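(* Let $G_1\rightrightarrows G_0$ be a strict Lie 2-group with associated crossed module $\partial:K\to G_0$, let $P_1\rightrightarrows P_0$ be a principal $(G_1\rightrightarrows G_0)$-bundle over a manifold $M$, and let $Q_1\rightrightarrows Q_0=P_0$ be its associated groupoid bundle gerbe. Then the Lie groupoids $P_1\rightrightarrows P_0$ and $Q_1\rightrightarrows Q_0$ admit left actions on $\Omega=P_1$ defined by $$\alpha_V:P_1\times_{s,P_0,s}P_1\to P_1,\quad (x,y)\mapsto yx^{-1},\qquad \alpha_H:Q_1\times_{s,P_0,t}P_1\to P_1,$$ where $\alpha_H$ is determined by $$\alpha_H((g,r),p)=\begin{cases}{}^gp,&\text{if } r={}^g1_{t(p)},\\ p\,({}^{(k,1)}1_{s(p)})^{-1},&\text{if }(g,r)=(\partial(k),{}^{(k^{-1},\partial(k))}1_{t(p)}).\end{cases}$$ Moreover, $\alpha_H$ and $\alpha_V$, together with the Lie 2-group action of $G_1\rightrightarrows G_0$ on $P$ and the action of $G_1\rightrightarrows G_0$ on $Q$, constitute a $(1,1)$-morphism of double Lie groupoids whose corners are: upper left, the Lie 2-group $G$; upper right and lower right, the manifold $M$; lower left, the submersion groupoid $P_0\times_MP_0\rightrightarrows P_0$; whose sides are: top, $P:M\dashrightarrow_hG$; left, $Q:(P_0\times_MP_0\rightrightarrows P_0)\dashrightarrow_vG$; bottom, the unit groupoid $P_0:M\dashrightarrow_h(P_0\times_MP_0\rightrightarrows P_0)$; right, $M:M\dashrightarrow_vM$ (the identity); and whose centre is $\Omega$, where the quotient map $\Omega\to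 M$ sends $p$ to the $G_0$-orbit of $t(p)$.
   Context: In a groupoid $gh$ is defined iff $s(g)=t(h)$. **Lie 2-group.** A strict Lie 2-group $G_1\rightrightarrows G_0$ corresponds to a crossed module $(\partial:K\to G_0,\ (g,k)\mapsto{}^gk)$ of Lie groups: $\partial({}^gk)=g\partial(k)g^{-1}$, ${}^{\partial(k)}k'=kk'k^{-1}$. Here $K=\ker s$, $G_1\cong K\times G_0$, $s(k,g)=g$, $t(k,g)=\partial(k)g$, groupoid composition $(k,\partial(k')g)(k',g)=(kk',g)$, group product $(k,g)(k',g')=(k({}^gk'),gg')$; $g\in G_0$ is identified with $1_g=(1,g)\in G_1$. It is viewed as a double Lie groupoid with $G_{11}=G_1$, $G_{10}=G_0$, $G_{01}=G_{00}=\ast$ (group structures horizontal, groupoid structure vertical). **Principal 2-bundle** over $M$: a Lie groupoid $P_1\rightrightarrows P_0$ with principal left group actions $G_i\times P_i\to P_i$, $(g,x)\mapsto{}^gx$ ($i=0,1$), together a groupoid morphism $G\times P\to P$ (a Lie 2-group action), with quotient the unit groupoid of $M$. $1_x$ is the unit at $x\in P_0$; ${}^gp:={}^{1_g}p$ for $g\in G_0,p\in P_1$. **Associated groupoid bundle gerbe**: $Q_1=G_0\times P_1\rightrightarrows Q_0=P_0$, $t(a,x)=t(x)$, $s(a,x)={}^{a^{-1}}s(x)$, $(a,x)(b,y)=(ab,x({}^ay))$; quotient morphism $Q_1\to P_0\times_MP_0$, $(a,x)\mapsto(t(x),{}^{a^{-1}}s(x))$; left action of the Lie groupoid $G_1\rightrightarrows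 G_0$ on $\mathrm{pr}:Q_1\to G_0$: $(k,a)\cdot(a,x)=(\partial(k)a,{}^{(k^{-1},\partial(k))}x)$. **Actions on $\Omega$**: $P$ acts with moment map $s:\Omega\to P_0$ and quotient map $t:\Omega\to P_0$ (bottom side); $Q$ acts with moment map $t:\Omega\to Q_0$ and quotient $\Omega\to M$. Elements $(g,{}^g1_x)$ and $(\partial(k),{}^{(k^{-1},\partial(k))}1_x)$ generate $Q_1$ under multiplication. **Double Lie groupoids and $(1,1)$-morphisms.** A double Lie groupoid $G$: manifolds $G_{11},G_{10},G_{01},G_{00}$ with Lie groupoids $G_{\bullet0}=(G_{10}\rightrightarrows G_{00})$, $G_{0\bullet}=(G_{01}\rightrightarrows G_{00})$, $G_{\bullet1}=(G_{11}\rightrightarrows G_{01})$ (horizontal), $G_{1\bullet}=(G_{11}\rightrightarrows G_{10})$ (vertical), structure maps in each direction being groupoid morphisms for the other. $M$ is the double groupoid with all four spaces $M$; the submersion groupoid is the one with $(11),(10)$ spaces $P_0\times_MP_0$ and $(01),(00)$ spaces $P_0$ (vertical structures units). HS bibundle $R:X\dashrightarrow Y$ of Lie groupoids: manifold $R$ with $l:R\to Y_0$, $r:R\to X_0$, commuting left $Y$-action along $l$ and right $X$-action along $r$ (each preserving the other's moment map), $r$ a surjective submersion, $Y_1\times_{s,Y_0,l}R\to R\times_{X_0}R$, $(y,p)\mapsto(yp,p)$, a diffeomorphism. Horizontal generalized morphism $A:G\dashrightarrow_hJ$: Lie groupoid $A$ with groupoid morphisms $l:A\to J_{0\bullet}$,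 $r:A\to G_{0\bullet}$, $A_i$ an HS bibundle $G_{\bullet i}\dashrightarrow J_{\bullet i}$, action maps groupoid morphisms. Vertical $C:G\dashrightarrow_vH$: same with directions exchanged. A $(1,1)$-morphism with lower right corner $G$, upper right $H$, lower left $J$, upper left $K$: $A:G\dashrightarrow_hJ$ (bottom), $D:H\dashrightarrow_hK$ (top), $C:G\dashrightarrow_vH$ (right), $B:J\dashrightarrow_vK$ (left), and a manifold $\Omega$ that is simultaneously an HS bibundle $C\dashrightarrow B$ (actions $\cdot_h$) and $A\dashrightarrow D$ (actions $\cdot_v$), with moment maps compatible with and equivariant along those of the sides, such that $(k\cdot_hd)\cdot_v(b\cdot_h\omega)=(k\cdot_vb)\cdot_h(d\cdot_v\omega)$ for $k\in K_{11},d\in D_1,b\in B_1,\omega\in\Omega$ whenever defined, and analogous equations at the other corners. *)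

theory Defs
  imports "HOL-Analysis.Analysis"
begin

section \<open>Smooth manifolds\<close>

text \<open>
  \<open>Euclidean_space n\<close> is the space of all \<open>x :: nat \<Rightarrow> real\<close> with \<open>x i = 0\<close> for \<open>i \<ge> n\<close>.
  Using it as the model space keeps the dimension a natural number (possibly 0), which is
  needed because fibre products have dimensions such as \<open>m + p - n\<close>.  Throughout, \<open>W\<close> is
  an open subset of \<open>Euclidean_space n\<close>.
\<close>

primrec Ck_on :: "nat \<Rightarrow> nat \<Rightarrow> (nat \<Rightarrow> real) set \<Rightarrow> ((nat \<Rightarrow> real) \<Rightarrow> real) \<Rightarrow> bool" where
  "Ck_on 0 n W f \<longleftrightarrow>
     continuous_map (subtopology (Euclidean_space n) W) euclideanreal f"
| "Ck_on (Suc k) n W f \<longleftrightarrow>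
     continuous_map (subtopology (Euclidean_space n) W) euclideanreal f \<and>
     (\<forall>i<n. \<exists>g. (\<forall>x\<in>W. ((\<lambda>u. f (x(i := u))) has_real_derivative g x) (at (x i))) \<and>
               Ck_on k n W g)"

definition smooth_on :: "nat \<Rightarrow> (nat \<Rightarrow> real) set \<Rightarrow> ((nat \<Rightarrow> real) \<Rightarrow> real) \<Rightarrow> bool" where
  "smooth_on n W f \<longleftrightarrow> (\<forall>k. Ck_on k n W f)"

record 'a manifold =
  mtop :: "'a topology"
  mdim :: nat
  atlas :: "('a set \<times> ('a \<Rightarrow> nat \<Rightarrow> real)) set"

abbreviation pts :: "'a manifold \<Rightarrow> 'a set" where
  "pts M \<equiv> topspace (mtop M)"

definition is_chart :: "nat \<Rightarrow> 'a topology \<Rightarrow> 'a set \<Rightarrow> ('a \<Rightarrow> nat \<Rightarrow> real) \<Rightarrow> bool" where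
  "is_chart n T U \<phi> \<longleftrightarrow>
     openin T U \<and> openin (Euclidean_space n) (\<phi> ` U) \<and>
     homeomorphic_map (subtopology T U) (subtopology (Euclidean_space n) (\<phi> ` U)) \<phi>"

definition smooth_transition ::
  "nat \<Rightarrow> 'a set \<Rightarrow> ('a \<Rightarrow> nat \<Rightarrow> real) \<Rightarrow> 'a set \<Rightarrow> ('a \<Rightarrow> nat \<Rightarrow> real) \<Rightarrow> bool" where
  "smooth_transition n U \<phi> V \<psi> \<longleftrightarrow>
     (\<forall>i<n. smooth_on n (\<phi> ` (U \<inter> V)) (\<lambda>x. \<psi> (inv_into U \<phi> x) i))"

definition is_manifold :: "'a manifold \<Rightarrow> bool" where
  "is_manifold M \<longleftrightarrow>
     Hausdorff_space (mtop M) \<and> second_countable (mtop M) \<and>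
     (\<forall>(U, \<phi>)\<in>atlas M. is_chart (mdim M) (mtop M) U \<phi>) \<and>
     (\<Union>(U, \<phi>)\<in>atlas M. U) = pts M \<and>
     (\<forall>(U, \<phi>)\<in>atlas M. \<forall>(V, \<psi>)\<in>atlas M. smooth_transition (mdim M) U \<phi> V \<psi>)"

definition maximal_atlas :: "'a manifold \<Rightarrow> ('a set \<times> ('a \<Rightarrow> nat \<Rightarrow> real)) set" where
  "maximal_atlas M = {(U, \<phi>). is_chart (mdim M) (mtop M) U \<phi> \<and>
     (\<forall>(V, \<psi>)\<in>atlas M. smooth_transition (mdim M) U \<phi> V \<psi> \<and>
                        smooth_transition (mdim M) V \<psi> U \<phi>)}"

definition smooth_map :: "'a manifold \<Rightarrow> 'b manifold \<Rightarrow> ('a \<Rightarrow> 'b) \<Rightarrow> bool" where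
  "smooth_map M N f \<longleftrightarrow>
     continuous_map (mtop M) (mtop N) f \<and>
     (\<forall>(U, \<phi>)\<in>atlas M. \<forall>(V, \<psi>)\<in>atlas N. \<forall>i<mdim N.
        smooth_on (mdim M) (\<phi> ` (U \<inter> f -` V)) (\<lambda>x. \<psi> (f (inv_into U \<phi> x)) i))"

definition diffeomorphism :: "'a manifold \<Rightarrow> 'b manifold \<Rightarrow> ('a \<Rightarrow> 'b) \<Rightarrow> bool" where
  "diffeomorphism M N f \<longleftrightarrow>
     (\<exists>g. smooth_map M N f \<and> smooth_map N M g \<and>
          (\<forall>x\<in>pts M. g (f x) = x) \<and> (\<forall>y\<in>pts N. f (g y) = y))"

text \<open>
  Submersions in the sense of Lang: near every point the map is, in suitable charts, the
  projection onto the first \<open>mdim N\<close> coordinates.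
\<close>

definition submersion :: "'a manifold \<Rightarrow> 'b manifold \<Rightarrow> ('a \<Rightarrow> 'b) \<Rightarrow> bool" where
  "submersion M N f \<longleftrightarrow>
     smooth_map M N f \<and>
     (\<forall>p\<in>pts M. mdim N \<le> mdim M \<and>
        (\<exists>(U, \<phi>)\<in>maximal_atlas M. \<exists>(V, \<psi>)\<in>maximal_atlas N.
           p \<in> U \<and> f ` U \<subseteq> V \<and> (\<forall>x\<in>U. \<forall>i<mdim N. \<psi> (f x) i = \<phi> x i)))"

definition surj_submersion :: "'a manifold \<Rightarrow> 'b manifold \<Rightarrow> ('a \<Rightarrow> 'b) \<Rightarrow> bool" where
  "surj_submersion M N f \<longleftrightarrow> submersion M N f \<and> f ` pts M = pts N"

definition point_manifold :: "unit manifold" where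
  "point_manifold =
     \<lparr> mtop = discrete_topology {()}, mdim = 0, atlas = {({()}, \<lambda>_ _. 0)} \<rparr>"

definition prod_manifold :: "'a manifold \<Rightarrow> 'b manifold \<Rightarrow> ('a \<times> 'b) manifold" where
  "prod_manifold M N =
     \<lparr> mtop = prod_topology (mtop M) (mtop N),
       mdim = mdim M + mdim N,
       atlas = {(U \<times> V, \<lambda>(x, y) i. if i < mdim M then \<phi> x i else \<psi> y (i - mdim M)) | U \<phi> V \<psi>.
                  (U, \<phi>) \<in> atlas M \<and> (V, \<psi>) \<in> atlas N} \<rparr>"

text \<open>
  The structure of a \<open>k\<close>-dimensional embedded submanifold \<open>S\<close> is given by the restrictions
  of slice charts; since \<open>Euclidean_space k \<subseteq> Euclidean_space n\<close> for \<open>k \<le> n\<close>, such a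
  restriction already takes its values in the \<open>k\<close>-dimensional model space.
\<close>

definition submanifold :: "'a manifold \<Rightarrow> 'a set \<Rightarrow> nat \<Rightarrow> 'a manifold" where
  "submanifold M S k =
     \<lparr> mtop = subtopology (mtop M) S,
       mdim = k,
       atlas = {(U \<inter> S, \<phi>) | U \<phi>. (U, \<phi>) \<in> maximal_atlas M \<and>
                  \<phi> ` (U \<inter> S) = \<phi> ` U \<inter> topspace (Euclidean_space k)} \<rparr>"

text \<open>
  \<open>fibre_product R f N g S\<close> is \<open>R \<times>\<^sub>N S = {(x, y). f x = g y}\<close>.  It is only used when one of
  \<open>f\<close>, \<open>g\<close> is a submersion onto \<open>N\<close>; then it is an embedded submanifold of the product, of
  the dimension given here.
\<close>

definition fibre_product ::
  "'a manifold \<Rightarrow> ('a \<Rightarrow> 'n) \<Rightarrow> 'n manifold \<Rightarrow> ('b \<Rightarrow> 'n) \<Rightarrow> 'b manifold \<Rightarrow> ('a \<times> 'b) manifold"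
  where
  "fibre_product R f N g S =
     submanifold (prod_manifold R S) {(x, y). f x = g y} (mdim R + mdim S - mdim N)"


section \<open>Lie groupoids\<close>

text \<open>The product \<open>mul X g h\<close> is meaningful iff \<open>src X g = tgt X h\<close>.\<close>

record ('a, 'o) groupoid =
  arr :: "'a manifold"
  obj :: "'o manifold"
  src :: "'a \<Rightarrow> 'o"
  tgt :: "'a \<Rightarrow> 'o"
  one :: "'o \<Rightarrow> 'a"
  ivr :: "'a \<Rightarrow> 'a"
  mul :: "'a \<Rightarrow> 'a \<Rightarrow> 'a"

definition lie_groupoid :: "('a, 'o) groupoid \<Rightarrow> bool" where
  "lie_groupoid X \<longleftrightarrow>
     is_manifold (arr X) \<and> is_manifold (obj X) \<and>
     surj_submersion (arr X) (obj X) (src X) \<and>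
     surj_submersion (arr X) (obj X) (tgt X) \<and>
     smooth_map (obj X) (arr X) (one X) \<and>
     smooth_map (arr X) (arr X) (ivr X) \<and>
     smooth_map (fibre_product (arr X) (src X) (obj X) (tgt X) (arr X)) (arr X)
       (\<lambda>(g, h). mul X g h) \<and>
     (\<forall>x\<in>pts (obj X). src X (one X x) = x \<and> tgt X (one X x) = x) \<and>
     (\<forall>g\<in>pts (arr X). \<forall>h\<in>pts (arr X). src X g = tgt X h \<longrightarrow>
        src X (mul X g h) = src X h \<and> tgt X (mul X g h) = tgt X g) \<and>
     (\<forall>g\<in>pts (arr X). \<forall>h\<in>pts (arr X). \<forall>k\<in>pts (arr X).
        src X g = tgt X h \<and> src X h = tgt X k \<longrightarrow>
        mul X (mul X g h) k = mul X g (mul X h k)) \<and>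
     (\<forall>g\<in>pts (arr X). mul X g (one X (src X g)) = g \<and> mul X (one X (tgt X g)) g = g) \<and>
     (\<forall>g\<in>pts (arr X). src X (ivr X g) = tgt X g \<and> tgt X (ivr X g) = src X g \<and>
        mul X g (ivr X g) = one X (tgt X g) \<and> mul X (ivr X g) g = one X (src X g))"

definition groupoid_morphism ::
  "('a, 'o) groupoid \<Rightarrow> ('b, 'p) groupoid \<Rightarrow> ('a \<Rightarrow> 'b) \<Rightarrow> ('o \<Rightarrow> 'p) \<Rightarrow> bool" where
  "groupoid_morphism X Y f1 f0 \<longleftrightarrow>
     smooth_map (arr X) (arr Y) f1 \<and> smooth_map (obj X) (obj Y) f0 \<and>
     (\<forall>g\<in>pts (arr X). src Y (f1 g) = f0 (src X g) \<and> tgt Y (f1 g) = f0 (tgt X g)) \<and>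
     (\<forall>x\<in>pts (obj X). f1 (one X x) = one Y (f0 x)) \<and>
     (\<forall>g\<in>pts (arr X). \<forall>h\<in>pts (arr X). src X g = tgt X h \<longrightarrow>
        f1 (mul X g h) = mul Y (f1 g) (f1 h))"

definition unit_groupoid :: "'a manifold \<Rightarrow> ('a, 'a) groupoid" where
  "unit_groupoid M =
     \<lparr> arr = M, obj = M, src = (\<lambda>x. x), tgt = (\<lambda>x. x), one = (\<lambda>x. x), ivr = (\<lambda>x. x),
       mul = (\<lambda>x y. x) \<rparr>"

definition submersion_groupoid ::
  "'a manifold \<Rightarrow> 'm manifold \<Rightarrow> ('a \<Rightarrow> 'm) \<Rightarrow> ('a \<times> 'a, 'a) groupoid" where
  "submersion_groupoid N M \<pi> =
     \<lparr> arr = fibre_product N \<pi> M \<pi> N, obj = N, src = snd, tgt = fst,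
       one = (\<lambda>x. (x, x)), ivr = (\<lambda>(x, y). (y, x)),
       mul = (\<lambda>(x, y) (y', z). (x, z)) \<rparr>"


section \<open>Actions and bibundles\<close>

definition left_action ::
  "('y, 'o) groupoid \<Rightarrow> 'r manifold \<Rightarrow> ('r \<Rightarrow> 'o) \<Rightarrow> ('y \<Rightarrow> 'r \<Rightarrow> 'r) \<Rightarrow> bool" where
  "left_action Y R l a \<longleftrightarrow>
     smooth_map R (obj Y) l \<and>
     smooth_map (fibre_product (arr Y) (src Y) (obj Y) l R) R (\<lambda>(y, p). a y p) \<and>
     (\<forall>y\<in>pts (arr Y). \<forall>p\<in>pts R. src Y y = l p \<longrightarrow> l (a y p) = tgt Y y) \<and>
     (\<forall>p\<in>pts R. a (one Y (l p)) p = p) \<and>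
     (\<forall>y\<in>pts (arr Y). \<forall>y'\<in>pts (arr Y). \<forall>p\<in>pts R. src Y y = tgt Y y' \<and> src Y y' = l p \<longrightarrow>
        a (mul Y y y') p = a y (a y' p))"

definition right_action ::
  "('x, 'o) groupoid \<Rightarrow> 'r manifold \<Rightarrow> ('r \<Rightarrow> 'o) \<Rightarrow> ('r \<Rightarrow> 'x \<Rightarrow> 'r) \<Rightarrow> bool" where
  "right_action X R r b \<longleftrightarrow>
     smooth_map R (obj X) r \<and>
     smooth_map (fibre_product R r (obj X) (tgt X) (arr X)) R (\<lambda>(p, x). b p x) \<and>
     (\<forall>p\<in>pts R. \<forall>x\<in>pts (arr X). r p = tgt X x \<longrightarrow> r (b p x) = src X x) \<and>
     (\<forall>p\<in>pts R. b p (one X (r p)) = p) \<and>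
     (\<forall>p\<in>pts R. \<forall>x\<in>pts (arr X). \<forall>x'\<in>pts (arr X). r p = tgt X x \<and> src X x = tgt X x' \<longrightarrow>
        b p (mul X x x') = b (b p x) x')"

text \<open>Principal action of \<open>Y\<close> on \<open>R\<close> (moment map \<open>l\<close>) with quotient map \<open>r : R \<rightarrow> N\<close>.\<close>

definition principal_left_bundle ::
  "('y, 'o) groupoid \<Rightarrow> 'r manifold \<Rightarrow> ('r \<Rightarrow> 'o) \<Rightarrow> ('y \<Rightarrow> 'r \<Rightarrow> 'r) \<Rightarrow>
   'n manifold \<Rightarrow> ('r \<Rightarrow> 'n) \<Rightarrow> bool" where
  "principal_left_bundle Y R l a N r \<longleftrightarrow>
     left_action Y R l a \<and> surj_submersion R N r \<and>
     (\<forall>y\<in>pts (arr Y). \<forall>p\<in>pts R. src Y y = l p \<longrightarrow> r (a y p) = r p) \<and>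
     diffeomorphism (fibre_product (arr Y) (src Y) (obj Y) l R) (fibre_product R r N r R)
       (\<lambda>(y, p). (a y p, p))"

text \<open>
  The data of an HS bibundle \<open>R : X \<dashrightarrow> Y\<close>, with left \<open>Y\<close>-action and right \<open>X\<close>-action.
\<close>

record ('r, 'y, 'yo, 'x, 'xo) bibundle =
  tot :: "'r manifold"
  lmom :: "'r \<Rightarrow> 'yo"
  rmom :: "'r \<Rightarrow> 'xo"
  lact :: "'y \<Rightarrow> 'r \<Rightarrow> 'r"
  ract :: "'r \<Rightarrow> 'x \<Rightarrow> 'r"

definition hs_bibundle ::
  "('x, 'xo) groupoid \<Rightarrow> ('y, 'yo) groupoid \<Rightarrow> ('r, 'y, 'yo, 'x, 'xo) bibundle \<Rightarrow> bool" where
  "hs_bibundle X Y R \<longleftrightarrow>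
     lie_groupoid X \<and> lie_groupoid Y \<and> is_manifold (tot R) \<and>
     principal_left_bundle Y (tot R) (lmom R) (lact R) (obj X) (rmom R) \<and>
     right_action X (tot R) (rmom R) (ract R) \<and>
     (\<forall>p\<in>pts (tot R). \<forall>x\<in>pts (arr X). rmom R p = tgt X x \<longrightarrow>
        lmom R (ract R p x) = lmom R p) \<and>
     (\<forall>y\<in>pts (arr Y). \<forall>p\<in>pts (tot R). \<forall>x\<in>pts (arr X).
        src Y y = lmom R p \<and> rmom R p = tgt X x \<longrightarrow>
        ract R (lact R y p) x = lact R y (ract R p x))"


section \<open>Double Lie groupoids and generalized morphisms\<close>

text \<open>
  For a double groupoid with spaces \<open>G\<^sub>1\<^sub>1, G\<^sub>1\<^sub>0, G\<^sub>0\<^sub>1, G\<^sub>0\<^sub>0\<close>: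
  \<open>hor1 = (G\<^sub>1\<^sub>1 \<rightrightarrows> G\<^sub>0\<^sub>1)\<close>, \<open>hor0 = (G\<^sub>1\<^sub>0 \<rightrightarrows> G\<^sub>0\<^sub>0)\<close>, \<open>ver1 = (G\<^sub>1\<^sub>1 \<rightrightarrows> G\<^sub>1\<^sub>0)\<close>, \<open>ver0 = (G\<^sub>0\<^sub>1 \<rightrightarrows> G\<^sub>0\<^sub>0)\<close>.
\<close>

record ('g11, 'g10, 'g01, 'g00) double_groupoid =
  hor1 :: "('g11, 'g01) groupoid"
  hor0 :: "('g10, 'g00) groupoid"
  ver1 :: "('g11, 'g10) groupoid"
  ver0 :: "('g01, 'g00) groupoid"

definition transpose_dg ::
  "('g11, 'g10, 'g01, 'g00) double_groupoid \<Rightarrow> ('g11, 'g01, 'g10, 'g00) double_groupoid" where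
  "transpose_dg G = \<lparr> hor1 = ver1 G, hor0 = ver0 G, ver1 = hor1 G, ver0 = hor0 G \<rparr>"

text \<open>
  The horizontal structure maps are morphisms for the vertical groupoids.  The
  multiplication is treated as a morphism on the composable pairs of arrows and objects;
  its last clause is the interchange law.
\<close>

definition hor_structure_maps_morphisms ::
  "('g11, 'g10, 'g01, 'g00) double_groupoid \<Rightarrow> bool" where
  "hor_structure_maps_morphisms G \<longleftrightarrow>
     groupoid_morphism (ver1 G) (ver0 G) (src (hor1 G)) (src (hor0 G)) \<and>
     groupoid_morphism (ver1 G) (ver0 G) (tgt (hor1 G)) (tgt (hor0 G)) \<and>
     groupoid_morphism (ver0 G) (ver1 G) (one (hor1 G)) (one (hor0 G)) \<and>
     groupoid_morphism (ver1 G) (ver1 G) (ivr (hor1 G)) (ivr (hor0 G)) \<and>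
     (\<forall>g\<in>pts (arr (hor1 G)). \<forall>h\<in>pts (arr (hor1 G)). src (hor1 G) g = tgt (hor1 G) h \<longrightarrow>
        src (ver1 G) (mul (hor1 G) g h) = mul (hor0 G) (src (ver1 G) g) (src (ver1 G) h) \<and>
        tgt (ver1 G) (mul (hor1 G) g h) = mul (hor0 G) (tgt (ver1 G) g) (tgt (ver1 G) h)) \<and>
     (\<forall>x\<in>pts (arr (hor0 G)). \<forall>y\<in>pts (arr (hor0 G)). src (hor0 G) x = tgt (hor0 G) y \<longrightarrow>
        one (ver1 G) (mul (hor0 G) x y) = mul (hor1 G) (one (ver1 G) x) (one (ver1 G) y)) \<and>
     (\<forall>g\<in>pts (arr (hor1 G)). \<forall>g'\<in>pts (arr (hor1 G)).
      \<forall>h\<in>pts (arr (hor1 G)). \<forall>h'\<in>pts (arr (hor1 G)).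
        src (ver1 G) g = tgt (ver1 G) g' \<and> src (ver1 G) h = tgt (ver1 G) h' \<and>
        src (hor1 G) g = tgt (hor1 G) h \<and> src (hor1 G) g' = tgt (hor1 G) h' \<longrightarrow>
        mul (hor1 G) (mul (ver1 G) g g') (mul (ver1 G) h h') =
        mul (ver1 G) (mul (hor1 G) g h) (mul (hor1 G) g' h'))"

definition double_lie_groupoid :: "('g11, 'g10, 'g01, 'g00) double_groupoid \<Rightarrow> bool" where
  "double_lie_groupoid G \<longleftrightarrow>
     lie_groupoid (hor1 G) \<and> lie_groupoid (hor0 G) \<and>
     lie_groupoid (ver1 G) \<and> lie_groupoid (ver0 G) \<and>
     arr (hor1 G) = arr (ver1 G) \<and> arr (hor0 G) = obj (ver1 G) \<and>
     arr (ver0 G) = obj (hor1 G) \<and> obj (hor0 G) = obj (ver0 G) \<and>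
     hor_structure_maps_morphisms G \<and> hor_structure_maps_morphisms (transpose_dg G)"

definition manifold_dg :: "'m manifold \<Rightarrow> ('m, 'm, 'm, 'm) double_groupoid" where
  "manifold_dg M = \<lparr> hor1 = unit_groupoid M, hor0 = unit_groupoid M,
                     ver1 = unit_groupoid M, ver0 = unit_groupoid M \<rparr>"

definition submersion_dg ::
  "'a manifold \<Rightarrow> 'm manifold \<Rightarrow> ('a \<Rightarrow> 'm) \<Rightarrow> ('a \<times> 'a, 'a \<times> 'a, 'a, 'a) double_groupoid" where
  "submersion_dg N M \<pi> =
     \<lparr> hor1 = submersion_groupoid N M \<pi>, hor0 = submersion_groupoid N M \<pi>,
       ver1 = unit_groupoid (fibre_product N \<pi> M \<pi> N), ver0 = unit_groupoid N \<rparr>"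

text \<open>
  Left (right) action maps as groupoid morphisms \<open>V \<times> A \<rightarrow> A\<close> (\<open>A \<times> V \<rightarrow> A\<close>) on the fibre
  products.  In the left version \<open>sh1\<close>, \<open>sh0\<close> are the maps of \<open>V\<close> and \<open>l1\<close>, \<open>l0\<close> the moment
  maps of \<open>A\<close> over which the fibre products are formed; similarly on the right.
\<close>

definition left_action_morphism ::
  "('v, 'vo) groupoid \<Rightarrow> ('v \<Rightarrow> 'b) \<Rightarrow> ('vo \<Rightarrow> 'bo) \<Rightarrow> ('a, 'ao) groupoid \<Rightarrow>
   ('a \<Rightarrow> 'b) \<Rightarrow> ('ao \<Rightarrow> 'bo) \<Rightarrow> ('v \<Rightarrow> 'a \<Rightarrow> 'a) \<Rightarrow> ('vo \<Rightarrow> 'ao \<Rightarrow> 'ao) \<Rightarrow> bool" where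
  "left_action_morphism V sh1 sh0 A l1 l0 act1 act0 \<longleftrightarrow>
     (\<forall>v\<in>pts (arr V). \<forall>a\<in>pts (arr A). sh1 v = l1 a \<longrightarrow>
        src A (act1 v a) = act0 (src V v) (src A a) \<and>
        tgt A (act1 v a) = act0 (tgt V v) (tgt A a)) \<and>
     (\<forall>v\<in>pts (obj V). \<forall>x\<in>pts (obj A). sh0 v = l0 x \<longrightarrow>
        act1 (one V v) (one A x) = one A (act0 v x)) \<and>
     (\<forall>v\<in>pts (arr V). \<forall>v'\<in>pts (arr V). \<forall>a\<in>pts (arr A). \<forall>a'\<in>pts (arr A).
        sh1 v = l1 a \<and> sh1 v' = l1 a' \<and> src V v = tgt V v' \<and> src A a = tgt A a' \<longrightarrow>
        act1 (mul V v v') (mul A a a') = mul A (act1 v a) (act1 v' a'))"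

definition right_action_morphism ::
  "('v, 'vo) groupoid \<Rightarrow> ('v \<Rightarrow> 'b) \<Rightarrow> ('vo \<Rightarrow> 'bo) \<Rightarrow> ('a, 'ao) groupoid \<Rightarrow>
   ('a \<Rightarrow> 'b) \<Rightarrow> ('ao \<Rightarrow> 'bo) \<Rightarrow> ('a \<Rightarrow> 'v \<Rightarrow> 'a) \<Rightarrow> ('ao \<Rightarrow> 'vo \<Rightarrow> 'ao) \<Rightarrow> bool" where
  "right_action_morphism V th1 th0 A r1 r0 act1 act0 \<longleftrightarrow>
     left_action_morphism V th1 th0 A r1 r0 (\<lambda>v a. act1 a v) (\<lambda>v x. act0 x v)"

text \<open>
  Data of a horizontal generalized morphism \<open>A : G \<dashrightarrow>\<^sub>h J\<close>: \<open>bib i\<close> is the bibundle structure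
  of \<open>A\<^sub>i\<close>.  The morphisms \<open>A \<rightarrow> J\<^sub>0\<^sub>\<bullet>\<close> and \<open>A \<rightarrow> G\<^sub>0\<^sub>\<bullet>\<close> are formed by the moment maps.
\<close>

record ('a1, 'a0, 'j11, 'j10, 'j01, 'j00, 'g11, 'g10, 'g01, 'g00) gen_morphism =
  gpd :: "('a1, 'a0) groupoid"
  bib1 :: "('a1, 'j11, 'j01, 'g11, 'g01) bibundle"
  bib0 :: "('a0, 'j10, 'j00, 'g10, 'g00) bibundle"

definition horizontal_morphism ::
  "('g11, 'g10, 'g01, 'g00) double_groupoid \<Rightarrow> ('j11, 'j10, 'j01, 'j00) double_groupoid \<Rightarrow>
   ('a1, 'a0, 'j11, 'j10, 'j01, 'j00, 'g11, 'g10, 'g01, 'g00) gen_morphism \<Rightarrow> bool" where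
  "horizontal_morphism G J A \<longleftrightarrow>
     lie_groupoid (gpd A) \<and> tot (bib1 A) = arr (gpd A) \<and> tot (bib0 A) = obj (gpd A) \<and>
     groupoid_morphism (gpd A) (ver0 J) (lmom (bib1 A)) (lmom (bib0 A)) \<and>
     groupoid_morphism (gpd A) (ver0 G) (rmom (bib1 A)) (rmom (bib0 A)) \<and>
     hs_bibundle (hor1 G) (hor1 J) (bib1 A) \<and>
     hs_bibundle (hor0 G) (hor0 J) (bib0 A) \<and>
     left_action_morphism (ver1 J) (src (hor1 J)) (src (hor0 J)) (gpd A)
       (lmom (bib1 A)) (lmom (bib0 A)) (lact (bib1 A)) (lact (bib0 A)) \<and>
     right_action_morphism (ver1 G) (tgt (hor1 G)) (tgt (hor0 G)) (gpd A)
       (rmom (bib1 A)) (rmom (bib0 A)) (ract (bib1 A)) (ract (bib0 A))"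

definition vertical_morphism ::
  "('g11, 'g10, 'g01, 'g00) double_groupoid \<Rightarrow> ('h11, 'h10, 'h01, 'h00) double_groupoid \<Rightarrow>
   ('c1, 'c0, 'h11, 'h01, 'h10, 'h00, 'g11, 'g01, 'g10, 'g00) gen_morphism \<Rightarrow> bool" where
  "vertical_morphism G H C \<longleftrightarrow> horizontal_morphism (transpose_dg G) (transpose_dg H) C"

text \<open>
  A \<open>(1,1)\<close>-morphism with corners \<open>K\<close> (upper left), \<open>H\<close> (upper right), \<open>J\<close> (lower left), \<open>G\<close>
  (lower right), sides \<open>D : H \<dashrightarrow>\<^sub>h K\<close> (top), \<open>B : J \<dashrightarrow>\<^sub>v K\<close> (left), \<open>A : G \<dashrightarrow>\<^sub>h J\<close> (bottom),
  \<open>C : G \<dashrightarrow>\<^sub>v H\<close> (right), and centre \<open>tot \<Omega>h = tot \<Omega>v\<close>: \<open>\<Omega>h : C \<dashrightarrow> B\<close> carries the horizontal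
  and \<open>\<Omega>v : A \<dashrightarrow> D\<close> the vertical actions.
\<close>

definition moments_compatible where
  "moments_compatible A B C D \<Omega>h \<Omega>v \<longleftrightarrow>
     (\<forall>w\<in>pts (tot \<Omega>h).
        lmom (bib0 D) (lmom \<Omega>v w) = lmom (bib0 B) (lmom \<Omega>h w) \<and>
        rmom (bib0 D) (lmom \<Omega>v w) = lmom (bib0 C) (rmom \<Omega>h w) \<and>
        lmom (bib0 A) (rmom \<Omega>v w) = rmom (bib0 B) (lmom \<Omega>h w) \<and>
        rmom (bib0 A) (rmom \<Omega>v w) = rmom (bib0 C) (rmom \<Omega>h w))"

definition moments_equivariant where
  "moments_equivariant A B C D \<Omega>h \<Omega>v \<longleftrightarrow>
     (\<forall>d\<in>pts (arr (gpd D)). \<forall>w\<in>pts (tot \<Omega>v). src (gpd D) d = lmom \<Omega>v w \<longrightarrow>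
        lmom \<Omega>h (lact \<Omega>v d w) = lact (bib0 B) (lmom (bib1 D) d) (lmom \<Omega>h w) \<and>
        rmom \<Omega>h (lact \<Omega>v d w) = lact (bib0 C) (rmom (bib1 D) d) (rmom \<Omega>h w)) \<and>
     (\<forall>a\<in>pts (arr (gpd A)). \<forall>w\<in>pts (tot \<Omega>v). rmom \<Omega>v w = tgt (gpd A) a \<longrightarrow>
        lmom \<Omega>h (ract \<Omega>v w a) = ract (bib0 B) (lmom \<Omega>h w) (lmom (bib1 A) a) \<and>
        rmom \<Omega>h (ract \<Omega>v w a) = ract (bib0 C) (rmom \<Omega>h w) (rmom (bib1 A) a)) \<and>
     (\<forall>b\<in>pts (arr (gpd B)). \<forall>w\<in>pts (tot \<Omega>h). src (gpd B) b = lmom \<Omega>h w \<longrightarrow>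
        lmom \<Omega>v (lact \<Omega>h b w) = lact (bib0 D) (lmom (bib1 B) b) (lmom \<Omega>v w) \<and>
        rmom \<Omega>v (lact \<Omega>h b w) = lact (bib0 A) (rmom (bib1 B) b) (rmom \<Omega>v w)) \<and>
     (\<forall>c\<in>pts (arr (gpd C)). \<forall>w\<in>pts (tot \<Omega>h). rmom \<Omega>h w = tgt (gpd C) c \<longrightarrow>
        lmom \<Omega>v (ract \<Omega>h w c) = ract (bib0 D) (lmom \<Omega>v w) (lmom (bib1 C) c) \<and>
        rmom \<Omega>v (ract \<Omega>h w c) = ract (bib0 A) (rmom \<Omega>v w) (rmom (bib1 C) c))"

text \<open>
  The interchange equations, in this order: \<open>(kd)(b\<omega>) = (kb)(d\<omega>)\<close>, \<open>(dh)(\<omega>c) = (d\<omega>)(hc)\<close>,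
  \<open>(b\<omega>)(ja) = (bj)(\<omega>a)\<close>, \<open>(\<omega>a)(cg) = (\<omega>c)(ag)\<close>.  The premises express that both sides are
  defined.
\<close>

definition corner_interchange where
  "corner_interchange K H J G A B C D \<Omega>h \<Omega>v \<longleftrightarrow>
     (\<forall>k\<in>pts (arr (hor1 K)). \<forall>d\<in>pts (arr (gpd D)). \<forall>b\<in>pts (arr (gpd B)). \<forall>w\<in>pts (tot \<Omega>h).
        src (hor1 K) k = lmom (bib1 D) d \<and> src (ver1 K) k = lmom (bib1 B) b \<and>
        src (gpd D) d = lmom \<Omega>v w \<and> src (gpd B) b = lmom \<Omega>h w \<longrightarrow>
        lact \<Omega>v (lact (bib1 D) k d) (lact \<Omega>h b w) =
        lact \<Omega>h (lact (bib1 B) k b) (lact \<Omega>v d w)) \<and>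
     (\<forall>h\<in>pts (arr (hor1 H)). \<forall>d\<in>pts (arr (gpd D)). \<forall>c\<in>pts (arr (gpd C)). \<forall>w\<in>pts (tot \<Omega>h).
        rmom (bib1 D) d = tgt (hor1 H) h \<and> src (ver1 H) h = lmom (bib1 C) c \<and>
        src (gpd D) d = lmom \<Omega>v w \<and> rmom \<Omega>h w = tgt (gpd C) c \<longrightarrow>
        lact \<Omega>v (ract (bib1 D) d h) (ract \<Omega>h w c) =
        ract \<Omega>h (lact \<Omega>v d w) (lact (bib1 C) h c)) \<and>
     (\<forall>j\<in>pts (arr (hor1 J)). \<forall>a\<in>pts (arr (gpd A)). \<forall>b\<in>pts (arr (gpd B)). \<forall>w\<in>pts (tot \<Omega>h).
        src (hor1 J) j = lmom (bib1 A) a \<and> rmom (bib1 B) b = tgt (ver1 J) j \<and>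
        rmom \<Omega>v w = tgt (gpd A) a \<and> src (gpd B) b = lmom \<Omega>h w \<longrightarrow>
        ract \<Omega>v (lact \<Omega>h b w) (lact (bib1 A) j a) =
        lact \<Omega>h (ract (bib1 B) b j) (ract \<Omega>v w a)) \<and>
     (\<forall>g\<in>pts (arr (hor1 G)). \<forall>a\<in>pts (arr (gpd A)). \<forall>c\<in>pts (arr (gpd C)). \<forall>w\<in>pts (tot \<Omega>h).
        rmom (bib1 A) a = tgt (hor1 G) g \<and> rmom (bib1 C) c = tgt (ver1 G) g \<and>
        rmom \<Omega>v w = tgt (gpd A) a \<and> rmom \<Omega>h w = tgt (gpd C) c \<longrightarrow>
        ract \<Omega>h (ract \<Omega>v w a) (ract (bib1 C) c g) =
        ract \<Omega>v (ract \<Omega>h w c) (ract (bib1 A) a g))"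

definition one_one_morphism ::
  "('k11, 'k10, 'k01, 'k00) double_groupoid \<Rightarrow> ('h11, 'h10, 'h01, 'h00) double_groupoid \<Rightarrow>
   ('j11, 'j10, 'j01, 'j00) double_groupoid \<Rightarrow> ('g11, 'g10, 'g01, 'g00) double_groupoid \<Rightarrow>
   ('d1, 'd0, 'k11, 'k10, 'k01, 'k00, 'h11, 'h10, 'h01, 'h00) gen_morphism \<Rightarrow>
   ('b1, 'b0, 'k11, 'k01, 'k10, 'k00, 'j11, 'j01, 'j10, 'j00) gen_morphism \<Rightarrow>
   ('a1, 'a0, 'j11, 'j10, 'j01, 'j00, 'g11, 'g10, 'g01, 'g00) gen_morphism \<Rightarrow>
   ('c1, 'c0, 'h11, 'h01, 'h10, 'h00, 'g11, 'g01, 'g10, 'g00) gen_morphism \<Rightarrow>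
   ('w, 'b1, 'b0, 'c1, 'c0) bibundle \<Rightarrow> ('w, 'd1, 'd0, 'a1, 'a0) bibundle \<Rightarrow> bool" where
  "one_one_morphism K H J G D B A C \<Omega>h \<Omega>v \<longleftrightarrow>
     double_lie_groupoid K \<and> double_lie_groupoid H \<and>
     double_lie_groupoid J \<and> double_lie_groupoid G \<and>
     horizontal_morphism H K D \<and> vertical_morphism J K B \<and>
     horizontal_morphism G J A \<and> vertical_morphism G H C \<and>
     tot \<Omega>h = tot \<Omega>v \<and>
     hs_bibundle (gpd C) (gpd B) \<Omega>h \<and> hs_bibundle (gpd A) (gpd D) \<Omega>v \<and>
     moments_compatible A B C D \<Omega>h \<Omega>v \<and> moments_equivariant A B C D \<Omega>h \<Omega>v \<and>
     corner_interchange K H J G A B C D \<Omega>h \<Omega>v"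


section \<open>Lie 2-groups, principal 2-bundles and their bundle gerbes\<close>

text \<open>
  A strict Lie 2-group \<open>G\<^sub>1 \<rightrightarrows> G\<^sub>0\<close>: \<open>hor1 G\<close> and \<open>hor0 G\<close> are the Lie groups \<open>G\<^sub>1\<close> and \<open>G\<^sub>0\<close>
  (Lie groupoids over the point), \<open>ver1 G\<close> is the Lie groupoid \<open>G\<^sub>1 \<rightrightarrows> G\<^sub>0\<close>.
\<close>

type_synonym ('g1, 'g0) two_group = "('g1, 'g0, unit, unit) double_groupoid"

definition lie_2_group :: "('g1, 'g0) two_group \<Rightarrow> bool" where
  "lie_2_group G \<longleftrightarrow> double_lie_groupoid G \<and> ver0 G = unit_groupoid point_manifold"

text \<open>
  The associated crossed module: \<open>K = ker s\<close>, a subgroup of \<open>G\<^sub>1\<close>; \<open>\<partial>\<close> is the restriction of the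
  target map.  The pair \<open>(k, g) \<in> K \<times> G\<^sub>0\<close> stands for the element \<open>k 1\<^sub>g\<close> of \<open>G\<^sub>1\<close> (group
  product), and every element of \<open>G\<^sub>1\<close> is of this form with \<open>g\<close> its source; \<open>cm_part\<close>
  is the projection to \<open>K\<close>.  The action \<open>\<^sup>gk\<close> is conjugation by \<open>1\<^sub>g\<close> in \<open>G\<^sub>1\<close>.
\<close>

definition cm_ker :: "('g1, 'g0) two_group \<Rightarrow> 'g1 set" where
  "cm_ker G = {k \<in> pts (arr (ver1 G)). src (ver1 G) k = one (hor0 G) ()}"

definition cm_bd :: "('g1, 'g0) two_group \<Rightarrow> 'g1 \<Rightarrow> 'g0" where
  "cm_bd G k = tgt (ver1 G) k"

definition cm_pair :: "('g1, 'g0) two_group \<Rightarrow> 'g1 \<Rightarrow> 'g0 \<Rightarrow> 'g1" where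
  "cm_pair G k g = mul (hor1 G) k (one (ver1 G) g)"

definition cm_part :: "('g1, 'g0) two_group \<Rightarrow> 'g1 \<Rightarrow> 'g1" where
  "cm_part G \<gamma> = mul (hor1 G) \<gamma> (ivr (hor1 G) (one (ver1 G) (src (ver1 G) \<gamma>)))"

definition principal_2_bundle ::
  "('g1, 'g0) two_group \<Rightarrow> ('p1, 'p0) groupoid \<Rightarrow> ('g1 \<Rightarrow> 'p1 \<Rightarrow> 'p1) \<Rightarrow> ('g0 \<Rightarrow> 'p0 \<Rightarrow> 'p0) \<Rightarrow>
   'm manifold \<Rightarrow> ('p0 \<Rightarrow> 'm) \<Rightarrow> bool" where
  "principal_2_bundle G P act1 act0 M \<pi> \<longleftrightarrow>
     lie_groupoid P \<and> is_manifold M \<and>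
     principal_left_bundle (hor1 G) (arr P) (\<lambda>_. ()) act1 M (\<lambda>p. \<pi> (src P p)) \<and>
     principal_left_bundle (hor0 G) (obj P) (\<lambda>_. ()) act0 M \<pi> \<and>
     left_action_morphism (ver1 G) (\<lambda>_. ()) (\<lambda>_. ()) P (\<lambda>_. ()) (\<lambda>_. ()) act1 act0 \<and>
     (\<forall>p\<in>pts (arr P). \<pi> (tgt P p) = \<pi> (src P p))"

definition gerbe_groupoid ::
  "('g1, 'g0) two_group \<Rightarrow> ('p1, 'p0) groupoid \<Rightarrow> ('g1 \<Rightarrow> 'p1 \<Rightarrow> 'p1) \<Rightarrow> ('g0 \<Rightarrow> 'p0 \<Rightarrow> 'p0) \<Rightarrow>
   ('g0 \<times> 'p1, 'p0) groupoid" where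
  "gerbe_groupoid G P act1 act0 =
     \<lparr> arr = prod_manifold (arr (hor0 G)) (arr P),
       obj = obj P,
       src = (\<lambda>(a, x). act0 (ivr (hor0 G) a) (src P x)),
       tgt = (\<lambda>(a, x). tgt P x),
       one = (\<lambda>x. (one (hor0 G) (), one P x)),
       ivr = (\<lambda>(a, x). (ivr (hor0 G) a, act1 (one (ver1 G) (ivr (hor0 G) a)) (ivr P x))),
       mul = (\<lambda>(a, x) (b, y). (mul (hor0 G) a b, mul P x (act1 (one (ver1 G) a) y))) \<rparr>"

text \<open>\<open>(k, a) \<cdot> (a, x) = (\<partial>(k) a, (k\<inverse>, \<partial>(k)) x)\<close>, for \<open>\<gamma> = (k, a)\<close>.\<close>

definition gerbe_act ::
  "('g1, 'g0) two_group \<Rightarrow> ('g1 \<Rightarrow> 'p1 \<Rightarrow> 'p1) \<Rightarrow> 'g1 \<Rightarrow> 'g0 \<times> 'p1 \<Rightarrow> 'g0 \<times> 'p1" where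
  "gerbe_act G act1 \<gamma> = (\<lambda>(a, x). let k = cm_part G \<gamma> in
     (mul (hor0 G) (cm_bd G k) a,
      act1 (cm_pair G (ivr (hor1 G) k) (cm_bd G k)) x))"


section \<open>The square associated with a principal 2-bundle\<close>

definition top_side where
  "top_side P act1 act0 \<pi> =
     \<lparr> gpd = P,
       bib1 = \<lparr> tot = arr P, lmom = (\<lambda>_. ()), rmom = (\<lambda>p. \<pi> (src P p)),
                lact = act1, ract = (\<lambda>p m. p) \<rparr>,
       bib0 = \<lparr> tot = obj P, lmom = (\<lambda>_. ()), rmom = \<pi>,
                lact = act0, ract = (\<lambda>x m. x) \<rparr> \<rparr>"

definition left_side where
  "left_side G P act1 act0 =
     (let Q = gerbe_groupoid G P act1 act0 in
     \<lparr> gpd = Q,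
       bib1 = \<lparr> tot = arr Q, lmom = fst, rmom = (\<lambda>q. (tgt Q q, src Q q)),
                lact = gerbe_act G act1, ract = (\<lambda>q z. q) \<rparr>,
       bib0 = \<lparr> tot = obj Q, lmom = (\<lambda>_. ()), rmom = (\<lambda>x. x),
                lact = (\<lambda>u x. x), ract = (\<lambda>x y. x) \<rparr> \<rparr>)"

text \<open>\<open>P\<^sub>0\<close> with the canonical left action \<open>(x, y) \<cdot> y = x\<close> of \<open>P\<^sub>0 \<times>\<^sub>M P\<^sub>0 \<rightrightarrows> P\<^sub>0\<close>.\<close>

definition bottom_side where
  "bottom_side P0 \<pi> =
     (let R = \<lparr> tot = P0, lmom = (\<lambda>x. x), rmom = \<pi>,
                lact = (\<lambda>(x, y) z. x), ract = (\<lambda>x m. x) \<rparr>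
      in \<lparr> gpd = unit_groupoid P0, bib1 = R, bib0 = R \<rparr>)"

definition identity_side where
  "identity_side M =
     (let R = \<lparr> tot = M, lmom = (\<lambda>x. x), rmom = (\<lambda>x. x),
                lact = (\<lambda>m x. x), ract = (\<lambda>x m. x) \<rparr>
      in \<lparr> gpd = unit_groupoid M, bib1 = R, bib0 = R \<rparr>)"

definition centre_hor where
  "centre_hor P \<pi> \<alpha>H =
     \<lparr> tot = arr P, lmom = tgt P, rmom = (\<lambda>p. \<pi> (tgt P p)),
       lact = \<alpha>H, ract = (\<lambda>p m. p) \<rparr>"

definition centre_ver where
  "centre_ver P \<alpha>V =
     \<lparr> tot = arr P, lmom = src P, rmom = tgt P, lact = \<alpha>V, ract = (\<lambda>p x. p) \<rparr>"

definition alpha_V :: "('p1, 'p0) groupoid \<Rightarrow> 'p1 \<Rightarrow> 'p1 \<Rightarrow> 'p1" where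
  "alpha_V P x y = mul P y (ivr P x)"

text \<open>The two prescribed cases for the values \<open>\<alpha>\<^sub>H((g, r), p)\<close>.\<close>

definition alpha_H_cases ::
  "('g1, 'g0) two_group \<Rightarrow> ('p1, 'p0) groupoid \<Rightarrow> ('g1 \<Rightarrow> 'p1 \<Rightarrow> 'p1) \<Rightarrow> ('g0 \<Rightarrow> 'p0 \<Rightarrow> 'p0) \<Rightarrow>
   ('g0 \<times> 'p1 \<Rightarrow> 'p1 \<Rightarrow> 'p1) \<Rightarrow> bool" where
  "alpha_H_cases G P act1 act0 \<alpha>H \<longleftrightarrow>
     (\<forall>g\<in>pts (arr (hor0 G)). \<forall>r\<in>pts (arr P). \<forall>p\<in>pts (arr P).
        src (gerbe_groupoid G P act1 act0) (g, r) = tgt P p \<longrightarrow>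
        (r = act1 (one (ver1 G) g) (one P (tgt P p)) \<longrightarrow>
           \<alpha>H (g, r) p = act1 (one (ver1 G) g) p) \<and>
        (\<forall>k\<in>cm_ker G.
           g = cm_bd G k \<and>
           r = act1 (cm_pair G (ivr (hor1 G) k) (cm_bd G k)) (one P (tgt P p)) \<longrightarrow>
           \<alpha>H (g, r) p =
           mul P p (ivr P (act1 (cm_pair G k (one (hor0 G) ())) (one P (src P p))))))"

end

theory Submission
  imports "HOL-Homology.Invariance_of_Domain" Defs
begin

text \<open>
  On \<open>\<Omega> = P\<^sub>1\<close> the horizontal action has the closed form \<open>(a, x) \<cdot> p = x (\<^sup>ap)\<close>.  Since
  \<open>G \<times> P \<rightarrow> P\<close> is a morphism of groupoids, this is an action of \<open>Q\<close> and takes the two prescribed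
  values; it is the only one because \<open>G\<^sub>1\<close> is transitive on the fibres of \<open>P\<^sub>1 \<rightarrow> M\<close>, so that every
  element of \<open>Q\<^sub>1\<close> is a product of two elements for which the value is prescribed.  Principality of an
  action amounts to a smooth division map, and all division maps needed here are composed of those of
  the principal \<open>G\<^sub>i\<close>-bundles \<open>P\<^sub>i \<rightarrow> M\<close> and of inversion in \<open>P\<close> and \<open>G\<close>.  The map
  \<open>Q\<^sub>1 \<rightarrow> P\<^sub>0 \<times>\<^sub>M P\<^sub>0\<close> is a submersion since, up to diffeomorphisms of the source and the target, it is
  \<open>id \<times> t : G\<^sub>0 \<times> P\<^sub>1 \<rightarrow> G\<^sub>0 \<times> P\<^sub>0\<close>.
\<close>

subsection \<open>Calculus on open subsets of Euclidean space\<close>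

text \<open>The product x (^a p) is defined exactly when \<open>(a, x)\<close> and p are composable,
  since ^(a^-1) s(x) = t(p) means s(x) = t(^a p). The second prescribed value has its form because
  the element (k^-1, \<partial>(k)) is the inverse of k in the groupoid G_1 over G_0: writing p as 1
  p or as p 1, an arrow acting on p splits off as a factor on the left of p or on the right of p.
  The same passage of a factor across a product gives the one substantial interchange law. The
  analytic obstacle is the form of the definitions: smoothness means iterated partial derivatives,
  and submersions are described by adapted charts. Whenever a new chart is required, its inverse is
  written down as a smooth map, and openness of its image is then a matter of invariance of domain.
  That theorem also shows that diffeomorphic nonempty manifolds carry the same number
  \<open>mdim\<close>, to which the adapted charts refer.\<close>

abbreviation Esp :: "nat \<Rightarrow> (nat \<Rightarrow> real) set" where
  "Esp n \<equiv> topspace (Euclidean_space n)"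

lemma Esp_iff: "x \<in> Esp n \<longleftrightarrow> (\<forall>i\<ge>n. x i = 0)"
  by (simp add: topspace_Euclidean_space)

lemma Euclidean_space_top_of_set: "Euclidean_space n = top_of_set {x. \<forall>i\<ge>n. x i = 0}"
  by (simp add: Euclidean_space_def euclidean_product_topology)

text \<open>Both topologies restrict the product topology on \<open>nat \<Rightarrow> real\<close>,
  so continuity in the sense of the type classes can be used on subsets of the model space.\<close>

lemma cm_real_iff:
  assumes "W \<subseteq> Esp n"
  shows "continuous_map (subtopology (Euclidean_space n) W) euclideanreal f \<longleftrightarrow> continuous_on W f"
proof -
  have "subtopology (Euclidean_space n) W = top_of_set W"
    using assms unfolding Euclidean_space_top_of_set subtopology_subtopology
    by (simp add: Int_absorb1)
  then show ?thesis by simp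
qed

lemma openin_Esp_subset: "openin (Euclidean_space n) W \<Longrightarrow> W \<subseteq> Esp n"
  by (rule openin_subset)

text \<open>A basic open set of the infinite product prescribes an open set for every coordinate,
  but points of the model space agree, being zero, from index n on. Only n radii remain, and their
  minimum serves.\<close>

lemma openin_Esp_box:
  assumes W: "openin (Euclidean_space n) W" and x: "x \<in> W"
  obtains e where "e > 0"
    "\<And>y. y \<in> Esp n \<Longrightarrow> (\<And>i. i < n \<Longrightarrow> \<bar>y i - x i\<bar> < e) \<Longrightarrow> y \<in> W"
proof -
  obtain T where T: "openin (powertop_real UNIV) T" "W = T \<inter> {x. \<forall>i\<ge>n. x i = 0}"
    using W unfolding Euclidean_space_def openin_subtopology by blast
  obtain X where X: "x \<in> Pi\<^sub>E UNIV X" "\<And>i. open (X i)" "Pi\<^sub>E UNIV X \<subseteq> T"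
    using product_topology_open_contains_basis[OF T(1)] x T(2) by (metis IntD1 open_openin)
  have "\<exists>e>0. \<forall>v. \<bar>v - x i\<bar> < e \<longrightarrow> v \<in> X i" for i
    using X(2)[of i] X(1) unfolding open_dist by (metis PiE_E UNIV_I dist_real_def)
  then obtain e where e: "\<And>i. e i > 0" "\<And>i v. \<bar>v - x i\<bar> < e i \<Longrightarrow> v \<in> X i"
    by metis
  show thesis
  proof
    \<comment> \<open>The inserted 1 keeps the minimum defined for n = 0.\<close>
    show "Min (insert 1 (e ` {..<n})) > 0" using e(1) by auto
    fix y assume y: "y \<in> Esp n" "\<And>i. i < n \<Longrightarrow> \<bar>y i - x i\<bar> < Min (insert 1 (e ` {..<n}))"
    have "y i \<in> X i" for i
    proof (cases "i < n")
      case True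
      then show ?thesis using y(2)[OF True] by (intro e(2)) auto
    next
      case False
      then have "y i = x i" using y(1) x T(2) by (simp add: Esp_iff)
      then show ?thesis using X(1) by (simp add: PiE_iff)
    qed
    then show "y \<in> W" using X(3) y(1) T(2) by (auto simp: Esp_iff PiE_iff)
  qed
qed

text \<open>\<open>Ck_on\<close> takes derivatives along whole coordinate lines, which may leave W.
  Openness confines a neighbourhood on the line to W, so that a partial derivative depends on values
  in W alone.\<close>

lemma eventually_fun_upd_in_open:
  assumes "openin (Euclidean_space n) W" "x \<in> W" "i < n"
  shows "eventually (\<lambda>u. x(i := u) \<in> W) (nhds (x i))"
proof -
  obtain e where e: "e > 0" "\<And>y. y \<in> Esp n \<Longrightarrow> (\<And>i. i < n \<Longrightarrow> \<bar>y i - x i\<bar> < e) \<Longrightarrow> y \<in> W"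
    using openin_Esp_box assms by metis
  have "x(i := u) \<in> W" if "dist u (x i) < e" for u
    using that assms openin_Esp_subset[OF assms(1)] e(1)
    by (intro e(2)) (auto simp: Esp_iff dist_real_def)
  then show ?thesis using e(1) by (auto simp: eventually_nhds_metric)
qed

lemma Ck_on_continuous: "Ck_on k n W f \<Longrightarrow> continuous_map (subtopology (Euclidean_space n) W) euclideanreal f"
  by (cases k) auto

lemma has_partial_cong:
  assumes W: "openin (Euclidean_space n) W" "x \<in> W" "i < n" and eq: "\<And>y. y \<in> W \<Longrightarrow> f y = g y"
  shows "((\<lambda>u. f (x(i := u))) has_real_derivative D) (at (x i)) \<longleftrightarrow>
         ((\<lambda>u. g (x(i := u))) has_real_derivative D) (at (x i))"
  by (rule DERIV_cong_ev)
     (use eventually_fun_upd_in_open[OF W] eq in \<open>auto elim: eventually_mono\<close>)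

lemma Ck_on_cong:
  assumes "openin (Euclidean_space n) W" "\<And>x. x \<in> W \<Longrightarrow> f x = g x"
  shows "Ck_on k n W f \<longleftrightarrow> Ck_on k n W g"
proof -
  have c: "continuous_map (subtopology (Euclidean_space n) W) euclideanreal f \<longleftrightarrow>
     continuous_map (subtopology (Euclidean_space n) W) euclideanreal g"
    using assms(2) cm_real_iff[OF openin_Esp_subset[OF assms(1)]]
    by (simp cong: continuous_on_cong)
  show ?thesis
  proof (cases k)
    case (Suc k')
    have "((\<lambda>u. f (x(i := u))) has_real_derivative D) (at (x i)) \<longleftrightarrow>
         ((\<lambda>u. g (x(i := u))) has_real_derivative D) (at (x i))" if "x \<in> W" "i < n" for x i D
      using has_partial_cong[OF assms(1) that] assms(2) by blast
    then show ?thesis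
      unfolding Suc Ck_on.simps c by blast
  qed (simp add: c)
qed

text \<open>A canonical name for the derivative that \<open>Ck_on\<close> only asserts to exist. It
  does not refer to W, so derivatives found on different open sets can be compared and
  glued.\<close>

definition partial_deriv :: "nat \<Rightarrow> ((nat \<Rightarrow> real) \<Rightarrow> real) \<Rightarrow> (nat \<Rightarrow> real) \<Rightarrow> real" where
  "partial_deriv i f x = deriv (\<lambda>u. f (x(i := u))) (x i)"

lemma partial_deriv_eq: "((\<lambda>u. f (x(i := u))) has_real_derivative D) (at (x i)) \<Longrightarrow> partial_deriv i f x = D"
  unfolding partial_deriv_def by (rule DERIV_imp_deriv)

text \<open>Derivatives are unique, so any witness agrees with \<open>partial_deriv\<close> on W,
  and by congruence the latter inherits its differentiability class there.\<close>

lemma Ck_on_Suc_iff: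
  assumes W: "openin (Euclidean_space n) W"
  shows "Ck_on (Suc k) n W f \<longleftrightarrow> continuous_on W f \<and>
     (\<forall>i<n. (\<forall>x\<in>W. ((\<lambda>u. f (x(i := u))) has_real_derivative partial_deriv i f x) (at (x i))) \<and>
        Ck_on k n W (partial_deriv i f))"
proof -
  have "(\<exists>g. (\<forall>x\<in>W. ((\<lambda>u. f (x(i := u))) has_real_derivative g x) (at (x i))) \<and> Ck_on k n W g) \<longleftrightarrow>
        (\<forall>x\<in>W. ((\<lambda>u. f (x(i := u))) has_real_derivative partial_deriv i f x) (at (x i))) \<and> Ck_on k n W (partial_deriv i f)"
    for i
  proof safe
    fix g assume g: "\<forall>x\<in>W. ((\<lambda>u. f (x(i := u))) has_real_derivative g x) (at (x i))" "Ck_on k n W g"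
    then have eq: "partial_deriv i f x = g x" if "x \<in> W" for x using that partial_deriv_eq by blast
    show "Ck_on k n W (partial_deriv i f)" using g(2) Ck_on_cong[OF W eq] by simp
    fix x assume "x \<in> W"
    then show "((\<lambda>u. f (x(i := u))) has_real_derivative partial_deriv i f x) (at (x i))" using g(1) eq by simp
  qed auto
  then show ?thesis using cm_real_iff[OF openin_Esp_subset[OF W]] by simp
qed

lemma Ck_on_SucD:
  assumes "openin (Euclidean_space n) W" "Ck_on (Suc k) n W f"
  shows "continuous_on W f"
    "i < n \<Longrightarrow> x \<in> W \<Longrightarrow> ((\<lambda>u. f (x(i := u))) has_real_derivative partial_deriv i f x) (at (x i))"
    "i < n \<Longrightarrow> Ck_on k n W (partial_deriv i f)"
  using assms(2) unfolding Ck_on_Suc_iff[OF assms(1)] by blast+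

lemma Ck_on_0_iff:
  assumes W: "openin (Euclidean_space n) W"
  shows "Ck_on 0 n W f \<longleftrightarrow> continuous_on W f"
  using cm_real_iff[OF openin_Esp_subset[OF W]] by (simp add: Ck_on.simps)

declare Ck_on.simps [simp del]

lemma Ck_on_SucI:
  assumes "openin (Euclidean_space n) W" "continuous_on W f"
    "\<And>i x. i < n \<Longrightarrow> x \<in> W \<Longrightarrow> ((\<lambda>u. f (x(i := u))) has_real_derivative g i x) (at (x i))"
    "\<And>i. i < n \<Longrightarrow> Ck_on k n W (g i)"
  shows "Ck_on (Suc k) n W f"
  unfolding Ck_on.simps using assms cm_real_iff[OF openin_Esp_subset[OF assms(1)]] by blast

lemma Ck_on_Suc_imp: "Ck_on (Suc k) n W f \<Longrightarrow> Ck_on k n W f"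
proof (induction k arbitrary: f)
  case (Suc k)
  from Suc.prems have "continuous_map (subtopology (Euclidean_space n) W) euclideanreal f"
    "\<And>i. i < n \<Longrightarrow> \<exists>g. (\<forall>x\<in>W. ((\<lambda>u. f (x(i := u))) has_real_derivative g x) (at (x i))) \<and> Ck_on k n W g"
    using Suc.IH unfolding Ck_on.simps(2)[of "Suc k"] by blast+
  then show ?case unfolding Ck_on.simps by blast
qed (simp add: Ck_on.simps)

lemma Ck_on_subset: "Ck_on k n W f \<Longrightarrow> V \<subseteq> W \<Longrightarrow> Ck_on k n V f"
proof (induction k arbitrary: f)
  case 0
  then show ?case unfolding Ck_on.simps by (auto intro: continuous_map_from_subtopology_mono)
next
  case (Suc k)
  then have "continuous_map (subtopology (Euclidean_space n) V) euclideanreal f"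
    unfolding Ck_on.simps using continuous_map_from_subtopology_mono by blast
  with Suc show ?case unfolding Ck_on.simps by blast
qed

text \<open>The sets V cover W, so openness of W appears as a conclusion. Near x the set V is cut
  out by an ambient open set, hence limits within W and within V agree.\<close>

lemma continuous_on_local_Esp:
  assumes loc: "\<And>x. x \<in> W \<Longrightarrow> \<exists>V. openin (Euclidean_space n) V \<and> x \<in> V \<and> V \<subseteq> W \<and> continuous_on V f"
  shows "continuous_on W f" and "openin (Euclidean_space n) W"
proof -
  show W: "openin (Euclidean_space n) W"
    using loc by (subst openin_subopen) blast
  show "continuous_on W f"
    unfolding continuous_on_def
  proof
    fix x assume "x \<in> W"
    then obtain V where V: "openin (Euclidean_space n) V" "x \<in> V" "V \<subseteq> W" "continuous_on V f"
      using loc by blast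
    obtain T where T: "open T" "V = {x. \<forall>i\<ge>n. x i = 0} \<inter> T"
      using V(1) unfolding Euclidean_space_top_of_set openin_open by auto
    have "at x within W = at x within V"
      using V(2,3) T openin_Esp_subset[OF W] by (intro at_within_nhd[of x T]) (auto simp: Esp_iff)
    then show "(f \<longlongrightarrow> f x) (at x within W)"
      using V(2,4) unfolding continuous_on_def by simp
  qed
qed

text \<open>On every piece the derivative is given by the same function
  \<open>partial_deriv\<close>, so gluing involves no choice and the induction hypothesis applies to
  it directly.\<close>

lemma Ck_on_local:
  assumes "\<And>x. x \<in> W \<Longrightarrow> \<exists>V. openin (Euclidean_space n) V \<and> x \<in> V \<and> V \<subseteq> W \<and> Ck_on k n V f"
  shows "Ck_on k n W f"
  using assms
proof (induction k arbitrary: f)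
  case 0
  have *: "\<exists>V. openin (Euclidean_space n) V \<and> x \<in> V \<and> V \<subseteq> W \<and> continuous_on V f" if "x \<in> W" for x
    using 0[OF that] by (metis Ck_on_0_iff)
  have "openin (Euclidean_space n) W" "continuous_on W f" using continuous_on_local_Esp[OF *] by blast+
  then show ?case by (simp add: Ck_on_0_iff)
next
  case (Suc k)
  have *: "\<exists>V. openin (Euclidean_space n) V \<and> x \<in> V \<and> V \<subseteq> W \<and> continuous_on V f" if "x \<in> W" for x
    using Suc.prems[OF that] by (metis Ck_on_SucD(1))
  have W: "openin (Euclidean_space n) W" using continuous_on_local_Esp(2)[OF *] .
  show ?case unfolding Ck_on_Suc_iff[OF W]
  proof (intro conjI allI impI ballI)
    show "continuous_on W f" using continuous_on_local_Esp(1)[OF *] .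
    fix i assume i: "i < n"
    show "Ck_on k n W (partial_deriv i f)"
    proof (rule Suc.IH)
      show "\<exists>V. openin (Euclidean_space n) V \<and> x \<in> V \<and> V \<subseteq> W \<and> Ck_on k n V (partial_deriv i f)" if "x \<in> W" for x
        using Suc.prems[OF that] i by (metis Ck_on_SucD(3))
    qed
    fix x assume "x \<in> W"
    from Suc.prems[OF this] show "((\<lambda>u. f (x(i := u))) has_real_derivative partial_deriv i f x) (at (x i))"
      using i by (metis Ck_on_SucD(2))
  qed
qed

lemma Ck_on_const [simp]:
  assumes "openin (Euclidean_space n) W" shows "Ck_on k n W (\<lambda>x. c)"
proof (induction k arbitrary: c)
  case 0 then show ?case by (simp add: Ck_on_0_iff assms)
next
  case (Suc k)
  show ?case by (rule Ck_on_SucI[OF assms, where g = "\<lambda>_ _. 0"]) (auto intro: Suc)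
qed

lemma continuous_on_coord: "continuous_on W (\<lambda>x::nat \<Rightarrow> real. x j)"
  by (rule continuous_on_subset[OF continuous_on_product_coordinates subset_UNIV])

lemma Ck_on_coord:
  assumes "openin (Euclidean_space n) W" shows "Ck_on k n W (\<lambda>x. x j)"
proof (cases k)
  case 0 then show ?thesis by (simp add: Ck_on_0_iff assms continuous_on_coord)
next
  case (Suc k')
  show ?thesis unfolding Suc
  proof (rule Ck_on_SucI[OF assms continuous_on_coord])
    show "((\<lambda>u. (x(i := u)) j) has_real_derivative (if i = j then 1 else 0)) (at (x i))" for x i
      by (cases "i = j") auto
    show "Ck_on k' n W (\<lambda>_. if i = j then 1 else 0)" for i
      by (rule Ck_on_const[OF assms])
  qed
qed

lemma Ck_on_add:
  assumes W: "openin (Euclidean_space n) W" and "Ck_on k n W f" "Ck_on k n W g"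
  shows "Ck_on k n W (\<lambda>x. f x + g x)"
  using assms(2,3)
proof (induction k arbitrary: f g)
  case 0 then show ?case by (auto simp: Ck_on_0_iff W intro: continuous_intros)
next
  case (Suc k)
  then show ?case
    by (intro Ck_on_SucI[OF W, where g = "\<lambda>i x. partial_deriv i f x + partial_deriv i g x"])
       (auto simp: Ck_on_Suc_iff W simp del: fun_upd_apply intro!: continuous_on_add DERIV_add)
qed

lemma Ck_on_mult:
  assumes W: "openin (Euclidean_space n) W" and "Ck_on k n W f" "Ck_on k n W g"
  shows "Ck_on k n W (\<lambda>x. f x * g x)"
  using assms(2,3)
proof (induction k arbitrary: f g)
  case 0 then show ?case by (auto simp: Ck_on_0_iff W intro: continuous_intros)
next
  case (Suc k)
  have k: "Ck_on k n W f" "Ck_on k n W g" using Suc.prems Ck_on_Suc_imp by auto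
  show ?case
  proof (rule Ck_on_SucI[OF W, where g = "\<lambda>i x. partial_deriv i f x * g x + partial_deriv i g x * f x"])
    show "continuous_on W (\<lambda>x. f x * g x)"
      using Suc.prems by (auto simp: Ck_on_Suc_iff W intro: continuous_on_mult)
    fix i assume i: "i < n"
    show "Ck_on k n W (\<lambda>x. partial_deriv i f x * g x + partial_deriv i g x * f x)"
      using Suc.prems k i by (intro Ck_on_add W Suc.IH) (auto simp: Ck_on_Suc_iff W)
    fix x assume x: "x \<in> W"
    show "((\<lambda>u. f (x(i := u)) * g (x(i := u))) has_real_derivative partial_deriv i f x * g x + partial_deriv i g x * f x) (at (x i))"
      using DERIV_mult[of "\<lambda>u. f (x(i := u))" "partial_deriv i f x" "x i" UNIV "\<lambda>u. g (x(i := u))" "partial_deriv i g x"]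
        Suc.prems x i by (simp add: Ck_on_Suc_iff W)
  qed
qed

lemma Ck_on_sum:
  assumes W: "openin (Euclidean_space n) W" and "\<And>j. j \<in> J \<Longrightarrow> Ck_on k n W (f j)"
  shows "Ck_on k n W (\<lambda>x. \<Sum>j\<in>J. f j x)"
  using assms(2) by (induction J rule: infinite_finite_induct) (auto intro: Ck_on_add W simp: W)

text \<open>A coordinate of a curve may increase, decrease or stand still; the intermediate point is
  therefore sought in the segment between the end points in either order, possibly
  degenerate.\<close>

lemma MVT_unordered:
  fixes g :: "real \<Rightarrow> real"
  assumes "\<And>v. v \<in> closed_segment a b \<Longrightarrow> (g has_real_derivative g' v) (at v)"
  shows "\<exists>\<xi>\<in>closed_segment a b. g b - g a = (b - a) * g' \<xi>"
proof (cases a b rule: linorder_cases)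
  case less
  then have *: "\<And>v. a \<le> v \<Longrightarrow> v \<le> b \<Longrightarrow> (g has_real_derivative g' v) (at v)"
    using assms by (simp add: closed_segment_eq_real_ivl)
  show ?thesis using MVT2[OF less *] less by (auto simp: closed_segment_eq_real_ivl)
next
  case greater
  then have *: "\<And>v. b \<le> v \<Longrightarrow> v \<le> a \<Longrightarrow> (g has_real_derivative g' v) (at v)"
    using assms by (simp add: closed_segment_eq_real_ivl)
  obtain z where "z > b" "z < a" "g a - g b = (a - b) * g' z" using MVT2[OF greater *] by blast
  then show ?thesis using greater by (intro bexI[of _ z]) (auto simp: closed_segment_eq_real_ivl algebra_simps)
qed auto

lemma continuous_on_Esp_box:
  assumes V: "openin (Euclidean_space m) V" and f: "continuous_on V f" and x: "x \<in> V" and "\<epsilon> > (0::real)"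
  obtains e where "e > 0"
    "\<And>y. y \<in> Esp m \<Longrightarrow> (\<And>i. i < m \<Longrightarrow> \<bar>y i - x i\<bar> < e) \<Longrightarrow> y \<in> V \<and> \<bar>f y - f x\<bar> < \<epsilon>"
proof -
  have "openin (top_of_set V) (V \<inter> f -` ball (f x) \<epsilon>)"
    using f by (intro continuous_openin_preimage_gen) auto
  then have "openin (Euclidean_space m) (V \<inter> f -` ball (f x) \<epsilon>)"
    using V openin_trans unfolding Euclidean_space_top_of_set by blast
  from openin_Esp_box[OF this, of x] x \<open>\<epsilon> > 0\<close> obtain e where
    "e > 0" "\<And>y. y \<in> Esp m \<Longrightarrow> (\<And>i. i < m \<Longrightarrow> \<bar>y i - x i\<bar> < e) \<Longrightarrow> y \<in> V \<inter> f -` ball (f x) \<epsilon>"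
    by (auto simp: dist_real_def)
  then show thesis by (intro that[of e]) (force simp: dist_real_def)+
qed

text \<open>The increment of \<open>f\<close> along \<open>c\<close> is telescoped over the coordinates, and each summand is
  evaluated by the mean value theorem; this needs only continuity of the partial derivatives.\<close>

lemma has_derivative_along_curve:
  fixes c :: "real \<Rightarrow> nat \<Rightarrow> real"
  assumes V: "openin (Euclidean_space m) V" and c0: "c u0 \<in> V"
    and ev: "eventually (\<lambda>u. c u \<in> V) (nhds u0)"
    and f: "\<And>j x. j < m \<Longrightarrow> x \<in> V \<Longrightarrow> ((\<lambda>u. f (x(j := u))) has_real_derivative D j x) (at (x j))"
    and D: "\<And>j. j < m \<Longrightarrow> continuous_on V (D j)"
    and c: "\<And>j. j < m \<Longrightarrow> ((\<lambda>u. c u j) has_real_derivative c' j) (at u0)"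
  shows "((\<lambda>u. f (c u)) has_real_derivative (\<Sum>j<m. D j (c u0) * c' j)) (at u0)"
proof -
  \<comment> \<open>Interpolates between the base point and \<open>c u\<close>: the first j
    coordinates have already moved. Consecutive points differ in coordinate j only.\<close>
  define z where "z j u = (\<lambda>i. if i < j then c u i else c u0 i)" for j u
  have c0E: "c u0 i = 0" if "i \<ge> m" for i
    using c0 openin_Esp_subset[OF V] that by (auto simp: Esp_iff)
  have near: "eventually (\<lambda>u. \<forall>i\<in>{..<m}. \<bar>c u i - c u0 i\<bar> < e) (nhds u0)" if "e > 0" for e
  proof (rule eventually_ball_finite, simp, rule ballI)
    fix j assume "j \<in> {..<m}"
    then have "isCont (\<lambda>u. c u j) u0" using c DERIV_isCont by blast
    then have "((\<lambda>u. c u j) \<longlongrightarrow> c u0 j) (at u0)" by (simp add: isCont_def)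
    from tendstoD[OF this that] have "eventually (\<lambda>u. \<bar>c u j - c u0 j\<bar> < e) (at u0)"
      by (simp add: dist_real_def)
    then show "eventually (\<lambda>u. \<bar>c u j - c u0 j\<bar> < e) (nhds u0)"
      unfolding eventually_at_filter by (rule eventually_mono) (use that in auto)
  qed
  have step: "((\<lambda>u. f (z (Suc j) u) - f (z j u)) has_real_derivative D j (c u0) * c' j) (at u0)"
    if j: "j < m" for j
  proof -
    define ok where "ok u \<xi> \<longleftrightarrow> \<xi> \<in> closed_segment (c u0 j) (c u j) \<and>
       f (z (Suc j) u) - f (z j u) = (c u j - c u0 j) * D j ((z j u)(j := \<xi>))" for u \<xi>
    \<comment> \<open>The chosen intermediate point may jump with u. It stays in a segment that
      shrinks to a point, so continuity of the partial derivative still determines the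
      limit.\<close>
    define \<xi> where "\<xi> u = (SOME \<xi>. ok u \<xi>)" for u
    have zE: "(z j u)(j := v) \<in> Esp m" for u v using c0E j by (auto simp: z_def Esp_iff)
    have box: "\<bar>((z j u)(j := v)) i - c u0 i\<bar> < e"
      if "\<forall>i\<in>{..<m}. \<bar>c u i - c u0 i\<bar> < e" "v \<in> closed_segment (c u0 j) (c u j)" "i < m" "e > 0" for u v i e
    proof (cases "i = j")
      case True
      have "\<bar>v - c u0 j\<bar> \<le> \<bar>c u j - c u0 j\<bar>"
        using that(2) by (auto simp: closed_segment_eq_real_ivl split: if_splits)
      also have "\<dots> < e" using that(1) j by simp
      finally show ?thesis using True by simp
    next
      case False then show ?thesis using that by (auto simp: z_def)
    qed
    obtain e0 where e0: "e0 > 0"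
      "\<And>y. y \<in> Esp m \<Longrightarrow> (\<And>i. i < m \<Longrightarrow> \<bar>y i - c u0 i\<bar> < e0) \<Longrightarrow> y \<in> V"
      using openin_Esp_box[OF V c0] by metis
    have ok: "ok u (\<xi> u)" if u: "\<forall>i\<in>{..<m}. \<bar>c u i - c u0 i\<bar> < e0" for u
    proof -
      have "\<exists>\<xi>\<in>closed_segment (c u0 j) (c u j). f ((z j u)(j := c u j)) - f ((z j u)(j := c u0 j)) =
          (c u j - c u0 j) * D j ((z j u)(j := \<xi>))"
      proof (rule MVT_unordered)
        fix v assume v: "v \<in> closed_segment (c u0 j) (c u j)"
        have "(z j u)(j := v) \<in> V" by (rule e0(2)[OF zE box[OF u v _ e0(1)]])
        from f[OF j this] show "((\<lambda>v. f ((z j u)(j := v))) has_real_derivative D j ((z j u)(j := v))) (at v)"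
          by simp
      qed
      moreover have "(z j u)(j := c u j) = z (Suc j) u" "(z j u)(j := c u0 j) = z j u"
        by (auto simp: z_def fun_eq_iff)
      ultimately have "\<exists>\<xi>. ok u \<xi>" unfolding ok_def by auto
      then show ?thesis unfolding \<xi>_def by (rule someI_ex)
    qed
    have q: "((\<lambda>u. D j ((z j u)(j := \<xi> u))) \<longlongrightarrow> D j (c u0)) (nhds u0)"
    proof (rule tendstoI)
      fix \<epsilon> :: real assume "\<epsilon> > 0"
      then obtain e where e: "e > 0" "\<And>y. y \<in> Esp m \<Longrightarrow> (\<And>i. i < m \<Longrightarrow> \<bar>y i - c u0 i\<bar> < e) \<Longrightarrow>
          y \<in> V \<and> \<bar>D j y - D j (c u0)\<bar> < \<epsilon>"
        using continuous_on_Esp_box[OF V D[OF j] c0] by metis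
      show "eventually (\<lambda>u. dist (D j ((z j u)(j := \<xi> u))) (D j (c u0)) < \<epsilon>) (nhds u0)"
        using near[OF e0(1)] near[OF e(1)]
      proof eventually_elim
        case (elim u)
        have "\<xi> u \<in> closed_segment (c u0 j) (c u j)" using ok[OF elim(1)] by (simp add: ok_def)
        from e(2)[OF zE box[OF elim(2) this _ e(1)]] show ?case unfolding dist_real_def by blast
      qed
    qed
    have "((\<lambda>u. D j ((z j u)(j := \<xi> u)) * ((c u j - c u0 j) / (u - u0))) \<longlongrightarrow> D j (c u0) * c' j) (at u0)"
    proof (rule tendsto_mult)
      show "((\<lambda>u. D j ((z j u)(j := \<xi> u))) \<longlongrightarrow> D j (c u0)) (at u0)"
        using q by (rule tendsto_mono[rotated]) (simp add: at_within_def)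
      show "((\<lambda>u. (c u j - c u0 j) / (u - u0)) \<longlongrightarrow> c' j) (at u0)"
        using c[OF j] by (simp add: has_field_derivative_iff)
    qed
    moreover have "eventually (\<lambda>u. D j ((z j u)(j := \<xi> u)) * ((c u j - c u0 j) / (u - u0)) =
       ((f (z (Suc j) u) - f (z j u)) - (f (z (Suc j) u0) - f (z j u0))) / (u - u0)) (at u0)"
    proof -
      have "eventually (\<lambda>u. \<forall>i\<in>{..<m}. \<bar>c u i - c u0 i\<bar> < e0) (at u0)"
        using near[OF e0(1)] by (auto simp: eventually_at_filter elim: eventually_mono)
      then show ?thesis
      proof eventually_elim
        case (elim u)
        have "z (Suc j) u0 = z j u0" by (auto simp: z_def)
        with ok[OF elim] show ?case by (simp add: ok_def)
      qed
    qed
    ultimately show ?thesis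
      unfolding has_field_derivative_iff by (rule Lim_transform_eventually)
  qed
  have part: "((\<lambda>u. f (z j u)) has_real_derivative (\<Sum>l<j. D l (c u0) * c' l)) (at u0)" if "j \<le> m" for j
    using that
  proof (induction j)
    case 0
    have "z 0 u = c u0" for u by (auto simp: z_def)
    then show ?case by simp
  next
    case (Suc j)
    have "((\<lambda>u. f (z j u) + (f (z (Suc j) u) - f (z j u))) has_real_derivative
        (\<Sum>l<j. D l (c u0) * c' l) + D j (c u0) * c' j) (at u0)"
      using Suc by (intro DERIV_add step) auto
    then show ?case by simp
  qed
  \<comment> \<open>The coordinates from m on are frozen at the base point, where they vanish, and
    they vanish for \<open>c u\<close> as long as it lies in V.\<close>
  have "z m u = c u" if "c u \<in> V" for u
    using that openin_Esp_subset[OF V] c0E by (auto simp: z_def Esp_iff fun_eq_iff)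
  then have "eventually (\<lambda>u. f (z m u) = f (c u)) (nhds u0)"
    using ev by (auto elim: eventually_mono)
  from DERIV_cong_ev[OF refl this refl] show ?thesis using part[of m] by simp
qed

lemma continuous_on_Esp_compose:
  assumes W: "openin (Euclidean_space n) W" and V: "openin (Euclidean_space m) V"
    and h: "\<And>x. x \<in> W \<Longrightarrow> h x \<in> V" "\<And>j. j < m \<Longrightarrow> continuous_on W (\<lambda>x. h x j)"
    and f: "continuous_on V f"
  shows "continuous_on W (\<lambda>x. f (h x))"
proof -
  have "continuous_on W (\<lambda>x. h x j)" for j
  proof (cases "j < m")
    case False
    then have "h x j = 0" if "x \<in> W" for x
      using h(1)[OF that] openin_Esp_subset[OF V] by (auto simp: Esp_iff)
    then show ?thesis by (metis (mono_tags, lifting) continuous_on_cong continuous_on_const)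
  qed (use h in auto)
  then have "continuous_on W h" by (rule continuous_on_coordinatewise_then_product)
  then show ?thesis using h(1) by (intro continuous_on_compose2[OF f]) auto
qed

text \<open>Chain rule, by induction on the order with f arbitrary: the i-th derivative is a sum of
  products of (\<partial>_j f) o h with \<partial>_i h_j. The first factor is covered by the
  induction hypothesis, for which h is demoted by one order; the second is of the required class by
  assumption.\<close>

lemma Ck_on_compose:
  assumes W: "openin (Euclidean_space n) W" and V: "openin (Euclidean_space m) V"
    and "\<And>x. x \<in> W \<Longrightarrow> h x \<in> V" "\<And>j. j < m \<Longrightarrow> Ck_on k n W (\<lambda>x. h x j)" "Ck_on k m V f"
  shows "Ck_on k n W (\<lambda>x. f (h x))"
  using assms(4,5)
proof (induction k arbitrary: f)
  case 0
  then show ?case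
    using assms(3) by (auto simp: Ck_on_0_iff W V intro: continuous_on_Esp_compose[where h = h, OF W V])
next
  case (Suc k)
  have hk: "Ck_on k n W (\<lambda>x. h x j)" if "j < m" for j using Suc.prems(1) Ck_on_Suc_imp that by blast
  have f: "\<And>j x. j < m \<Longrightarrow> x \<in> V \<Longrightarrow> ((\<lambda>u. f (x(j := u))) has_real_derivative partial_deriv j f x) (at (x j))"
    "\<And>j. j < m \<Longrightarrow> Ck_on k m V (partial_deriv j f)" "continuous_on V f"
    using Suc.prems(2) by (auto simp: Ck_on_Suc_iff V)
  have h: "\<And>j i x. j < m \<Longrightarrow> i < n \<Longrightarrow> x \<in> W \<Longrightarrow>
        ((\<lambda>u. h (x(i := u)) j) has_real_derivative partial_deriv i (\<lambda>x. h x j) x) (at (x i))"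
    "\<And>j i. j < m \<Longrightarrow> i < n \<Longrightarrow> Ck_on k n W (partial_deriv i (\<lambda>x. h x j))"
    "\<And>j. j < m \<Longrightarrow> continuous_on W (\<lambda>x. h x j)"
    using Suc.prems(1) by (auto simp: Ck_on_Suc_iff W)
  have pdc: "continuous_on V (partial_deriv j f)" if "j < m" for j
    using Ck_on_continuous[OF f(2)[OF that]] cm_real_iff[OF openin_Esp_subset[OF V]] by blast
  show ?case
  proof (rule Ck_on_SucI[OF W, where g = "\<lambda>i x. \<Sum>j<m. partial_deriv j f (h x) * partial_deriv i (\<lambda>x. h x j) x"])
    show "continuous_on W (\<lambda>x. f (h x))"
      by (rule continuous_on_Esp_compose[where h = h, OF W V _ h(3) f(3)]) (use assms(3) in auto)
    fix i assume i: "i < n"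
    show "Ck_on k n W (\<lambda>x. \<Sum>j<m. partial_deriv j f (h x) * partial_deriv i (\<lambda>x. h x j) x)"
    proof (rule Ck_on_sum[OF W], rule Ck_on_mult[OF W])
      fix j assume "j \<in> {..<m}"
      then have j: "j < m" by simp
      show "Ck_on k n W (\<lambda>x. partial_deriv j f (h x))" by (rule Suc.IH[OF hk f(2)[OF j]])
      show "Ck_on k n W (partial_deriv i (\<lambda>x. h x j))" by (rule h(2)[OF j i])
    qed
    fix x assume x: "x \<in> W"
    have "((\<lambda>u. f (h (x(i := u)))) has_real_derivative
        (\<Sum>j<m. partial_deriv j f (h (x(i := x i))) * partial_deriv i (\<lambda>x. h x j) x)) (at (x i))"
    proof (rule has_derivative_along_curve[OF V _ _ f(1) pdc h(1)[OF _ i x]])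
      show "h (x(i := x i)) \<in> V" using assms(3) x by simp
      show "\<forall>\<^sub>F u in nhds (x i). h (x(i := u)) \<in> V"
        using eventually_fun_upd_in_open[OF W x i] assms(3) by (auto elim: eventually_mono)
    qed auto
    then show "((\<lambda>u. f (h (x(i := u)))) has_real_derivative
        (\<Sum>j<m. partial_deriv j f (h x) * partial_deriv i (\<lambda>x. h x j) x)) (at (x i))" by simp
  qed
qed

section \<open>Closure properties of smooth functions on the model space\<close>

lemma smooth_on_cong:
  "openin (Euclidean_space n) W \<Longrightarrow> (\<And>x. x \<in> W \<Longrightarrow> f x = g x) \<Longrightarrow> smooth_on n W f \<longleftrightarrow> smooth_on n W g"
  unfolding smooth_on_def using Ck_on_cong by blast

lemma smooth_on_continuous:
  "openin (Euclidean_space n) W \<Longrightarrow> smooth_on n W f \<Longrightarrow> continuous_on W f"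
  unfolding smooth_on_def using Ck_on_0_iff by blast

lemma smooth_on_subset: "smooth_on n W f \<Longrightarrow> V \<subseteq> W \<Longrightarrow> smooth_on n V f"
  unfolding smooth_on_def using Ck_on_subset by blast

lemma smooth_on_local:
  assumes "\<And>x. x \<in> W \<Longrightarrow> \<exists>V. openin (Euclidean_space n) V \<and> x \<in> V \<and> V \<subseteq> W \<and> smooth_on n V f"
  shows "smooth_on n W f"
  unfolding smooth_on_def
proof
  fix k show "Ck_on k n W f"
  proof (rule Ck_on_local)
    fix x assume "x \<in> W"
    from assms[OF this] show "\<exists>V. openin (Euclidean_space n) V \<and> x \<in> V \<and> V \<subseteq> W \<and> Ck_on k n V f"
      by (auto simp: smooth_on_def)
  qed
qed

lemma smooth_on_const: "openin (Euclidean_space n) W \<Longrightarrow> smooth_on n W (\<lambda>x. c)"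
  unfolding smooth_on_def by simp

lemma smooth_on_coord: "openin (Euclidean_space n) W \<Longrightarrow> smooth_on n W (\<lambda>x. x j)"
  unfolding smooth_on_def using Ck_on_coord by blast

lemma smooth_on_add:
  "openin (Euclidean_space n) W \<Longrightarrow> smooth_on n W f \<Longrightarrow> smooth_on n W g \<Longrightarrow> smooth_on n W (\<lambda>x. f x + g x)"
  unfolding smooth_on_def using Ck_on_add by blast

lemma smooth_on_mult:
  "openin (Euclidean_space n) W \<Longrightarrow> smooth_on n W f \<Longrightarrow> smooth_on n W g \<Longrightarrow> smooth_on n W (\<lambda>x. f x * g x)"
  unfolding smooth_on_def using Ck_on_mult by blast

lemma smooth_on_diff:
  assumes "openin (Euclidean_space n) W" "smooth_on n W f" "smooth_on n W g"
  shows "smooth_on n W (\<lambda>x. f x - g x)"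
  using smooth_on_add[OF assms(1,2) smooth_on_mult[OF assms(1) smooth_on_const[OF assms(1), of "-1"] assms(3)]]
  by simp

lemma smooth_on_compose:
  assumes "openin (Euclidean_space n) W" "openin (Euclidean_space m) V"
    "\<And>x. x \<in> W \<Longrightarrow> h x \<in> V" "\<And>j. j < m \<Longrightarrow> smooth_on n W (\<lambda>x. h x j)" "smooth_on m V f"
  shows "smooth_on n W (\<lambda>x. f (h x))"
  unfolding smooth_on_def
proof
  fix k show "Ck_on k n W (\<lambda>x. f (h x))"
    by (rule Ck_on_compose[where h = h, OF assms(1,2)]) (use assms(3-5) in \<open>auto simp: smooth_on_def\<close>)
qed

subsection \<open>Charts and smooth functions\<close>

text \<open>The componentwise criterion concerns functions truncated at n; a map into the model
  space coincides with its truncation.\<close>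

lemma cm_into_Esp:
  "continuous_map X (Euclidean_space n) k \<longleftrightarrow>
   (\<forall>x\<in>topspace X. k x \<in> Esp n) \<and> (\<forall>i<n. continuous_map X euclideanreal (\<lambda>x. k x i))"
proof (cases "\<forall>x\<in>topspace X. k x \<in> Esp n")
  case True
  have "continuous_map X (Euclidean_space n) k \<longleftrightarrow>
        continuous_map X (Euclidean_space n) (\<lambda>x i. if i < n then k x i else 0)"
    by (rule iffI; erule continuous_map_eq) (use True in \<open>auto simp: Esp_iff fun_eq_iff\<close>)
  then show ?thesis using True continuous_map_componentwise_Euclidean_space by blast
next
  case False
  then show ?thesis by (auto simp: continuous_map_def Pi_iff)
qed

lemma is_chartI:
  assumes "openin T U" "openin (Euclidean_space n) W"
    "continuous_map (subtopology T U) (Euclidean_space n) \<phi>"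
    "continuous_map (subtopology (Euclidean_space n) W) T g"
    "\<And>x. x \<in> U \<Longrightarrow> \<phi> x \<in> W \<and> g (\<phi> x) = x" "\<And>z. z \<in> W \<Longrightarrow> g z \<in> U \<and> \<phi> (g z) = z"
  shows "is_chart n T U \<phi>" "\<phi> ` U = W"
proof -
  show W: "\<phi> ` U = W" using assms(5,6) by force
  have "homeomorphic_maps (subtopology T U) (subtopology (Euclidean_space n) W) \<phi> g"
    unfolding homeomorphic_maps_def continuous_map_in_subtopology
    using assms openin_subset[OF assms(1)] openin_subset[OF assms(2)]
    by (auto simp: continuous_map_in_subtopology Pi_iff)
  then show "is_chart n T U \<phi>"
    unfolding is_chart_def W using assms homeomorphic_maps_map by blast
qed

lemma is_chartD:
  assumes "is_chart n T U \<phi>"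
  shows "openin T U" "U \<subseteq> topspace T" "openin (Euclidean_space n) (\<phi> ` U)" "inj_on \<phi> U"
    "continuous_map (subtopology T U) (Euclidean_space n) \<phi>"
    "continuous_map (subtopology (Euclidean_space n) (\<phi> ` U)) T (inv_into U \<phi>)"
    "x \<in> U \<Longrightarrow> \<phi> x \<in> Esp n"
proof -
  show U: "openin T U" and W: "openin (Euclidean_space n) (\<phi> ` U)" using assms by (auto simp: is_chart_def)
  show Us: "U \<subseteq> topspace T" using openin_subset[OF U] .
  have h: "homeomorphic_map (subtopology T U) (subtopology (Euclidean_space n) (\<phi> ` U)) \<phi>"
    using assms by (auto simp: is_chart_def)
  have ts: "topspace (subtopology T U) = U" using Us by auto
  show inj: "inj_on \<phi> U" using homeomorphic_imp_injective_map[OF h] ts by simp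
  show "continuous_map (subtopology T U) (Euclidean_space n) \<phi>"
    using homeomorphic_imp_continuous_map[OF h] by (simp add: continuous_map_in_subtopology)
  show "x \<in> U \<Longrightarrow> \<phi> x \<in> Esp n" using openin_Esp_subset[OF W] by auto
  obtain g where g: "homeomorphic_maps (subtopology T U) (subtopology (Euclidean_space n) (\<phi> ` U)) \<phi> g"
    using h by (auto simp: homeomorphic_map_maps)
  then have gc: "continuous_map (subtopology (Euclidean_space n) (\<phi> ` U)) T g"
    and ge: "\<And>x. x \<in> U \<Longrightarrow> g (\<phi> x) = x"
    using ts by (auto simp: homeomorphic_maps_def continuous_map_in_subtopology)
  show "continuous_map (subtopology (Euclidean_space n) (\<phi> ` U)) T (inv_into U \<phi>)"
    by (rule continuous_map_eq[OF gc]) (auto simp: ge inv_into_f_f[OF inj])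
qed

lemma is_chart_image_open:
  assumes "is_chart n T U \<phi>" "openin T A" "A \<subseteq> U"
  shows "openin (Euclidean_space n) (\<phi> ` A)"
proof -
  note c = is_chartD[OF assms(1)]
  have "\<phi> ` A = {z \<in> topspace (subtopology (Euclidean_space n) (\<phi> ` U)). inv_into U \<phi> z \<in> A}"
    using assms(3) c(7) by (force simp: inv_into_f_f[OF c(4)])
  moreover have "openin (subtopology (Euclidean_space n) (\<phi> ` U)) \<dots>"
    by (rule openin_continuous_map_preimage[OF c(6) assms(2)])
  ultimately show ?thesis using c(3) by (simp add: openin_open_subtopology)
qed

lemma is_chart_subset:
  assumes "is_chart n T U \<phi>" "openin T A" "A \<subseteq> U"
  shows "is_chart n T A \<phi>"
proof -
  note c = is_chartD[OF assms(1)]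
  show ?thesis
  proof (rule is_chartI(1)[OF assms(2) is_chart_image_open[OF assms], of \<phi> "inv_into U \<phi>"])
    show "continuous_map (subtopology T A) (Euclidean_space n) \<phi>"
      using c(5) assms(3) by (rule continuous_map_from_subtopology_mono)
    show "continuous_map (subtopology (Euclidean_space n) (\<phi> ` A)) T (inv_into U \<phi>)"
      using c(6) image_mono[OF assms(3)] by (rule continuous_map_from_subtopology_mono)
  qed (use assms(3) inv_into_f_f[OF c(4)] in auto)
qed

text \<open>Asks for a representative G in coordinates in place of h composed with
  \<open>inv_into U \<phi>\<close>. The inverse depends on the domain U of the chart, whereas a
  representative restricts to smaller sets unchanged.\<close>

definition chart_smooth :: "nat \<Rightarrow> ('a \<Rightarrow> nat \<Rightarrow> real) \<Rightarrow> 'a set \<Rightarrow> ('a \<Rightarrow> real) \<Rightarrow> bool" where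
  "chart_smooth n \<phi> A h \<longleftrightarrow> (\<exists>G. smooth_on n (\<phi> ` A) G \<and> (\<forall>x\<in>A. G (\<phi> x) = h x))"

lemma chart_smooth_iff_inv:
  assumes "is_chart n T U \<phi>" "openin T A" "A \<subseteq> U"
  shows "chart_smooth n \<phi> A h \<longleftrightarrow> smooth_on n (\<phi> ` A) (\<lambda>z. h (inv_into U \<phi> z))"
proof
  have inv: "inv_into U \<phi> (\<phi> x) = x" if "x \<in> A" for x
    using that assms(3) inv_into_f_f[OF is_chartD(4)[OF assms(1)]] by blast
  show "chart_smooth n \<phi> A h" if "smooth_on n (\<phi> ` A) (\<lambda>z. h (inv_into U \<phi> z))"
    unfolding chart_smooth_def using that inv by (intro exI[of _ "\<lambda>z. h (inv_into U \<phi> z)"]) auto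
  assume "chart_smooth n \<phi> A h"
  then obtain G where G: "smooth_on n (\<phi> ` A) G" "\<forall>x\<in>A. G (\<phi> x) = h x" by (auto simp: chart_smooth_def)
  show "smooth_on n (\<phi> ` A) (\<lambda>z. h (inv_into U \<phi> z))"
    by (rule iffD1[OF smooth_on_cong G(1)]) (use is_chart_image_open[OF assms] G(2) inv in auto)
qed

lemma chart_smooth_subset: "chart_smooth n \<phi> A h \<Longrightarrow> B \<subseteq> A \<Longrightarrow> chart_smooth n \<phi> B h"
  unfolding chart_smooth_def by (meson image_mono smooth_on_subset subsetD)

lemma chart_smooth_cong: "(\<And>x. x \<in> A \<Longrightarrow> h x = h' x) \<Longrightarrow> chart_smooth n \<phi> A h \<longleftrightarrow> chart_smooth n \<phi> A h'"
  unfolding chart_smooth_def by simp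

lemma chart_smooth_local:
  assumes c: "is_chart n T U \<phi>" and A: "A \<subseteq> U"
    and loc: "\<And>x. x \<in> A \<Longrightarrow> \<exists>B. openin T B \<and> x \<in> B \<and> B \<subseteq> A \<and> chart_smooth n \<phi> B h"
  shows "chart_smooth n \<phi> A h"
proof -
  have oA: "openin T A" using loc by (subst openin_subopen) blast
  show ?thesis unfolding chart_smooth_iff_inv[OF c oA A]
  proof (rule smooth_on_local)
    fix z assume "z \<in> \<phi> ` A"
    then obtain x where x: "x \<in> A" "z = \<phi> x" by auto
    from loc[OF x(1)] obtain B where B: "openin T B" "x \<in> B" "B \<subseteq> A" "chart_smooth n \<phi> B h" by auto
    have BU: "B \<subseteq> U" using B A by auto
    show "\<exists>V. openin (Euclidean_space n) V \<and> z \<in> V \<and> V \<subseteq> \<phi> ` A \<and> smooth_on n V (\<lambda>z. h (inv_into U \<phi> z))"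
      using is_chart_image_open[OF c B(1) BU] B x chart_smooth_iff_inv[OF c B(1) BU]
      by (intro exI[of _ "\<phi> ` B"]) auto
  qed
qed

lemma chart_smooth_coord:
  assumes "is_chart n T U \<phi>" "openin T A" "A \<subseteq> U"
  shows "chart_smooth n \<phi> A (\<lambda>x. \<phi> x j)"
  unfolding chart_smooth_def using smooth_on_coord[OF is_chart_image_open[OF assms]] by blast

lemma chart_smooth_compose:
  assumes c: "is_chart n T U \<phi>" "openin T A" "A \<subseteq> U"
    and k: "\<And>x. x \<in> A \<Longrightarrow> k x \<in> V" "\<And>j. j < m \<Longrightarrow> chart_smooth n \<phi> A (\<lambda>x. k x j)"
    and G: "openin (Euclidean_space m) V" "smooth_on m V G"
  shows "chart_smooth n \<phi> A (\<lambda>x. G (k x))"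
  unfolding chart_smooth_iff_inv[OF c]
proof (rule smooth_on_compose[where h = "\<lambda>z. k (inv_into U \<phi> z)", OF is_chart_image_open[OF c] G(1) _ _ G(2)])
  show "k (inv_into U \<phi> z) \<in> V" if "z \<in> \<phi> ` A" for z
    using that k(1) c(3) inv_into_f_f[OF is_chartD(4)[OF c(1)]] by auto
  show "smooth_on n (\<phi> ` A) (\<lambda>z. k (inv_into U \<phi> z) j)" if "j < m" for j
    using k(2)[OF that] unfolding chart_smooth_iff_inv[OF c] .
qed

text \<open>Change of coordinates, with the identity of \<open>M\<close> generalized to an arbitrary map \<open>f\<close>.\<close>

lemma chart_smooth_pull:
  assumes c: "is_chart n T U \<phi>" "openin T A" "A \<subseteq> U"
    and d: "is_chart m T' V \<psi>" "openin T' B" "B \<subseteq> V"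
    and f: "f ` A \<subseteq> B" "\<And>j. j < m \<Longrightarrow> chart_smooth n \<phi> A (\<lambda>x. \<psi> (f x) j)"
    and h: "chart_smooth m \<psi> B h"
  shows "chart_smooth n \<phi> A (\<lambda>x. h (f x))"
proof -
  obtain G where G: "smooth_on m (\<psi> ` B) G" "\<And>y. y \<in> B \<Longrightarrow> G (\<psi> y) = h y"
    using h by (auto simp: chart_smooth_def)
  have "chart_smooth n \<phi> A (\<lambda>x. G (\<psi> (f x)))"
    by (rule chart_smooth_compose[where k = "\<lambda>x. \<psi> (f x)", OF c _ f(2) is_chart_image_open[OF d] G(1)]) (use f(1) in auto)
  then show ?thesis by (rule iffD1[OF chart_smooth_cong, rotated]) (use G(2) f(1) in auto)
qed

lemma is_manifoldD:
  assumes "is_manifold M"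
  shows "Hausdorff_space (mtop M)" "second_countable (mtop M)"
    "(U, \<phi>) \<in> atlas M \<Longrightarrow> is_chart (mdim M) (mtop M) U \<phi>"
    "p \<in> pts M \<Longrightarrow> \<exists>U \<phi>. (U, \<phi>) \<in> atlas M \<and> p \<in> U"
    "(U, \<phi>) \<in> atlas M \<Longrightarrow> (V, \<psi>) \<in> atlas M \<Longrightarrow> i < mdim M \<Longrightarrow>
       chart_smooth (mdim M) \<phi> (U \<inter> V) (\<lambda>x. \<psi> x i)"
    "(U, \<phi>) \<in> atlas M \<Longrightarrow> (U, \<phi>) \<in> maximal_atlas M"
proof -
  note m = assms[unfolded is_manifold_def]
  show "Hausdorff_space (mtop M)" "second_countable (mtop M)" using m by auto
  show c: "(U, \<phi>) \<in> atlas M \<Longrightarrow> is_chart (mdim M) (mtop M) U \<phi>" for U \<phi> using m by auto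
  show "\<exists>U \<phi>. (U, \<phi>) \<in> atlas M \<and> p \<in> U" if "p \<in> pts M"
  proof -
    have "p \<in> (\<Union>(U, \<phi>)\<in>atlas M. U)" using m that by auto
    then show ?thesis by auto
  qed
  show "chart_smooth (mdim M) \<phi> (U \<inter> V) (\<lambda>x. \<psi> x i)" if "(U, \<phi>) \<in> atlas M" "(V, \<psi>) \<in> atlas M" "i < mdim M"
  proof (subst chart_smooth_iff_inv[OF c[OF that(1)]])
    show "openin (mtop M) (U \<inter> V)" using c[OF that(1)] c[OF that(2)] by (auto simp: is_chart_def)
    have "smooth_transition (mdim M) U \<phi> V \<psi>" using m that(1,2) by fast
    then show "smooth_on (mdim M) (\<phi> ` (U \<inter> V)) (\<lambda>z. \<psi> (inv_into U \<phi> z) i)"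
      using that(3) by (simp add: smooth_transition_def)
  qed auto
  show "(U, \<phi>) \<in> atlas M \<Longrightarrow> (U, \<phi>) \<in> maximal_atlas M"
    using m unfolding maximal_atlas_def by fast
qed

lemma is_manifoldI:
  assumes "Hausdorff_space (mtop M)" "second_countable (mtop M)"
    "\<And>U \<phi>. (U, \<phi>) \<in> atlas M \<Longrightarrow> is_chart (mdim M) (mtop M) U \<phi>"
    "\<And>p. p \<in> pts M \<Longrightarrow> \<exists>U \<phi>. (U, \<phi>) \<in> atlas M \<and> p \<in> U"
    "\<And>U \<phi> V \<psi> i. (U, \<phi>) \<in> atlas M \<Longrightarrow> (V, \<psi>) \<in> atlas M \<Longrightarrow> i < mdim M \<Longrightarrow>
       chart_smooth (mdim M) \<phi> (U \<inter> V) (\<lambda>x. \<psi> x i)"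
  shows "is_manifold M"
  unfolding is_manifold_def
proof (intro conjI)
  show "\<forall>(U, \<phi>)\<in>atlas M. is_chart (mdim M) (mtop M) U \<phi>" using assms(3) by auto
  show "(\<Union>(U, \<phi>)\<in>atlas M. U) = pts M"
    using assms(3,4) is_chartD(2) by fast
  show "\<forall>(U, \<phi>)\<in>atlas M. \<forall>(V, \<psi>)\<in>atlas M. smooth_transition (mdim M) U \<phi> V \<psi>"
    unfolding smooth_transition_def
  proof clarify
    fix U \<phi> V \<psi> i assume a: "(U, \<phi>) \<in> atlas M" "(V, \<psi>) \<in> atlas M" "i < mdim M"
    have "openin (mtop M) (U \<inter> V)" using assms(3)[OF a(1)] assms(3)[OF a(2)] by (auto simp: is_chart_def)
    from chart_smooth_iff_inv[OF assms(3)[OF a(1)] this] assms(5)[OF a]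
    show "smooth_on (mdim M) (\<phi> ` (U \<inter> V)) (\<lambda>x. \<psi> (inv_into U \<phi> x) i)" by auto
  qed
qed (use assms in auto)

lemma maximal_atlas_iff:
  assumes M: "is_manifold M"
  shows "(U, \<phi>) \<in> maximal_atlas M \<longleftrightarrow> is_chart (mdim M) (mtop M) U \<phi> \<and>
     (\<forall>V \<psi> i. (V, \<psi>) \<in> atlas M \<longrightarrow> i < mdim M \<longrightarrow>
        chart_smooth (mdim M) \<phi> (U \<inter> V) (\<lambda>x. \<psi> x i) \<and> chart_smooth (mdim M) \<psi> (U \<inter> V) (\<lambda>x. \<phi> x i))"
proof -
  have "smooth_transition (mdim M) U \<phi> V \<psi> \<longleftrightarrow> (\<forall>i<mdim M. chart_smooth (mdim M) \<phi> (U \<inter> V) (\<lambda>x. \<psi> x i))"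
    "smooth_transition (mdim M) V \<psi> U \<phi> \<longleftrightarrow> (\<forall>i<mdim M. chart_smooth (mdim M) \<psi> (U \<inter> V) (\<lambda>x. \<phi> x i))"
    if c: "is_chart (mdim M) (mtop M) U \<phi>" and a: "(V, \<psi>) \<in> atlas M" for V \<psi>
  proof -
    have o: "openin (mtop M) (U \<inter> V)" using c is_manifoldD(3)[OF M a] by (auto simp: is_chart_def)
    show "smooth_transition (mdim M) U \<phi> V \<psi> \<longleftrightarrow> (\<forall>i<mdim M. chart_smooth (mdim M) \<phi> (U \<inter> V) (\<lambda>x. \<psi> x i))"
      unfolding smooth_transition_def by (simp add: chart_smooth_iff_inv[OF c o])
    show "smooth_transition (mdim M) V \<psi> U \<phi> \<longleftrightarrow> (\<forall>i<mdim M. chart_smooth (mdim M) \<psi> (U \<inter> V) (\<lambda>x. \<phi> x i))"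
      unfolding smooth_transition_def
      by (simp add: chart_smooth_iff_inv[OF is_manifoldD(3)[OF M a] o] Int_commute[of V U])
  qed
  then show ?thesis unfolding maximal_atlas_def by blast
qed

lemma maximal_atlasD:
  assumes "is_manifold M" "(U, \<phi>) \<in> maximal_atlas M"
  shows "is_chart (mdim M) (mtop M) U \<phi>" "openin (mtop M) U" "U \<subseteq> pts M"
    "(V, \<psi>) \<in> atlas M \<Longrightarrow> i < mdim M \<Longrightarrow> chart_smooth (mdim M) \<phi> (U \<inter> V) (\<lambda>x. \<psi> x i)"
    "(V, \<psi>) \<in> atlas M \<Longrightarrow> i < mdim M \<Longrightarrow> chart_smooth (mdim M) \<psi> (U \<inter> V) (\<lambda>x. \<phi> x i)"
  using assms(2) unfolding maximal_atlas_iff[OF assms(1)] by (auto dest: is_chartD(1,2))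

text \<open>Real functions on open sets are the test objects: charts and maps are later judged by
  their coordinate functions. Openness of A is built in so that A can be intersected with chart
  domains freely.\<close>

definition smooth_fun :: "'a manifold \<Rightarrow> 'a set \<Rightarrow> ('a \<Rightarrow> real) \<Rightarrow> bool" where
  "smooth_fun M A h \<longleftrightarrow> openin (mtop M) A \<and> (\<forall>(U, \<phi>)\<in>atlas M. chart_smooth (mdim M) \<phi> (U \<inter> A) h)"

lemma smooth_fun_open: "smooth_fun M A h \<Longrightarrow> openin (mtop M) A"
  by (simp add: smooth_fun_def)

lemma smooth_fun_atlas: "smooth_fun M A h \<Longrightarrow> (U, \<phi>) \<in> atlas M \<Longrightarrow> chart_smooth (mdim M) \<phi> (U \<inter> A) h"
  by (auto simp: smooth_fun_def)

lemma smooth_fun_subset: "smooth_fun M A h \<Longrightarrow> B \<subseteq> A \<Longrightarrow> openin (mtop M) B \<Longrightarrow> smooth_fun M B h"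
  unfolding smooth_fun_def by (fastforce elim: chart_smooth_subset)

lemma smooth_fun_cong: "(\<And>x. x \<in> A \<Longrightarrow> h x = h' x) \<Longrightarrow> smooth_fun M A h \<longleftrightarrow> smooth_fun M A h'"
  unfolding smooth_fun_def by (intro conj_cong refl ball_cong) (auto intro!: chart_smooth_cong)

text \<open>Around each point an atlas chart is interposed. There h is smooth, and the atlas
  coordinates are smooth functions of \<phi>, so a change of coordinates gives smoothness on a small
  open set.\<close>

lemma smooth_fun_chart_smooth:
  assumes M: "is_manifold M" and c: "(U, \<phi>) \<in> maximal_atlas M" and h: "smooth_fun M A h"
  shows "chart_smooth (mdim M) \<phi> (U \<inter> A) h"
proof (rule chart_smooth_local[OF maximal_atlasD(1)[OF M c]])
  fix x assume x: "x \<in> U \<inter> A"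
  then have "x \<in> pts M" using maximal_atlasD(3)[OF M c] by auto
  then obtain V \<psi> where V: "(V, \<psi>) \<in> atlas M" "x \<in> V" using is_manifoldD(4)[OF M] by blast
  let ?B = "U \<inter> A \<inter> V"
  have oB: "openin (mtop M) ?B"
    using maximal_atlasD(2)[OF M c] smooth_fun_open[OF h] is_chartD(1)[OF is_manifoldD(3)[OF M V(1)]] by auto
  have "chart_smooth (mdim M) \<phi> ?B (\<lambda>x. h ((\<lambda>x. x) x))"
  proof (rule chart_smooth_pull[OF maximal_atlasD(1)[OF M c] oB _ is_manifoldD(3)[OF M V(1)] oB])
    show "chart_smooth (mdim M) \<phi> ?B (\<lambda>x. \<psi> x j)" if "j < mdim M" for j
      using maximal_atlasD(4)[OF M c V(1) that] by (rule chart_smooth_subset) auto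
    show "chart_smooth (mdim M) \<psi> ?B h" using smooth_fun_atlas[OF h V(1)] by (rule chart_smooth_subset) auto
  qed auto
  then show "\<exists>B. openin (mtop M) B \<and> x \<in> B \<and> B \<subseteq> U \<inter> A \<and> chart_smooth (mdim M) \<phi> B h"
    using oB x V(2) by (intro exI[of _ ?B]) auto
qed auto

lemma chart_smooth_smooth_fun:
  assumes M: "is_manifold M" and c: "(U, \<phi>) \<in> maximal_atlas M" and A: "openin (mtop M) A" "A \<subseteq> U"
    and h: "chart_smooth (mdim M) \<phi> A h"
  shows "smooth_fun M A h"
  unfolding smooth_fun_def
proof (intro conjI A(1), clarify)
  fix V \<psi> assume V: "(V, \<psi>) \<in> atlas M"
  have oB: "openin (mtop M) (V \<inter> A)" using A(1) is_chartD(1)[OF is_manifoldD(3)[OF M V(1)]] by auto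
  have "chart_smooth (mdim M) \<psi> (V \<inter> A) (\<lambda>x. h ((\<lambda>x. x) x))"
  proof (rule chart_smooth_pull[OF is_manifoldD(3)[OF M V(1)] oB _ maximal_atlasD(1)[OF M c] oB])
    show "chart_smooth (mdim M) \<psi> (V \<inter> A) (\<lambda>x. \<phi> x j)" if "j < mdim M" for j
      using maximal_atlasD(5)[OF M c V(1) that] by (rule chart_smooth_subset) (use A in auto)
    show "chart_smooth (mdim M) \<phi> (V \<inter> A) h" using h by (rule chart_smooth_subset) auto
  qed (use A in auto)
  then show "chart_smooth (mdim M) \<psi> (V \<inter> A) h" by simp
qed

lemma smooth_fun_coord:
  assumes "is_manifold M" "(U, \<phi>) \<in> maximal_atlas M" shows "smooth_fun M U (\<lambda>x. \<phi> x j)"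
  by (rule chart_smooth_smooth_fun[OF assms maximal_atlasD(2)[OF assms] subset_refl
        chart_smooth_coord[OF maximal_atlasD(1,2)[OF assms] subset_refl]])

lemma smooth_fun_local:
  assumes M: "is_manifold M" and loc: "\<And>x. x \<in> A \<Longrightarrow> \<exists>B. x \<in> B \<and> B \<subseteq> A \<and> smooth_fun M B h"
  shows "smooth_fun M A h"
  unfolding smooth_fun_def
proof (intro conjI, goal_cases)
  case 1
  have "\<exists>B. openin (mtop M) B \<and> x \<in> B \<and> B \<subseteq> A" if "x \<in> A" for x
    using loc[OF that] smooth_fun_open by blast
  then show ?case by (subst openin_subopen) blast
next
  case 2
  show ?case
  proof clarify
    fix U \<phi> assume c: "(U, \<phi>) \<in> atlas M"
    show "chart_smooth (mdim M) \<phi> (U \<inter> A) h"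
    proof (rule chart_smooth_local[OF is_manifoldD(3)[OF M c]])
      fix x assume x: "x \<in> U \<inter> A"
      then obtain B where B: "x \<in> B" "B \<subseteq> A" "smooth_fun M B h" using loc by blast
      show "\<exists>B. openin (mtop M) B \<and> x \<in> B \<and> B \<subseteq> U \<inter> A \<and> chart_smooth (mdim M) \<phi> B h"
        using B x smooth_fun_open[OF B(3)] smooth_fun_atlas[OF B(3) c] is_chartD(1)[OF is_manifoldD(3)[OF M c]]
        by (intro exI[of _ "U \<inter> B"]) auto
    qed auto
  qed
qed

lemma smooth_fun_compose:
  assumes M: "is_manifold M" and A: "openin (mtop M) A"
    and k: "\<And>x. x \<in> A \<Longrightarrow> k x \<in> V" "\<And>j. j < m \<Longrightarrow> smooth_fun M A (\<lambda>x. k x j)"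
    and G: "openin (Euclidean_space m) V" "smooth_on m V G"
  shows "smooth_fun M A (\<lambda>x. G (k x))"
  unfolding smooth_fun_def
proof (intro conjI A, clarify)
  fix U \<phi> assume c: "(U, \<phi>) \<in> atlas M"
  have o: "openin (mtop M) (U \<inter> A)" using A is_chartD(1)[OF is_manifoldD(3)[OF M c]] by auto
  show "chart_smooth (mdim M) \<phi> (U \<inter> A) (\<lambda>x. G (k x))"
    by (rule chart_smooth_compose[where k = k, OF is_manifoldD(3)[OF M c] o _ _ smooth_fun_atlas[OF k(2) c] G])
      (use k(1) in auto)
qed

text \<open>A constant factors through the zero-dimensional model space.\<close>

lemma smooth_fun_const:
  assumes "is_manifold M" "openin (mtop M) A" shows "smooth_fun M A (\<lambda>x. c)"
  by (rule smooth_fun_compose[OF assms, where m = 0 and k = "\<lambda>_ _. 0" and V = "Esp 0" and G = "\<lambda>_. c"])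
     (auto simp: Esp_iff smooth_on_const)

text \<open>Compatibility has two directions. One is smoothness of the new coordinates; for the
  other it suffices to express, near each point, a single known chart through the new coordinates,
  because the transition from that chart to any atlas chart is smooth.\<close>

lemma maximal_atlasI:
  assumes M: "is_manifold M" and c: "is_chart (mdim M) (mtop M) U \<phi>"
    and s: "\<And>i. i < mdim M \<Longrightarrow> smooth_fun M U (\<lambda>x. \<phi> x i)"
    and loc: "\<And>p. p \<in> U \<Longrightarrow> \<exists>V \<psi> A. (V, \<psi>) \<in> maximal_atlas M \<and> openin (mtop M) A \<and> p \<in> A \<and> A \<subseteq> U \<inter> V \<and>
       (\<forall>i<mdim M. chart_smooth (mdim M) \<phi> A (\<lambda>x. \<psi> x i))"
  shows "(U, \<phi>) \<in> maximal_atlas M"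
  unfolding maximal_atlas_iff[OF M]
proof (intro conjI c allI impI)
  fix V \<psi> i assume V: "(V, \<psi>) \<in> atlas M" and i: "i < mdim M"
  show "chart_smooth (mdim M) \<psi> (U \<inter> V) (\<lambda>x. \<phi> x i)"
    using smooth_fun_atlas[OF s[OF i] V] by (simp add: Int_commute)
  show "chart_smooth (mdim M) \<phi> (U \<inter> V) (\<lambda>x. \<psi> x i)"
  proof (rule chart_smooth_local[OF c])
    fix x assume x: "x \<in> U \<inter> V"
    then obtain V' \<psi>' A where V': "(V', \<psi>') \<in> maximal_atlas M" "openin (mtop M) A" "x \<in> A" "A \<subseteq> U \<inter> V'"
       "\<And>i. i<mdim M \<Longrightarrow> chart_smooth (mdim M) \<phi> A (\<lambda>x. \<psi>' x i)" using loc by blast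
    have oV: "openin (mtop M) V" using is_manifoldD(3)[OF M V] is_chartD(1) by blast
    have o: "openin (mtop M) (A \<inter> V)" using oV V'(2) by auto
    have "chart_smooth (mdim M) \<phi> (A \<inter> V) (\<lambda>x. \<psi> ((\<lambda>x. x) x) i)"
    proof (rule chart_smooth_pull[OF c o _ maximal_atlasD(1)[OF M V'(1)] o])
      show "chart_smooth (mdim M) \<phi> (A \<inter> V) (\<lambda>x. \<psi>' x j)" if "j < mdim M" for j
        using V'(5)[OF that] by (rule chart_smooth_subset) auto
      show "chart_smooth (mdim M) \<psi>' (A \<inter> V) (\<lambda>x. \<psi> x i)"
        using maximal_atlasD(4)[OF M V'(1) V i] by (rule chart_smooth_subset) (use V'(4) in auto)
    qed (use V'(4) in auto)
    then show "\<exists>B. openin (mtop M) B \<and> x \<in> B \<and> B \<subseteq> U \<inter> V \<and> chart_smooth (mdim M) \<phi> B (\<lambda>x. \<psi> x i)"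
      using o V'(3,4) x by (intro exI[of _ "A \<inter> V"]) auto
  qed auto
qed

lemma maximal_atlas_subset:
  assumes M: "is_manifold M" and c: "(U, \<phi>) \<in> maximal_atlas M" and A: "openin (mtop M) A" "A \<subseteq> U"
  shows "(A, \<phi>) \<in> maximal_atlas M"
proof (rule maximal_atlasI[OF M is_chart_subset[OF maximal_atlasD(1)[OF M c] A]])
  show "smooth_fun M A (\<lambda>x. \<phi> x i)" for i by (rule smooth_fun_subset[OF smooth_fun_coord[OF M c] A(2,1)])
  show "\<exists>V \<psi> B. (V, \<psi>) \<in> maximal_atlas M \<and> openin (mtop M) B \<and> p \<in> B \<and> B \<subseteq> A \<inter> V \<and>
       (\<forall>i<mdim M. chart_smooth (mdim M) \<phi> B (\<lambda>x. \<psi> x i))" if "p \<in> A" for p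
    using c A chart_smooth_coord[OF maximal_atlasD(1)[OF M c] A] that
    by (intro exI[of _ U] exI[of _ \<phi>] exI[of _ A]) auto
qed

text \<open>Openness of the image of the new chart is obtained from invariance of domain.\<close>

lemma maximal_atlas_recoordinatize:
  assumes M: "is_manifold M" and c: "(U, \<phi>) \<in> maximal_atlas M"
    and \<Theta>: "\<And>x. x \<in> U \<Longrightarrow> \<Theta> x \<in> D" "\<And>i. i < mdim M \<Longrightarrow> smooth_fun M U (\<lambda>x. \<Theta> x i)"
    and D: "openin (Euclidean_space (mdim M)) D"
    and G: "\<And>j. j < mdim M \<Longrightarrow> smooth_on (mdim M) D (G j)"
      "\<And>x j. x \<in> U \<Longrightarrow> j < mdim M \<Longrightarrow> G j (\<Theta> x) = \<phi> x j"
  shows "(U, \<Theta>) \<in> maximal_atlas M"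
proof -
  define n where "n = mdim M"
  \<comment> \<open>G is prescribed below the dimension only; padding by zero puts the inverse into
    the model space.\<close>
  define G' where "G' z = (\<lambda>j. if j < n then G j z else 0)" for z
  note cc = is_chartD[OF maximal_atlasD(1)[OF M c], folded n_def]
  have GT: "G' (\<Theta> x) = \<phi> x" if "x \<in> U" for x
    using G(2)[OF that] cc(7)[OF that] by (auto simp: G'_def n_def Esp_iff fun_eq_iff)
  then have inj: "inj_on \<Theta> U" using cc(4) unfolding inj_on_def by metis
  have inv: "inv_into U \<phi> (\<phi> x) = x" if "x \<in> U" for x using that cc(4) by simp
  have Th: "continuous_map (subtopology (Euclidean_space n) (\<phi> ` U)) (Euclidean_space n) (\<lambda>z. \<Theta> (inv_into U \<phi> z))"
    unfolding cm_into_Esp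
  proof (intro conjI ballI allI impI)
    fix z assume "z \<in> topspace (subtopology (Euclidean_space n) (\<phi> ` U))"
    then show "\<Theta> (inv_into U \<phi> z) \<in> Esp n"
      using \<Theta>(1) openin_Esp_subset[OF D] inv by (auto simp: n_def)
  next
    fix i assume "i < n"
    then have "chart_smooth n \<phi> U (\<lambda>x. \<Theta> x i)" using smooth_fun_chart_smooth[OF M c \<Theta>(2)] by (simp add: n_def)
    then have "smooth_on n (\<phi> ` U) (\<lambda>z. \<Theta> (inv_into U \<phi> z) i)"
      using chart_smooth_iff_inv[OF maximal_atlasD(1)[OF M c] cc(1) subset_refl] by (simp add: n_def)
    then have "continuous_on (\<phi> ` U) (\<lambda>z. \<Theta> (inv_into U \<phi> z) i)" by (rule smooth_on_continuous[OF cc(3)])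
    then show "continuous_map (subtopology (Euclidean_space n) (\<phi> ` U)) euclideanreal (\<lambda>z. \<Theta> (inv_into U \<phi> z) i)"
      using cm_real_iff[OF openin_Esp_subset[OF cc(3)]] by blast
  qed
  have oT: "openin (Euclidean_space n) (\<Theta> ` U)"
  proof -
    have "inj_on (\<lambda>z. \<Theta> (inv_into U \<phi> z)) (\<phi> ` U)" using inj inv by (auto simp: inj_on_def)
    from invariance_of_domain_Euclidean_space[OF cc(3) Th this]
    show ?thesis using inv by (simp add: image_image)
  qed
  have TD: "\<Theta> ` U \<subseteq> D" using \<Theta>(1) by auto
  have Gs: "smooth_on n (\<Theta> ` U) (G j)" if "j < n" for j
    using smooth_on_subset[OF G(1) TD] that by (simp add: n_def)
  have chart: "is_chart n (mtop M) U \<Theta>"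
  proof (rule is_chartI(1)[OF cc(1) oT, of \<Theta> "\<lambda>z. inv_into U \<phi> (G' z)"])
    have "continuous_map (subtopology (mtop M) U) (subtopology (Euclidean_space n) (\<phi> ` U)) \<phi>"
      using cc(5) by (auto simp: continuous_map_in_subtopology)
    from continuous_map_compose[OF this Th]
    show "continuous_map (subtopology (mtop M) U) (Euclidean_space n) \<Theta>"
      by (rule continuous_map_eq) (use inv in auto)
    have "continuous_map (subtopology (Euclidean_space n) (\<Theta> ` U)) (Euclidean_space n) G'"
      unfolding cm_into_Esp
    proof (intro conjI ballI allI impI)
      fix i assume i: "i < n"
      then have e: "(\<lambda>z. G' z i) = G i" by (auto simp: G'_def)
      show "continuous_map (subtopology (Euclidean_space n) (\<Theta> ` U)) euclideanreal (\<lambda>z. G' z i)"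
        unfolding e cm_real_iff[OF openin_Esp_subset[OF oT]]
        by (rule smooth_on_continuous[OF oT Gs[OF i]])
    qed (auto simp: G'_def Esp_iff)
    moreover have "G' ` (\<Theta> ` U) \<subseteq> \<phi> ` U" using GT by auto
    ultimately have "continuous_map (subtopology (Euclidean_space n) (\<Theta> ` U)) (subtopology (Euclidean_space n) (\<phi> ` U)) G'"
      by (auto simp: continuous_map_in_subtopology)
    from continuous_map_compose[OF this cc(6)]
    show "continuous_map (subtopology (Euclidean_space n) (\<Theta> ` U)) (mtop M) (\<lambda>z. inv_into U \<phi> (G' z))"
      by (simp add: o_def)
  qed (use GT inv in auto)
  show ?thesis
  proof (rule maximal_atlasI[OF M])
    show "is_chart (mdim M) (mtop M) U \<Theta>" using chart by (simp add: n_def)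
    show "smooth_fun M U (\<lambda>x. \<Theta> x i)" if "i < mdim M" for i by (rule \<Theta>(2)[OF that])
    have "chart_smooth (mdim M) \<Theta> U (\<lambda>x. \<phi> x i)" if "i < mdim M" for i
      unfolding chart_smooth_def using Gs[of i] G(2) that by (auto simp: n_def)
    then show "\<exists>V \<psi> A. (V, \<psi>) \<in> maximal_atlas M \<and> openin (mtop M) A \<and> p \<in> A \<and> A \<subseteq> U \<inter> V \<and>
       (\<forall>i<mdim M. chart_smooth (mdim M) \<Theta> A (\<lambda>x. \<psi> x i))" if "p \<in> U" for p
      using c cc(1) that by (intro exI[of _ U] exI[of _ \<phi>]) auto
  qed
qed

subsection \<open>Smooth maps\<close>

lemma smooth_map_continuous: "smooth_map M N f \<Longrightarrow> continuous_map (mtop M) (mtop N) f"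
  by (simp add: smooth_map_def)

lemma smooth_map_in: "smooth_map M N f \<Longrightarrow> x \<in> pts M \<Longrightarrow> f x \<in> pts N"
  using smooth_map_continuous by (force simp: continuous_map_def)

lemma smooth_map_vimage_open:
  "smooth_map M N f \<Longrightarrow> openin (mtop N) B \<Longrightarrow> openin (mtop M) {x \<in> pts M. f x \<in> B}"
  by (rule openin_continuous_map_preimage[OF smooth_map_continuous])

lemma smooth_map_atlas_smooth_fun:
  assumes M: "is_manifold M" and N: "is_manifold N" and f: "smooth_map M N f"
    and V: "(V, \<psi>) \<in> atlas N" and i: "i < mdim N"
  shows "smooth_fun M {x \<in> pts M. f x \<in> V} (\<lambda>x. \<psi> (f x) i)"
  unfolding smooth_fun_def
proof (intro conjI smooth_map_vimage_open[OF f is_chartD(1)[OF is_manifoldD(3)[OF N V]]], clarify)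
  fix U \<phi> assume U: "(U, \<phi>) \<in> atlas M"
  note c = is_manifoldD(3)[OF M U]
  have e: "U \<inter> {x \<in> pts M. f x \<in> V} = U \<inter> f -` V" using is_chartD(2)[OF c] by auto
  have o: "openin (mtop M) (U \<inter> {x \<in> pts M. f x \<in> V})"
    using is_chartD(1)[OF c] smooth_map_vimage_open[OF f is_chartD(1)[OF is_manifoldD(3)[OF N V]]] by auto
  have "smooth_on (mdim M) (\<phi> ` (U \<inter> f -` V)) (\<lambda>x. \<psi> (f (inv_into U \<phi> x)) i)"
    using f U V i unfolding smooth_map_def by fast
  then show "chart_smooth (mdim M) \<phi> (U \<inter> {x \<in> pts M. f x \<in> V}) (\<lambda>x. \<psi> (f x) i)"
    unfolding e chart_smooth_iff_inv[OF c o[unfolded e] Int_lower1] .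
qed

text \<open>Near \<open>f x\<close> the function h is a smooth expression in the coordinates of an
  atlas chart, and these coordinates pulled back along f are smooth by the definition of
  \<open>smooth_map\<close>.\<close>

lemma smooth_fun_pullback:
  assumes M: "is_manifold M" and N: "is_manifold N" and f: "smooth_map M N f" and h: "smooth_fun N B h"
  shows "smooth_fun M {x \<in> pts M. f x \<in> B} (\<lambda>x. h (f x))"
proof (rule smooth_fun_local[OF M])
  fix x assume x: "x \<in> {x \<in> pts M. f x \<in> B}"
  then have "f x \<in> pts N" using smooth_map_in[OF f] by auto
  then obtain V \<psi> where V: "(V, \<psi>) \<in> atlas N" "f x \<in> V" using is_manifoldD(4)[OF N] by blast
  note c = is_manifoldD(3)[OF N V(1)]
  have oVB: "openin (mtop N) (V \<inter> B)" using is_chartD(1)[OF c] smooth_fun_open[OF h] by auto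
  obtain G where G: "smooth_on (mdim N) (\<psi> ` (V \<inter> B)) G" "\<And>y. y \<in> V \<inter> B \<Longrightarrow> G (\<psi> y) = h y"
    using smooth_fun_atlas[OF h V(1)] by (auto simp: chart_smooth_def)
  let ?A = "{x \<in> pts M. f x \<in> V \<inter> B}"
  have oA: "openin (mtop M) ?A" by (rule smooth_map_vimage_open[OF f oVB])
  have "smooth_fun M ?A (\<lambda>x. G (\<psi> (f x)))"
  proof (rule smooth_fun_compose[where k = "\<lambda>x. \<psi> (f x)", OF M oA _ _ is_chart_image_open[OF c oVB Int_lower1] G(1)])
    show "smooth_fun M ?A (\<lambda>x. \<psi> (f x) j)" if "j < mdim N" for j
      by (rule smooth_fun_subset[OF smooth_map_atlas_smooth_fun[OF M N f V(1) that] _ oA]) auto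
  qed auto
  then have "smooth_fun M ?A (\<lambda>x. h (f x))" by (rule iffD1[OF smooth_fun_cong, rotated]) (use G(2) in auto)
  then show "\<exists>A. x \<in> A \<and> A \<subseteq> {x \<in> pts M. f x \<in> B} \<and> smooth_fun M A (\<lambda>x. h (f x))"
    using x V(2) by (intro exI[of _ ?A]) auto
qed

lemma smooth_map_smooth_fun:
  assumes "is_manifold M" "is_manifold N" "smooth_map M N f" "(V, \<psi>) \<in> maximal_atlas N"
  shows "smooth_fun M {x \<in> pts M. f x \<in> V} (\<lambda>x. \<psi> (f x) i)"
  by (rule smooth_fun_pullback[OF assms(1-3) smooth_fun_coord[OF assms(2,4)]])

text \<open>One chart of the maximal atlas around each image point is enough, since every atlas
  chart of N is reached from it by a smooth transition. Continuity makes the preimages of chart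
  domains open.\<close>

lemma smooth_mapI:
  assumes M: "is_manifold M" and N: "is_manifold N" and f: "continuous_map (mtop M) (mtop N) f"
    and loc: "\<And>p. p \<in> pts M \<Longrightarrow> \<exists>V \<psi> A. (V, \<psi>) \<in> maximal_atlas N \<and> p \<in> A \<and> f ` A \<subseteq> V \<and>
       (\<forall>i<mdim N. smooth_fun M A (\<lambda>x. \<psi> (f x) i))"
  shows "smooth_map M N f"
  unfolding smooth_map_def
proof (intro conjI f, clarify)
  fix U \<phi> V' \<psi>' i assume U: "(U, \<phi>) \<in> atlas M" and V': "(V', \<psi>') \<in> atlas N" and i: "i < mdim N"
  note c = is_manifoldD(3)[OF M U] and d = is_manifoldD(3)[OF N V']
  let ?B = "{x \<in> pts M. f x \<in> V'}"
  have oB: "openin (mtop M) ?B" by (rule openin_continuous_map_preimage[OF f is_chartD(1)[OF d]])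
  have "smooth_fun M ?B (\<lambda>x. \<psi>' (f x) i)"
  proof (rule smooth_fun_local[OF M])
    fix x assume x: "x \<in> ?B"
    then have "x \<in> pts M" by simp
    from loc[OF this] obtain V \<psi> A where V: "(V, \<psi>) \<in> maximal_atlas N" "x \<in> A" "f ` A \<subseteq> V"
       "\<And>i. i < mdim N \<Longrightarrow> smooth_fun M A (\<lambda>x. \<psi> (f x) i)" by blast
    note e = maximal_atlasD(1)[OF N V(1)]
    have oA: "openin (mtop M) A" using smooth_fun_open[OF V(4)[OF i]] .
    have oV: "openin (mtop N) (V \<inter> V')" using is_chartD(1)[OF e] is_chartD(1)[OF d] by auto
    obtain G where G: "smooth_on (mdim N) (\<psi> ` (V \<inter> V')) G" "\<And>y. y \<in> V \<inter> V' \<Longrightarrow> G (\<psi> y) = \<psi>' y i"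
      using maximal_atlasD(4)[OF N V(1) V' i] by (auto simp: chart_smooth_def)
    have oC: "openin (mtop M) (A \<inter> ?B)" using oA oB by auto
    have "smooth_fun M (A \<inter> ?B) (\<lambda>x. G (\<psi> (f x)))"
    proof (rule smooth_fun_compose[where k = "\<lambda>x. \<psi> (f x)", OF M oC _ _ is_chart_image_open[OF e oV Int_lower1] G(1)])
      show "smooth_fun M (A \<inter> ?B) (\<lambda>x. \<psi> (f x) j)" if "j < mdim N" for j
        by (rule smooth_fun_subset[OF V(4)[OF that] _ oC]) auto
    qed (use V(3) in auto)
    then have "smooth_fun M (A \<inter> ?B) (\<lambda>x. \<psi>' (f x) i)"
      by (rule iffD1[OF smooth_fun_cong, rotated]) (use G(2) V(3) in auto)
    then show "\<exists>B. x \<in> B \<and> B \<subseteq> ?B \<and> smooth_fun M B (\<lambda>x. \<psi>' (f x) i)"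
      using x V(2) by (intro exI[of _ "A \<inter> ?B"]) auto
  qed
  from smooth_fun_atlas[OF this U] have "chart_smooth (mdim M) \<phi> (U \<inter> ?B) (\<lambda>x. \<psi>' (f x) i)" .
  moreover have "U \<inter> ?B = U \<inter> f -` V'" using is_chartD(2)[OF c] by auto
  moreover have "openin (mtop M) (U \<inter> ?B)" using is_chartD(1)[OF c] oB by auto
  ultimately show "smooth_on (mdim M) (\<phi> ` (U \<inter> f -` V')) (\<lambda>x. \<psi>' (f (inv_into U \<phi> x)) i)"
    using chart_smooth_iff_inv[OF c, of "U \<inter> f -` V'"] by simp
qed

lemma smooth_map_compose:
  assumes M: "is_manifold M" and N: "is_manifold N" and L: "is_manifold L"
    and f: "smooth_map M N f" and g: "smooth_map N L g"
  shows "smooth_map M L (\<lambda>x. g (f x))"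
proof (rule smooth_mapI[OF M L])
  show "continuous_map (mtop M) (mtop L) (\<lambda>x. g (f x))"
    using continuous_map_compose[OF smooth_map_continuous[OF f] smooth_map_continuous[OF g]] by (simp add: o_def)
  fix p assume p: "p \<in> pts M"
  then have "g (f p) \<in> pts L" using smooth_map_in f g by metis
  then obtain V \<psi> where V: "(V, \<psi>) \<in> maximal_atlas L" "g (f p) \<in> V"
    using is_manifoldD(4)[OF L] is_manifoldD(6)[OF L] by blast
  have "smooth_fun M {x \<in> pts M. f x \<in> {y \<in> pts N. g y \<in> V}} (\<lambda>x. \<psi> (g (f x)) i)" for i
    by (rule smooth_fun_pullback[OF M N f smooth_map_smooth_fun[OF N L g V(1)]])
  then show "\<exists>V \<psi> A. (V, \<psi>) \<in> maximal_atlas L \<and> p \<in> A \<and> (\<lambda>x. g (f x)) ` A \<subseteq> V \<and>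
       (\<forall>i<mdim L. smooth_fun M A (\<lambda>x. \<psi> (g (f x)) i))"
    using V p smooth_map_in[OF f p]
    by (intro exI[of _ V] exI[of _ \<psi>] exI[of _ "{x \<in> pts M. f x \<in> {y \<in> pts N. g y \<in> V}}"]) auto
qed

lemma smooth_map_cong:
  assumes M: "is_manifold M" and N: "is_manifold N" and f: "smooth_map M N f" and eq: "\<And>x. x \<in> pts M \<Longrightarrow> f x = g x"
  shows "smooth_map M N g"
proof (rule smooth_mapI[OF M N])
  show "continuous_map (mtop M) (mtop N) g"
    using continuous_map_eq[OF smooth_map_continuous[OF f]] eq by blast
  fix p assume p: "p \<in> pts M"
  then obtain V \<psi> where V: "(V, \<psi>) \<in> maximal_atlas N" "f p \<in> V"
    using is_manifoldD(4)[OF N] is_manifoldD(6)[OF N] smooth_map_in[OF f p] by blast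
  have "smooth_fun M {x \<in> pts M. f x \<in> V} (\<lambda>x. \<psi> (g x) i)" for i
    by (rule iffD1[OF smooth_fun_cong smooth_map_smooth_fun[OF M N f V(1)]]) (use eq in auto)
  then show "\<exists>V \<psi> A. (V, \<psi>) \<in> maximal_atlas N \<and> p \<in> A \<and> g ` A \<subseteq> V \<and>
       (\<forall>i<mdim N. smooth_fun M A (\<lambda>x. \<psi> (g x) i))"
    using V p eq
    by (intro exI[of _ V] exI[of _ \<psi>] exI[of _ "{x \<in> pts M. f x \<in> V}"]) auto
qed

lemma smooth_map_id:
  assumes M: "is_manifold M" shows "smooth_map M M (\<lambda>x. x)"
proof (rule smooth_mapI[OF M M])
  fix p assume "p \<in> pts M"
  then obtain V \<psi> where V: "(V, \<psi>) \<in> maximal_atlas M" "p \<in> V"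
    using is_manifoldD(4)[OF M] is_manifoldD(6)[OF M] by blast
  then show "\<exists>V \<psi> A. (V, \<psi>) \<in> maximal_atlas M \<and> p \<in> A \<and> (\<lambda>x. x) ` A \<subseteq> V \<and>
       (\<forall>i<mdim M. smooth_fun M A (\<lambda>x. \<psi> x i))"
    using smooth_fun_coord[OF M] by blast
qed auto

lemma smooth_map_const:
  assumes M: "is_manifold M" and N: "is_manifold N" and c: "c \<in> pts N"
  shows "smooth_map M N (\<lambda>x. c)"
proof (rule smooth_mapI[OF M N])
  obtain V \<psi> where V: "(V, \<psi>) \<in> maximal_atlas N" "c \<in> V"
    using is_manifoldD(4)[OF N] is_manifoldD(6)[OF N] c by blast
  then show "\<exists>V \<psi> A. (V, \<psi>) \<in> maximal_atlas N \<and> p \<in> A \<and> (\<lambda>x. c) ` A \<subseteq> V \<and>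
       (\<forall>i<mdim N. smooth_fun M A (\<lambda>x. \<psi> c i))" if "p \<in> pts M" for p
    using smooth_fun_const[OF M openin_topspace] that by blast
qed (use c in auto)

lemma point_manifold: "is_manifold point_manifold" "pts point_manifold = {()}" "mdim point_manifold = 0"
proof -
  show "is_manifold point_manifold"
  proof (rule is_manifoldI)
    show "is_chart (mdim point_manifold) (mtop point_manifold) U \<phi>"
      if "(U, \<phi>) \<in> atlas point_manifold" for U \<phi>
    proof (rule is_chartI(1)[where W = "Esp 0" and g = "\<lambda>_. ()"])
      show "continuous_map (subtopology (mtop point_manifold) U) (Euclidean_space (mdim point_manifold)) \<phi>"
        using that unfolding cm_into_Esp by (auto simp: point_manifold_def Esp_iff)
    qed (use that in \<open>auto simp: point_manifold_def Esp_iff\<close>)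
  qed (auto simp: point_manifold_def Hausdorff_space_discrete_topology second_countable_discrete_topology)
qed (auto simp: point_manifold_def)

subsection \<open>Products\<close>

text \<open>With \<open>shift\<close> this gives the two projections of R^(m+n), and
  \<open>cjoin\<close> is the inverse pairing. \<open>shift\<close> needs no cut-off: a vector of
  length m+n, shifted by m, vanishes from n on by itself.\<close>

definition trunc :: "nat \<Rightarrow> (nat \<Rightarrow> real) \<Rightarrow> nat \<Rightarrow> real" where
  "trunc q z i = (if i < q then z i else 0)"

definition shift :: "nat \<Rightarrow> (nat \<Rightarrow> real) \<Rightarrow> nat \<Rightarrow> real" where
  "shift q z i = z (q + i)"

definition cjoin :: "nat \<Rightarrow> (nat \<Rightarrow> real) \<Rightarrow> (nat \<Rightarrow> real) \<Rightarrow> nat \<Rightarrow> real" where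
  "cjoin m a b i = (if i < m then a i else b (i - m))"

lemma trunc_Esp: "trunc q z \<in> Esp q" by (auto simp: trunc_def Esp_iff)
lemma shift_Esp: "z \<in> Esp (m + n) \<Longrightarrow> shift m z \<in> Esp n" by (auto simp: shift_def Esp_iff)
lemma cjoin_Esp: "b \<in> Esp n \<Longrightarrow> cjoin m a b \<in> Esp (m + n)" by (auto simp: cjoin_def Esp_iff)
lemma trunc_cjoin: "a \<in> Esp m \<Longrightarrow> trunc m (cjoin m a b) = a" by (auto simp: trunc_def cjoin_def Esp_iff)
lemma shift_cjoin: "shift m (cjoin m a b) = b" by (auto simp: shift_def cjoin_def)
lemma cjoin_trunc_shift: "cjoin m (trunc m z) (shift m z) = z" by (auto simp: cjoin_def trunc_def shift_def)

lemma cm_Esp_coord: "continuous_map (subtopology (Euclidean_space n) W) euclideanreal (\<lambda>z. z i)"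
proof -
  have "continuous_map (subtopology (Euclidean_space n) (W \<inter> Esp n)) euclideanreal (\<lambda>z. z i)"
    by (subst cm_real_iff) (auto intro: continuous_on_coord)
  then show ?thesis by (metis subtopology_restrict Int_commute)
qed

lemma cm_trunc: "continuous_map (subtopology (Euclidean_space n) W) (Euclidean_space q) (trunc q)"
  unfolding cm_into_Esp using trunc_Esp cm_Esp_coord by (auto simp: trunc_def)

lemma cm_shift: "continuous_map (subtopology (Euclidean_space (m + n)) W) (Euclidean_space n) (shift m)"
  unfolding cm_into_Esp using shift_Esp cm_Esp_coord by (auto simp: shift_def)

lemma openin_trunc:
  "openin (Euclidean_space q) W \<Longrightarrow> openin (Euclidean_space n) {z \<in> Esp n. trunc q z \<in> W}"
  using openin_continuous_map_preimage[OF cm_trunc[of n "Esp n" q]] by (simp add: subtopology_topspace)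

lemma openin_shift:
  "openin (Euclidean_space n) W \<Longrightarrow> openin (Euclidean_space (m + n)) {z \<in> Esp (m + n). shift m z \<in> W}"
  using openin_continuous_map_preimage[OF cm_shift[of m n "Esp (m + n)"]] by (simp add: subtopology_topspace)

lemma smooth_on_trunc:
  assumes W: "openin (Euclidean_space q) W" and g: "smooth_on q W g"
  shows "smooth_on n {z \<in> Esp n. trunc q z \<in> W} (\<lambda>z. g (trunc q z))"
proof (rule smooth_on_compose[where h = "trunc q", OF openin_trunc[OF W] W _ _ g])
  show "smooth_on n {z \<in> Esp n. trunc q z \<in> W} (\<lambda>x. trunc q x j)" if "j < q" for j
    using that smooth_on_coord[OF openin_trunc[OF W]] by (simp add: trunc_def)
qed auto

lemma smooth_on_shift:
  assumes W: "openin (Euclidean_space n) W" and g: "smooth_on n W g"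
  shows "smooth_on (m + n) {z \<in> Esp (m + n). shift m z \<in> W} (\<lambda>z. g (shift m z))"
proof (rule smooth_on_compose[where h = "shift m", OF openin_shift[OF W] W _ _ g])
  show "smooth_on (m + n) {z \<in> Esp (m + n). shift m z \<in> W} (\<lambda>x. shift m x j)" if "j < n" for j
    using smooth_on_coord[OF openin_shift[OF W]] by (simp add: shift_def)
qed auto

definition pchart :: "nat \<Rightarrow> ('a \<Rightarrow> nat \<Rightarrow> real) \<Rightarrow> ('b \<Rightarrow> nat \<Rightarrow> real) \<Rightarrow> 'a \<times> 'b \<Rightarrow> nat \<Rightarrow> real" where
  "pchart m \<phi> \<psi> = (\<lambda>(x, y). cjoin m (\<phi> x) (\<psi> y))"

lemma is_chart_prod:
  assumes c: "is_chart m T U \<phi>" and d: "is_chart n S V \<psi>"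
  shows "is_chart (m + n) (prod_topology T S) (U \<times> V) (pchart m \<phi> \<psi>)"
proof -
  note cc = is_chartD[OF c] and dd = is_chartD[OF d]
  define W where "W = {z \<in> Esp (m + n). trunc m z \<in> \<phi> ` U} \<inter> {z \<in> Esp (m + n). shift m z \<in> \<psi> ` V}"
  define g where "g z = (inv_into U \<phi> (trunc m z), inv_into V \<psi> (shift m z))" for z
  have UV: "subtopology (prod_topology T S) (U \<times> V) = prod_topology (subtopology T U) (subtopology S V)"
    by (rule subtopology_Times)
  show ?thesis
  proof (rule is_chartI(1)[where W = W and g = g])
    show "openin (prod_topology T S) (U \<times> V)" using cc(1) dd(1) by (simp add: openin_prod_Times_iff)
    show "openin (Euclidean_space (m + n)) W"
      unfolding W_def by (intro openin_Int openin_trunc openin_shift cc(3) dd(3))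
    have a: "continuous_map (subtopology (prod_topology T S) (U \<times> V)) (Euclidean_space m) (\<lambda>p. \<phi> (fst p))"
      unfolding UV using continuous_map_compose[OF continuous_map_fst cc(5)] by (simp add: o_def)
    have b: "continuous_map (subtopology (prod_topology T S) (U \<times> V)) (Euclidean_space n) (\<lambda>p. \<psi> (snd p))"
      unfolding UV using continuous_map_compose[OF continuous_map_snd dd(5)] by (simp add: o_def)
    show "continuous_map (subtopology (prod_topology T S) (U \<times> V)) (Euclidean_space (m + n)) (pchart m \<phi> \<psi>)"
      unfolding cm_into_Esp
    proof (intro conjI ballI allI impI)
      show "pchart m \<phi> \<psi> x \<in> Esp (m + n)" if "x \<in> topspace (subtopology (prod_topology T S) (U \<times> V))" for x
        using that dd(7) by (auto simp: pchart_def intro: cjoin_Esp)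
      show "continuous_map (subtopology (prod_topology T S) (U \<times> V)) euclideanreal (\<lambda>x. pchart m \<phi> \<psi> x i)"
        if "i < m + n" for i
      proof (cases "i < m")
        case True
        then have "(\<lambda>x. pchart m \<phi> \<psi> x i) = (\<lambda>p. \<phi> (fst p) i)" by (auto simp: pchart_def cjoin_def)
        then show ?thesis using a True unfolding cm_into_Esp by simp
      next
        case False
        then have "(\<lambda>x. pchart m \<phi> \<psi> x i) = (\<lambda>p. \<psi> (snd p) (i - m))" by (auto simp: pchart_def cjoin_def)
        then show ?thesis using b False that unfolding cm_into_Esp by simp
      qed
    qed
    have "continuous_map (subtopology (Euclidean_space (m + n)) W) (subtopology (Euclidean_space m) (\<phi> ` U)) (trunc m)"
      using cm_trunc by (auto simp: continuous_map_in_subtopology W_def)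
    from continuous_map_compose[OF this cc(6)]
    have g1: "continuous_map (subtopology (Euclidean_space (m + n)) W) T (\<lambda>z. inv_into U \<phi> (trunc m z))" by (simp add: o_def)
    have "continuous_map (subtopology (Euclidean_space (m + n)) W) (subtopology (Euclidean_space n) (\<psi> ` V)) (shift m)"
      using cm_shift by (auto simp: continuous_map_in_subtopology W_def)
    from continuous_map_compose[OF this dd(6)]
    have g2: "continuous_map (subtopology (Euclidean_space (m + n)) W) S (\<lambda>z. inv_into V \<psi> (shift m z))" by (simp add: o_def)
    show "continuous_map (subtopology (Euclidean_space (m + n)) W) (prod_topology T S) g"
      unfolding g_def by (rule continuous_map_pairedI[OF g1 g2])
    fix x assume "x \<in> U \<times> V"
    then show "pchart m \<phi> \<psi> x \<in> W \<and> g (pchart m \<phi> \<psi> x) = x"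
      using cc(4,7) dd(4,7) by (auto simp: W_def g_def pchart_def trunc_cjoin shift_cjoin intro: cjoin_Esp)
  next
    fix z assume "z \<in> W"
    then show "g z \<in> U \<times> V \<and> pchart m \<phi> \<psi> (g z) = z"
      by (auto simp: W_def g_def pchart_def f_inv_into_f inv_into_into cjoin_trunc_shift)
  qed
qed

lemma chart_smooth_prod:
  assumes c: "is_chart m T U \<phi>" "openin T A" "A \<subseteq> U" and d: "is_chart n S V \<psi>" "openin S B" "B \<subseteq> V"
  shows "chart_smooth m \<phi> A h \<Longrightarrow> chart_smooth (m + n) (pchart m \<phi> \<psi>) (A \<times> B) (\<lambda>p. h (fst p))"
    and "chart_smooth n \<psi> B h' \<Longrightarrow> chart_smooth (m + n) (pchart m \<phi> \<psi>) (A \<times> B) (\<lambda>p. h' (snd p))"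
proof -
  note cc = is_chartD[OF c(1)] and dd = is_chartD[OF d(1)]
  have tr: "trunc m (pchart m \<phi> \<psi> (x, y)) = \<phi> x" "shift m (pchart m \<phi> \<psi> (x, y)) = \<psi> y"
     "pchart m \<phi> \<psi> (x, y) \<in> Esp (m + n)" if "x \<in> A" "y \<in> B" for x y
  proof -
    have "\<phi> x \<in> Esp m" "\<psi> y \<in> Esp n" using that c(3) d(3) cc(7) dd(7) by blast+
    then show "trunc m (pchart m \<phi> \<psi> (x, y)) = \<phi> x" "shift m (pchart m \<phi> \<psi> (x, y)) = \<psi> y"
      "pchart m \<phi> \<psi> (x, y) \<in> Esp (m + n)" by (simp_all add: pchart_def trunc_cjoin shift_cjoin cjoin_Esp)
  qed
  show "chart_smooth (m + n) (pchart m \<phi> \<psi>) (A \<times> B) (\<lambda>p. h (fst p))" if h: "chart_smooth m \<phi> A h"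
  proof -
    obtain G where G: "smooth_on m (\<phi> ` A) G" "\<forall>x\<in>A. G (\<phi> x) = h x" using h by (auto simp: chart_smooth_def)
    have "smooth_on (m + n) (pchart m \<phi> \<psi> ` (A \<times> B)) (\<lambda>z. G (trunc m z))"
      by (rule smooth_on_subset[OF smooth_on_trunc[OF is_chart_image_open[OF c] G(1)]]) (use tr in auto)
    then show ?thesis unfolding chart_smooth_def using G(2) tr by (intro exI[of _ "\<lambda>z. G (trunc m z)"]) auto
  qed
  show "chart_smooth (m + n) (pchart m \<phi> \<psi>) (A \<times> B) (\<lambda>p. h' (snd p))" if h: "chart_smooth n \<psi> B h'"
  proof -
    obtain G where G: "smooth_on n (\<psi> ` B) G" "\<forall>x\<in>B. G (\<psi> x) = h' x" using h by (auto simp: chart_smooth_def)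
    have "smooth_on (m + n) (pchart m \<phi> \<psi> ` (A \<times> B)) (\<lambda>z. G (shift m z))"
      by (rule smooth_on_subset[OF smooth_on_shift[OF is_chart_image_open[OF d] G(1)]]) (use tr in auto)
    then show ?thesis unfolding chart_smooth_def using G(2) tr by (intro exI[of _ "\<lambda>z. G (shift m z)"]) auto
  qed
qed

lemma chart_smooth_prod_coord:
  assumes c: "is_chart m T U \<phi>" "openin T A" "A \<subseteq> U" and d: "is_chart n S V \<psi>" "openin S B" "B \<subseteq> V"
    and "\<And>i. i < m \<Longrightarrow> chart_smooth m \<phi> A (\<lambda>x. \<phi>' x i)" "\<And>i. i < n \<Longrightarrow> chart_smooth n \<psi> B (\<lambda>x. \<psi>' x i)" and i: "i < m + n"
  shows "chart_smooth (m + n) (pchart m \<phi> \<psi>) (A \<times> B) (\<lambda>p. pchart m \<phi>' \<psi>' p i)"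
proof (cases "i < m")
  case True
  then have "(\<lambda>p. pchart m \<phi>' \<psi>' p i) = (\<lambda>p. \<phi>' (fst p) i)" by (auto simp: pchart_def cjoin_def)
  then show ?thesis using chart_smooth_prod(1)[OF c d assms(7)[OF True]] by simp
next
  case False
  then have "(\<lambda>p. pchart m \<phi>' \<psi>' p i) = (\<lambda>p. \<psi>' (snd p) (i - m))" by (auto simp: pchart_def cjoin_def)
  then show ?thesis using chart_smooth_prod(2)[OF c d assms(8)] False i by simp
qed

lemma second_countable_prod_topology:
  assumes "second_countable X" "second_countable Y"
  shows "second_countable (prod_topology X Y)"
proof -
  obtain B where B: "countable B" "\<And>V. V \<in> B \<Longrightarrow> openin X V"
    "\<And>U x. openin X U \<Longrightarrow> x \<in> U \<Longrightarrow> \<exists>V\<in>B. x \<in> V \<and> V \<subseteq> U" using assms(1) unfolding second_countable_def by metis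
  obtain C where C: "countable C" "\<And>V. V \<in> C \<Longrightarrow> openin Y V"
    "\<And>U x. openin Y U \<Longrightarrow> x \<in> U \<Longrightarrow> \<exists>V\<in>C. x \<in> V \<and> V \<subseteq> U" using assms(2) unfolding second_countable_def by metis
  let ?D = "(\<lambda>(b, c). b \<times> c) ` (B \<times> C)"
  have "countable ?D" using B(1) C(1) by auto
  moreover have "openin (prod_topology X Y) V" if "V \<in> ?D" for V
    using that B(2) C(2) by (auto simp: openin_prod_Times_iff)
  moreover have "\<exists>V\<in>?D. p \<in> V \<and> V \<subseteq> U" if U: "openin (prod_topology X Y) U" "p \<in> U" for U p
  proof -
    obtain x y where p: "p = (x, y)" by force
    obtain u v where uv: "openin X u" "openin Y v" "x \<in> u" "y \<in> v" "u \<times> v \<subseteq> U"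
      using iffD1[OF openin_prod_topology_alt U(1), rule_format, of x y] U(2) p by auto
    obtain b where b: "b \<in> B" "x \<in> b" "b \<subseteq> u" using B(3)[OF uv(1,3)] by auto
    obtain c where c: "c \<in> C" "y \<in> c" "c \<subseteq> v" using C(3)[OF uv(2,4)] by auto
    from b c uv(5) p show ?thesis by (intro bexI[of _ "b \<times> c"]) auto
  qed
  ultimately show ?thesis unfolding second_countable_def by (intro exI[of _ ?D]) simp
qed

lemma prod_manifold_simps [simp]:
  "mtop (prod_manifold M N) = prod_topology (mtop M) (mtop N)"
  "mdim (prod_manifold M N) = mdim M + mdim N"
  by (auto simp: prod_manifold_def)

lemma atlas_prod_manifold:
  "c \<in> atlas (prod_manifold M N) \<longleftrightarrow> (\<exists>U \<phi> V \<psi>. (U, \<phi>) \<in> atlas M \<and> (V, \<psi>) \<in> atlas N \<and>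
     c = (U \<times> V, pchart (mdim M) \<phi> \<psi>))"
  unfolding prod_manifold_def pchart_def cjoin_def by auto

lemma atlas_prod_manifoldI:
  "(U, \<phi>) \<in> atlas M \<Longrightarrow> (V, \<psi>) \<in> atlas N \<Longrightarrow>
   (U \<times> V, pchart (mdim M) \<phi> \<psi>) \<in> atlas (prod_manifold M N)"
  unfolding atlas_prod_manifold by blast

lemma is_manifold_prod:
  assumes M: "is_manifold M" and N: "is_manifold N"
  shows "is_manifold (prod_manifold M N)"
proof (rule is_manifoldI)
  show "Hausdorff_space (mtop (prod_manifold M N))"
    using is_manifoldD(1)[OF M] is_manifoldD(1)[OF N] by (simp add: Hausdorff_space_prod_topology)
  show "second_countable (mtop (prod_manifold M N))"
    using is_manifoldD(2)[OF M] is_manifoldD(2)[OF N] by (simp add: second_countable_prod_topology)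
  show "is_chart (mdim (prod_manifold M N)) (mtop (prod_manifold M N)) U \<phi>"
    if a: "(U, \<phi>) \<in> atlas (prod_manifold M N)" for U \<phi>
  proof -
    obtain U1 \<phi>1 V1 \<psi>1 where c: "(U1, \<phi>1) \<in> atlas M" "(V1, \<psi>1) \<in> atlas N" "U = U1 \<times> V1" "\<phi> = pchart (mdim M) \<phi>1 \<psi>1"
      using a by (auto simp: atlas_prod_manifold)
    show ?thesis unfolding c(3,4) prod_manifold_simps
      by (rule is_chart_prod[OF is_manifoldD(3)[OF M c(1)] is_manifoldD(3)[OF N c(2)]])
  qed
  show "\<exists>U \<phi>. (U, \<phi>) \<in> atlas (prod_manifold M N) \<and> p \<in> U" if p: "p \<in> pts (prod_manifold M N)" for p
  proof -
    obtain U \<phi> V \<psi> where c: "(U, \<phi>) \<in> atlas M" "fst p \<in> U" "(V, \<psi>) \<in> atlas N" "snd p \<in> V"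
      using is_manifoldD(4)[OF M, of "fst p"] is_manifoldD(4)[OF N, of "snd p"] p by (auto simp: mem_Times_iff)
    show ?thesis using atlas_prod_manifoldI[OF c(1,3)] c(2,4) by (auto simp: mem_Times_iff)
  qed
  fix U1 \<phi>1 U2 \<phi>2 i assume a: "(U1, \<phi>1) \<in> atlas (prod_manifold M N)" "(U2, \<phi>2) \<in> atlas (prod_manifold M N)"
    and i: "i < mdim (prod_manifold M N)"
  obtain U \<phi> V \<psi> where c1: "(U, \<phi>) \<in> atlas M" "(V, \<psi>) \<in> atlas N" "U1 = U \<times> V" "\<phi>1 = pchart (mdim M) \<phi> \<psi>"
    using a(1) by (auto simp: atlas_prod_manifold)
  obtain U' \<phi>' V' \<psi>' where c2: "(U', \<phi>') \<in> atlas M" "(V', \<psi>') \<in> atlas N" "U2 = U' \<times> V'" "\<phi>2 = pchart (mdim M) \<phi>' \<psi>'"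
    using a(2) by (auto simp: atlas_prod_manifold)
  note ch = is_manifoldD(3)[OF M c1(1)] is_manifoldD(3)[OF N c1(2)] is_manifoldD(3)[OF M c2(1)] is_manifoldD(3)[OF N c2(2)]
  have o: "openin (mtop M) (U \<inter> U')" "openin (mtop N) (V \<inter> V')" using is_chartD(1)[OF ch(1)] is_chartD(1)[OF ch(2)]
     is_chartD(1)[OF ch(3)] is_chartD(1)[OF ch(4)] by auto
  show "chart_smooth (mdim (prod_manifold M N)) \<phi>1 (U1 \<inter> U2) (\<lambda>x. \<phi>2 x i)"
    unfolding c1(3,4) c2(3,4) Times_Int_Times prod_manifold_simps
    by (rule chart_smooth_prod_coord[OF ch(1) o(1) _ ch(2) o(2)])
      (use i is_manifoldD(5)[OF M c1(1) c2(1)] is_manifoldD(5)[OF N c1(2) c2(2)] in auto)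
qed

lemma prod_atlas_pick:
  assumes M: "is_manifold M" and N: "is_manifold N" and p: "p \<in> pts (prod_manifold M N)"
  obtains U \<phi> V \<psi> where "(U, \<phi>) \<in> atlas M" "(V, \<psi>) \<in> atlas N" "fst p \<in> U" "snd p \<in> V"
    "(U \<times> V, pchart (mdim M) \<phi> \<psi>) \<in> atlas (prod_manifold M N)"
    "openin (mtop M) U" "openin (mtop N) V" "openin (prod_topology (mtop M) (mtop N)) (U \<times> V)"
proof -
  obtain U \<phi> V \<psi> where c: "(U, \<phi>) \<in> atlas M" "fst p \<in> U" "(V, \<psi>) \<in> atlas N" "snd p \<in> V"
    using is_manifoldD(4)[OF M, of "fst p"] is_manifoldD(4)[OF N, of "snd p"] p by (auto simp: mem_Times_iff)
  moreover have "(U \<times> V, pchart (mdim M) \<phi> \<psi>) \<in> atlas (prod_manifold M N)"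
    by (rule atlas_prod_manifoldI[OF c(1,3)])
  moreover have "openin (mtop M) U" "openin (mtop N) V"
    using is_chartD(1)[OF is_manifoldD(3)[OF M c(1)]] is_chartD(1)[OF is_manifoldD(3)[OF N c(3)]] by auto
  ultimately show thesis using that by (simp add: openin_prod_Times_iff)
qed

lemma smooth_map_fst_snd:
  assumes M: "is_manifold M" and N: "is_manifold N"
  shows "smooth_map (prod_manifold M N) M fst" "smooth_map (prod_manifold M N) N snd"
proof -
  note P = is_manifold_prod[OF M N]
  show "smooth_map (prod_manifold M N) M fst"
  proof (rule smooth_mapI[OF P M])
    fix p assume "p \<in> pts (prod_manifold M N)"
    then obtain U \<phi> V \<psi> where c: "(U, \<phi>) \<in> atlas M" "(V, \<psi>) \<in> atlas N" "fst p \<in> U" "snd p \<in> V"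
      "(U \<times> V, pchart (mdim M) \<phi> \<psi>) \<in> atlas (prod_manifold M N)" and o: "openin (mtop M) U" "openin (mtop N) V"
      "openin (prod_topology (mtop M) (mtop N)) (U \<times> V)"
      using prod_atlas_pick[OF M N] by metis
    have "smooth_fun (prod_manifold M N) (U \<times> V) (\<lambda>p. \<phi> (fst p) i)" for i
      by (rule chart_smooth_smooth_fun[OF P is_manifoldD(6)[OF P c(5)] _ subset_refl], simp add: o)
        (use chart_smooth_prod(1)[OF is_manifoldD(3)[OF M c(1)] o(1) subset_refl is_manifoldD(3)[OF N c(2)] o(2) subset_refl
           chart_smooth_coord[OF is_manifoldD(3)[OF M c(1)] o(1) subset_refl]] in simp)
    then show "\<exists>V \<psi> A. (V, \<psi>) \<in> maximal_atlas M \<and> p \<in> A \<and> fst ` A \<subseteq> V \<and>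
       (\<forall>i<mdim M. smooth_fun (prod_manifold M N) A (\<lambda>x. \<psi> (fst x) i))"
      using c is_manifoldD(6)[OF M c(1)] by (intro exI[of _ U] exI[of _ \<phi>] exI[of _ "U \<times> V"]) (auto simp: mem_Times_iff)
  qed (simp add: continuous_map_fst)
  show "smooth_map (prod_manifold M N) N snd"
  proof (rule smooth_mapI[OF P N])
    fix p assume "p \<in> pts (prod_manifold M N)"
    then obtain U \<phi> V \<psi> where c: "(U, \<phi>) \<in> atlas M" "(V, \<psi>) \<in> atlas N" "fst p \<in> U" "snd p \<in> V"
      "(U \<times> V, pchart (mdim M) \<phi> \<psi>) \<in> atlas (prod_manifold M N)" and o: "openin (mtop M) U" "openin (mtop N) V"
      "openin (prod_topology (mtop M) (mtop N)) (U \<times> V)"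
      using prod_atlas_pick[OF M N] by metis
    have "smooth_fun (prod_manifold M N) (U \<times> V) (\<lambda>p. \<psi> (snd p) i)" for i
      by (rule chart_smooth_smooth_fun[OF P is_manifoldD(6)[OF P c(5)] _ subset_refl], simp add: o)
        (use chart_smooth_prod(2)[OF is_manifoldD(3)[OF M c(1)] o(1) subset_refl is_manifoldD(3)[OF N c(2)] o(2) subset_refl
           chart_smooth_coord[OF is_manifoldD(3)[OF N c(2)] o(2) subset_refl]] in simp)
    then show "\<exists>V \<psi> A. (V, \<psi>) \<in> maximal_atlas N \<and> p \<in> A \<and> snd ` A \<subseteq> V \<and>
       (\<forall>i<mdim N. smooth_fun (prod_manifold M N) A (\<lambda>x. \<psi> (snd x) i))"
      using c is_manifoldD(6)[OF N c(2)] by (intro exI[of _ V] exI[of _ \<psi>] exI[of _ "U \<times> V"]) (auto simp: mem_Times_iff)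
  qed (simp add: continuous_map_snd)
qed

lemma smooth_map_pair:
  assumes X: "is_manifold X" and M: "is_manifold M" and N: "is_manifold N"
    and f: "smooth_map X M f" and g: "smooth_map X N g"
  shows "smooth_map X (prod_manifold M N) (\<lambda>x. (f x, g x))"
proof (rule smooth_mapI[OF X is_manifold_prod[OF M N]])
  show "continuous_map (mtop X) (mtop (prod_manifold M N)) (\<lambda>x. (f x, g x))"
    using continuous_map_pairedI[OF smooth_map_continuous[OF f] smooth_map_continuous[OF g]] by simp
  fix p assume p: "p \<in> pts X"
  then have "(f p, g p) \<in> pts (prod_manifold M N)" using smooth_map_in[OF f p] smooth_map_in[OF g p] by simp
  then obtain U \<phi> V \<psi> where c: "(U, \<phi>) \<in> atlas M" "(V, \<psi>) \<in> atlas N" "f p \<in> U" "g p \<in> V"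
    "(U \<times> V, pchart (mdim M) \<phi> \<psi>) \<in> atlas (prod_manifold M N)" and o: "openin (mtop M) U" "openin (mtop N) V"
    using prod_atlas_pick[OF M N] by (metis fst_conv snd_conv)
  let ?A = "{x \<in> pts X. f x \<in> U} \<inter> {x \<in> pts X. g x \<in> V}"
  have oA: "openin (mtop X) ?A" using smooth_map_vimage_open[OF f o(1)] smooth_map_vimage_open[OF g o(2)] by auto
  have "smooth_fun X ?A (\<lambda>x. pchart (mdim M) \<phi> \<psi> (f x, g x) i)" for i
  proof (cases "i < mdim M")
    case True
    then show ?thesis using smooth_fun_subset[OF smooth_map_smooth_fun[OF X M f is_manifoldD(6)[OF M c(1)]] _ oA]
      by (auto simp: pchart_def cjoin_def)
  next
    case False
    then show ?thesis using smooth_fun_subset[OF smooth_map_smooth_fun[OF X N g is_manifoldD(6)[OF N c(2)]] _ oA]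
      by (auto simp: pchart_def cjoin_def)
  qed
  then show "\<exists>V \<psi> A. (V, \<psi>) \<in> maximal_atlas (prod_manifold M N) \<and> p \<in> A \<and> (\<lambda>x. (f x, g x)) ` A \<subseteq> V \<and>
       (\<forall>i<mdim (prod_manifold M N). smooth_fun X A (\<lambda>x. \<psi> (f x, g x) i))"
    using c p is_manifoldD(6)[OF is_manifold_prod[OF M N] c(5)]
    by (intro exI[of _ "U \<times> V"] exI[of _ "pchart (mdim M) \<phi> \<psi>"] exI[of _ ?A]) auto
qed

text \<open>Submersions and slices supply charts of the maximal atlases, while the atlas of a
  product consists of pairs from the two given atlases. Compatibility is checked against such pairs,
  factor by factor.\<close>

lemma maximal_atlas_prod:
  assumes M: "is_manifold M" and N: "is_manifold N"
    and c: "(U, \<phi>) \<in> maximal_atlas M" and d: "(V, \<psi>) \<in> maximal_atlas N"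
  shows "(U \<times> V, pchart (mdim M) \<phi> \<psi>) \<in> maximal_atlas (prod_manifold M N)"
proof -
  note P = is_manifold_prod[OF M N]
  note cc = maximal_atlasD(1-3)[OF M c] and dd = maximal_atlasD(1-3)[OF N d]
  have oUV: "openin (mtop (prod_manifold M N)) (U \<times> V)" using cc(2) dd(2) by (simp add: openin_prod_Times_iff)
  show ?thesis
  proof (rule maximal_atlasI[OF P])
    show "is_chart (mdim (prod_manifold M N)) (mtop (prod_manifold M N)) (U \<times> V) (pchart (mdim M) \<phi> \<psi>)"
      using is_chart_prod[OF cc(1) dd(1)] by simp
    show "smooth_fun (prod_manifold M N) (U \<times> V) (\<lambda>x. pchart (mdim M) \<phi> \<psi> x i)" for i
    proof (cases "i < mdim M")
      case True
      then have "(\<lambda>p. pchart (mdim M) \<phi> \<psi> p i) = (\<lambda>p. \<phi> (fst p) i)" by (auto simp: pchart_def cjoin_def)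
      moreover have "smooth_fun (prod_manifold M N) (U \<times> V) (\<lambda>p. \<phi> (fst p) i)"
        by (rule smooth_fun_subset[OF smooth_map_smooth_fun[OF P M smooth_map_fst_snd(1)[OF M N] c] _ oUV])
          (use cc(3) dd(3) in auto)
      ultimately show ?thesis by simp
    next
      case False
      then have "(\<lambda>p. pchart (mdim M) \<phi> \<psi> p i) = (\<lambda>p. \<psi> (snd p) (i - mdim M))" by (auto simp: pchart_def cjoin_def)
      moreover have "smooth_fun (prod_manifold M N) (U \<times> V) (\<lambda>p. \<psi> (snd p) (i - mdim M))"
        by (rule smooth_fun_subset[OF smooth_map_smooth_fun[OF P N smooth_map_fst_snd(2)[OF M N] d] _ oUV])
          (use cc(3) dd(3) in auto)
      ultimately show ?thesis by simp
    qed
    fix p assume p: "p \<in> U \<times> V"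
    then have "p \<in> pts (prod_manifold M N)" using cc(3) dd(3) by auto
    then obtain U' \<phi>' V' \<psi>' where e: "(U', \<phi>') \<in> atlas M" "(V', \<psi>') \<in> atlas N" "fst p \<in> U'" "snd p \<in> V'"
      "(U' \<times> V', pchart (mdim M) \<phi>' \<psi>') \<in> atlas (prod_manifold M N)" and o: "openin (mtop M) U'" "openin (mtop N) V'"
      using prod_atlas_pick[OF M N] by metis
    have o2: "openin (mtop M) (U \<inter> U')" "openin (mtop N) (V \<inter> V')" using o cc(2) dd(2) by auto
    have "chart_smooth (mdim M + mdim N) (pchart (mdim M) \<phi> \<psi>) ((U \<inter> U') \<times> (V \<inter> V')) (\<lambda>x. pchart (mdim M) \<phi>' \<psi>' x i)"
      if "i < mdim M + mdim N" for i
      by (rule chart_smooth_prod_coord[OF cc(1) o2(1) _ dd(1) o2(2) _ _ _ that])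
        (use maximal_atlasD(4)[OF M c e(1)] maximal_atlasD(4)[OF N d e(2)] in auto)
    then show "\<exists>V' \<psi>' A. (V', \<psi>') \<in> maximal_atlas (prod_manifold M N) \<and> openin (mtop (prod_manifold M N)) A \<and> p \<in> A \<and>
      A \<subseteq> (U \<times> V) \<inter> V' \<and> (\<forall>i<mdim (prod_manifold M N). chart_smooth (mdim (prod_manifold M N)) (pchart (mdim M) \<phi> \<psi>) A (\<lambda>x. \<psi>' x i))"
      using p e is_manifoldD(6)[OF P e(5)] o2
      by (intro exI[of _ "U' \<times> V'"] exI[of _ "pchart (mdim M) \<phi>' \<psi>'"] exI[of _ "(U \<inter> U') \<times> (V \<inter> V')"])
        (auto simp: openin_prod_Times_iff mem_Times_iff)
  qed
qed

subsection \<open>Diffeomorphisms and submersions\<close>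

lemma is_manifold_chart_at:
  assumes "is_manifold M" "p \<in> pts M"
  obtains U \<phi> where "(U, \<phi>) \<in> maximal_atlas M" "p \<in> U"
  using is_manifoldD(4,6)[OF assms(1)] assms(2) by blast

text \<open>If n < m, the target is a proper coordinate subspace of \<open>Esp m\<close>, and h
  becomes an injective continuous map of U into \<open>Esp m\<close>. By invariance of domain its
  image is open there, although it lies in the proper subspace.\<close>

lemma injective_imp_dim_le:
  assumes U: "openin (Euclidean_space m) U" "U \<noteq> {}"
    and h: "continuous_map (subtopology (Euclidean_space m) U) (Euclidean_space n) h" "inj_on h U"
  shows "m \<le> n"
proof (rule ccontr)
  assume nm: "\<not> m \<le> n"
  have hE: "h x \<in> Esp n" if "x \<in> U" for x
    using h(1) that openin_Esp_subset[OF U(1)] unfolding cm_into_Esp by auto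
  have "continuous_map (subtopology (Euclidean_space m) U) (Euclidean_space m) h"
    unfolding cm_into_Esp
  proof (intro conjI ballI allI impI)
    show "h x \<in> Esp m" if "x \<in> topspace (subtopology (Euclidean_space m) U)" for x
      using hE[of x] that nm by (auto simp: Esp_iff)
    fix i
    show "continuous_map (subtopology (Euclidean_space m) U) euclideanreal (\<lambda>x. h x i)"
    proof (cases "i < n")
      case True then show ?thesis using h(1) unfolding cm_into_Esp by auto
    next
      case False
      have "continuous_map (subtopology (Euclidean_space m) U) euclideanreal (\<lambda>x. 0::real)" by simp
      then show ?thesis by (rule continuous_map_eq) (use hE False in \<open>auto simp: Esp_iff\<close>)
    qed
  qed
  from invariance_of_domain_Euclidean_space[OF U(1) this h(2)]
  have o: "openin (Euclidean_space m) (h ` U)" .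
  obtain x where x: "x \<in> h ` U" using U(2) by auto
  obtain e where e: "e > 0" "\<And>y. y \<in> Esp m \<Longrightarrow> (\<And>i. i < m \<Longrightarrow> \<bar>y i - x i\<bar> < e) \<Longrightarrow> y \<in> h ` U"
    using openin_Esp_box[OF o x] by metis
  have xE: "x \<in> Esp n" using x hE by auto
  \<comment> \<open>Coordinate n is free in \<open>Esp m\<close> but vanishes on
    \<open>Esp n\<close>.\<close>
  have "x(n := e / 2) \<in> h ` U"
    by (rule e(2)) (use xE nm e(1) in \<open>auto simp: Esp_iff\<close>)
  then have "x(n := e / 2) \<in> Esp n" using hE by auto
  then show False using e(1) by (auto simp: Esp_iff)
qed

lemma smooth_injective_dim_le:
  assumes M: "is_manifold M" and N: "is_manifold N" and f: "smooth_map M N f" "inj_on f (pts M)"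
    and p: "p \<in> pts M"
  shows "mdim M \<le> mdim N"
proof -
  obtain U \<phi> where U: "(U, \<phi>) \<in> maximal_atlas M" "p \<in> U" using is_manifold_chart_at[OF M p] .
  obtain V \<psi> where V: "(V, \<psi>) \<in> maximal_atlas N" "f p \<in> V"
    using is_manifold_chart_at[OF N smooth_map_in[OF f(1) p]] .
  note c = maximal_atlasD[OF M U(1)] and d = maximal_atlasD[OF N V(1)]
  note cc = is_chartD[OF c(1)] and dd = is_chartD[OF d(1)]
  let ?A = "U \<inter> {x \<in> pts M. f x \<in> V}"
  have oA: "openin (mtop M) ?A" using c(2) smooth_map_vimage_open[OF f(1) d(2)] by auto
  have inv: "inv_into U \<phi> (\<phi> x) = x" if "x \<in> U" for x using that cc(4) by simp
  show ?thesis
  proof (rule injective_imp_dim_le[OF is_chart_image_open[OF c(1) oA Int_lower1]])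
    show "\<phi> ` ?A \<noteq> {}" using U(2) V(2) p by auto
    have "continuous_map (subtopology (Euclidean_space (mdim M)) (\<phi> ` ?A)) (mtop M) (inv_into U \<phi>)"
      using continuous_map_from_subtopology_mono[OF cc(6)] by (meson Int_lower1 image_mono)
    then have "continuous_map (subtopology (Euclidean_space (mdim M)) (\<phi> ` ?A)) (mtop N) (\<lambda>z. f (inv_into U \<phi> z))"
      using continuous_map_compose[OF _ smooth_map_continuous[OF f(1)]] by (simp add: o_def)
    then have "continuous_map (subtopology (Euclidean_space (mdim M)) (\<phi> ` ?A)) (subtopology (mtop N) V) (\<lambda>z. f (inv_into U \<phi> z))"
      using inv by (auto simp: continuous_map_in_subtopology)
    from continuous_map_compose[OF this dd(5)]
    show "continuous_map (subtopology (Euclidean_space (mdim M)) (\<phi> ` ?A)) (Euclidean_space (mdim N)) (\<lambda>z. \<psi> (f (inv_into U \<phi> z)))"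
      by (simp add: o_def)
    show "inj_on (\<lambda>z. \<psi> (f (inv_into U \<phi> z))) (\<phi> ` ?A)"
    proof (rule inj_onI, clarify)
      fix x y assume xy: "x \<in> U" "f x \<in> V" "x \<in> pts M" "y \<in> U" "y \<in> pts M" "f y \<in> V"
        "\<psi> (f (inv_into U \<phi> (\<phi> x))) = \<psi> (f (inv_into U \<phi> (\<phi> y)))"
      then have "f x = f y" using inv dd(4) by (simp add: inj_on_eq_iff)
      then show "\<phi> x = \<phi> y" using f(2) xy by (simp add: inj_on_eq_iff)
    qed
  qed
qed

text \<open>A chart of N is pulled back along f. Its coordinates and those of M are smooth functions
  of each other through f and g. Equality of the dimensions is assumed because the notion of chart
  refers to the number \<open>mdim M\<close>.\<close>

lemma diffeo_chart:
  assumes M: "is_manifold M" and N: "is_manifold N" and dim: "mdim M = mdim N"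
    and f: "smooth_map M N f" and g: "smooth_map N M g"
    and gf: "\<And>x. x \<in> pts M \<Longrightarrow> g (f x) = x" and fg: "\<And>y. y \<in> pts N \<Longrightarrow> f (g y) = y"
    and V: "(V, \<psi>) \<in> maximal_atlas N"
  shows "({x \<in> pts M. f x \<in> V}, \<lambda>x. \<psi> (f x)) \<in> maximal_atlas M"
proof -
  note d = maximal_atlasD[OF N V]
  note dd = is_chartD[OF d(1)]
  let ?U = "{x \<in> pts M. f x \<in> V}"
  have oU: "openin (mtop M) ?U" by (rule smooth_map_vimage_open[OF f d(2)])
  have inv: "inv_into V \<psi> (\<psi> y) = y" if "y \<in> V" for y using that dd(4) by simp
  have c: "is_chart (mdim M) (mtop M) ?U (\<lambda>x. \<psi> (f x))"
  proof (rule is_chartI(1)[where W = "\<psi> ` V" and g = "\<lambda>z. g (inv_into V \<psi> z)"])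
    show "openin (Euclidean_space (mdim M)) (\<psi> ` V)" using dd(3) dim by simp
    have "continuous_map (subtopology (mtop M) ?U) (subtopology (mtop N) V) f"
      using continuous_map_from_subtopology[OF smooth_map_continuous[OF f]]
      by (auto simp: continuous_map_in_subtopology)
    from continuous_map_compose[OF this dd(5)]
    show "continuous_map (subtopology (mtop M) ?U) (Euclidean_space (mdim M)) (\<lambda>x. \<psi> (f x))"
      by (simp add: o_def dim)
    from continuous_map_compose[OF dd(6) smooth_map_continuous[OF g]]
    show "continuous_map (subtopology (Euclidean_space (mdim M)) (\<psi> ` V)) (mtop M) (\<lambda>z. g (inv_into V \<psi> z))"
      by (simp add: o_def dim)
    show "\<psi> (f x) \<in> \<psi> ` V \<and> g (inv_into V \<psi> (\<psi> (f x))) = x" if "x \<in> ?U" for x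
      using that inv gf by auto
    show "g (inv_into V \<psi> z) \<in> ?U \<and> \<psi> (f (g (inv_into V \<psi> z))) = z" if z: "z \<in> \<psi> ` V" for z
    proof -
      obtain y where y: "y \<in> V" "z = \<psi> y" using z by auto
      moreover have "y \<in> pts N" using y(1) d(3) by auto
      ultimately show ?thesis using inv[OF y(1)] fg smooth_map_in[OF g] by simp
    qed
  qed (rule oU)
  show ?thesis
  proof (rule maximal_atlasI[OF M c])
    show "smooth_fun M ?U (\<lambda>x. \<psi> (f x) i)" for i by (rule smooth_map_smooth_fun[OF M N f V])
    fix p assume p: "p \<in> ?U"
    then obtain U' \<phi>' where U': "(U', \<phi>') \<in> maximal_atlas M" "p \<in> U'" using is_manifold_chart_at[OF M] by blast
    let ?A = "?U \<inter> U'"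
    have oA: "openin (mtop M) ?A" using oU maximal_atlasD(2)[OF M U'(1)] by auto
    have "chart_smooth (mdim M) (\<lambda>x. \<psi> (f x)) ?A (\<lambda>x. \<phi>' x i)" for i
    proof -
      have "chart_smooth (mdim N) \<psi> (V \<inter> {y \<in> pts N. g y \<in> U'}) (\<lambda>y. \<phi>' (g y) i)"
        by (rule smooth_fun_chart_smooth[OF N V smooth_map_smooth_fun[OF N M g U'(1)]])
      then obtain G where G: "smooth_on (mdim N) (\<psi> ` (V \<inter> {y \<in> pts N. g y \<in> U'})) G"
        "\<And>y. y \<in> V \<inter> {y \<in> pts N. g y \<in> U'} \<Longrightarrow> G (\<psi> y) = \<phi>' (g y) i" by (auto simp: chart_smooth_def)
      have fA: "f x \<in> V \<inter> {y \<in> pts N. g y \<in> U'}" if "x \<in> ?A" for x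
        using that smooth_map_in[OF f] gf by auto
      have "smooth_on (mdim M) ((\<lambda>x. \<psi> (f x)) ` ?A) G"
        unfolding dim by (rule smooth_on_subset[OF G(1)]) (use fA in blast)
      moreover have "G (\<psi> (f x)) = \<phi>' x i" if "x \<in> ?A" for x
        using G(2)[OF fA[OF that]] gf that by simp
      ultimately show ?thesis unfolding chart_smooth_def by blast
    qed
    then show "\<exists>V \<psi>' A. (V, \<psi>') \<in> maximal_atlas M \<and> openin (mtop M) A \<and> p \<in> A \<and> A \<subseteq> ?U \<inter> V \<and>
       (\<forall>i<mdim M. chart_smooth (mdim M) (\<lambda>x. \<psi> (f x)) A (\<lambda>x. \<psi>' x i))"
      using U' p oA by (intro exI[of _ U'] exI[of _ \<phi>'] exI[of _ ?A]) auto
  qed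
qed

lemma diffeomorphismI:
  "smooth_map M N f \<Longrightarrow> smooth_map N M g \<Longrightarrow> (\<And>x. x \<in> pts M \<Longrightarrow> g (f x) = x) \<Longrightarrow>
   (\<And>y. y \<in> pts N \<Longrightarrow> f (g y) = y) \<Longrightarrow> diffeomorphism M N f"
  unfolding diffeomorphism_def by blast

text \<open>The inequality for injective maps is applied to f and to its inverse. The point p
  excludes the empty manifold, whose \<open>mdim\<close> is arbitrary.\<close>

lemma diffeomorphism_dim_eq:
  assumes M: "is_manifold M" and N: "is_manifold N" and f: "diffeomorphism M N f" and p: "p \<in> pts M"
  shows "mdim M = mdim N"
proof -
  obtain g where g: "smooth_map M N f" "smooth_map N M g" "\<forall>x\<in>pts M. g (f x) = x" "\<forall>y\<in>pts N. f (g y) = y"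
    using f by (auto simp: diffeomorphism_def)
  have "inj_on f (pts M)" "inj_on g (pts N)" using g(3,4) by (metis inj_on_def)+
  then show ?thesis
    using smooth_injective_dim_le[OF M N g(1) _ p] smooth_injective_dim_le[OF N M g(2) _ smooth_map_in[OF g(1) p]]
    by simp
qed

section \<open>Submersions: composites and products\<close>

lemma submersionD: "submersion M N f \<Longrightarrow> smooth_map M N f"
  by (simp add: submersion_def)

lemma submersionE:
  assumes "submersion M N f" "p \<in> pts M"
  obtains U \<phi> V \<psi> where "(U, \<phi>) \<in> maximal_atlas M" "(V, \<psi>) \<in> maximal_atlas N" "p \<in> U" "f ` U \<subseteq> V"
    "\<And>x i. x \<in> U \<Longrightarrow> i < mdim N \<Longrightarrow> \<psi> (f x) i = \<phi> x i" "mdim N \<le> mdim M"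
  using assms unfolding submersion_def by fast

lemma submersionI:
  assumes "smooth_map M N f"
    "\<And>p. p \<in> pts M \<Longrightarrow> mdim N \<le> mdim M \<and> (\<exists>U \<phi> V \<psi>. (U, \<phi>) \<in> maximal_atlas M \<and> (V, \<psi>) \<in> maximal_atlas N \<and>
      p \<in> U \<and> f ` U \<subseteq> V \<and> (\<forall>x\<in>U. \<forall>i<mdim N. \<psi> (f x) i = \<phi> x i))"
  shows "submersion M N f"
  unfolding submersion_def
proof (intro conjI assms(1) ballI)
  fix p assume "p \<in> pts M"
  from assms(2)[OF this] obtain U \<phi> V \<psi> where c: "mdim N \<le> mdim M" "(U, \<phi>) \<in> maximal_atlas M" "(V, \<psi>) \<in> maximal_atlas N"
      "p \<in> U \<and> f ` U \<subseteq> V \<and> (\<forall>x\<in>U. \<forall>i<mdim N. \<psi> (f x) i = \<phi> x i)" by blast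
  show "mdim N \<le> mdim M" by (rule c(1))
  show "\<exists>(U, \<phi>)\<in>maximal_atlas M. \<exists>(V, \<psi>)\<in>maximal_atlas N. p \<in> U \<and> f ` U \<subseteq> V \<and> (\<forall>x\<in>U. \<forall>i<mdim N. \<psi> (f x) i = \<phi> x i)"
    by (rule bexI[OF _ c(2)], rule case_prodI, rule bexI[OF _ c(3)], rule case_prodI, rule c(4))
qed

lemma submersion_cong:
  assumes M: "is_manifold M" and N: "is_manifold N" and f: "submersion M N f"
    and eq: "\<And>x. x \<in> pts M \<Longrightarrow> f x = g x"
  shows "submersion M N g"
proof (rule submersionI[OF smooth_map_cong[OF M N submersionD[OF f] eq]])
  fix p assume "p \<in> pts M"
  then obtain U \<phi> V \<psi> where c: "(U, \<phi>) \<in> maximal_atlas M" "(V, \<psi>) \<in> maximal_atlas N" "p \<in> U" "f ` U \<subseteq> V"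
    "\<And>x i. x \<in> U \<Longrightarrow> i < mdim N \<Longrightarrow> \<psi> (f x) i = \<phi> x i" "mdim N \<le> mdim M" using submersionE[OF f] by metis
  have "f x = g x" if "x \<in> U" for x using that eq maximal_atlasD(3)[OF M c(1)] by auto
  then show "mdim N \<le> mdim M \<and> (\<exists>U \<phi> V \<psi>. (U, \<phi>) \<in> maximal_atlas M \<and> (V, \<psi>) \<in> maximal_atlas N \<and>
      p \<in> U \<and> g ` U \<subseteq> V \<and> (\<forall>x\<in>U. \<forall>i<mdim N. \<psi> (g x) i = \<phi> x i))"
    using c by (intro conjI exI[of _ U] exI[of _ \<phi>] exI[of _ V] exI[of _ \<psi>]) auto
qed auto

lemma submersion_diffeomorphism:
  assumes M: "is_manifold M" and N: "is_manifold N" and f: "diffeomorphism M N f"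
  shows "submersion M N f"
proof -
  obtain g where g: "smooth_map M N f" "smooth_map N M g" "\<forall>x\<in>pts M. g (f x) = x" "\<forall>y\<in>pts N. f (g y) = y"
    using f by (auto simp: diffeomorphism_def)
  show ?thesis
  proof (rule submersionI[OF g(1)])
    fix p assume p: "p \<in> pts M"
    have dim: "mdim M = mdim N" by (rule diffeomorphism_dim_eq[OF M N f p])
    obtain V \<psi> where V: "(V, \<psi>) \<in> maximal_atlas N" "f p \<in> V" using is_manifold_chart_at[OF N smooth_map_in[OF g(1) p]] .
    have "({x \<in> pts M. f x \<in> V}, \<lambda>x. \<psi> (f x)) \<in> maximal_atlas M"
      by (rule diffeo_chart[OF M N dim g(1,2) _ _ V(1)]) (use g in auto)
    then show "mdim N \<le> mdim M \<and> (\<exists>U \<phi> V \<psi>. (U, \<phi>) \<in> maximal_atlas M \<and> (V, \<psi>) \<in> maximal_atlas N \<and>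
      p \<in> U \<and> f ` U \<subseteq> V \<and> (\<forall>x\<in>U. \<forall>i<mdim N. \<psi> (f x) i = \<phi> x i))"
      using V p dim
      by (intro conjI exI[of _ "{x \<in> pts M. f x \<in> V}"] exI[of _ "\<lambda>x. \<psi> (f x)"] exI[of _ V] exI[of _ \<psi>]) auto
  qed
qed

text \<open>The charts of N adapted to f and to g differ. In the chart of M adapted to f, the first
  \<open>mdim N\<close> coordinates are replaced by the g-adapted coordinates of \<open>f x\<close>.
  The transition \<tau> between the two charts of N, applied to this block, recovers the old
  coordinates, so the result is again a chart.\<close>

lemma submersion_compose:
  assumes M: "is_manifold M" and N: "is_manifold N" and L: "is_manifold L"
    and f: "submersion M N f" and g: "submersion N L g"
  shows "submersion M L (\<lambda>x. g (f x))"
proof (rule submersionI[OF smooth_map_compose[OF M N L submersionD[OF f] submersionD[OF g]]])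
  fix p assume p: "p \<in> pts M"
  obtain U \<phi> V \<psi> where c: "(U, \<phi>) \<in> maximal_atlas M" "(V, \<psi>) \<in> maximal_atlas N" "p \<in> U" "f ` U \<subseteq> V"
    "\<And>x i. x \<in> U \<Longrightarrow> i < mdim N \<Longrightarrow> \<psi> (f x) i = \<phi> x i" "mdim N \<le> mdim M" using submersionE[OF f p] by metis
  have "f p \<in> pts N" using smooth_map_in[OF submersionD[OF f] p] .
  then obtain V' \<psi>' W \<xi> where d: "(V', \<psi>') \<in> maximal_atlas N" "(W, \<xi>) \<in> maximal_atlas L" "f p \<in> V'" "g ` V' \<subseteq> W"
    "\<And>x i. x \<in> V' \<Longrightarrow> i < mdim L \<Longrightarrow> \<xi> (g x) i = \<psi>' x i" "mdim L \<le> mdim N" using submersionE[OF g] by metis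
  define U1 where "U1 = U \<inter> {x \<in> pts M. f x \<in> V'}"
  define \<Theta> where "\<Theta> x i = (if i < mdim N then \<psi>' (f x) i else \<phi> x i)" for x i
  define B where "B = V \<inter> V'"
  have oB: "openin (mtop N) B" unfolding B_def using maximal_atlasD(2)[OF N c(2)] maximal_atlasD(2)[OF N d(1)] by auto
  have oU1: "openin (mtop M) U1"
    unfolding U1_def using maximal_atlasD(2)[OF M c(1)] smooth_map_vimage_open[OF submersionD[OF f] maximal_atlasD(2)[OF N d(1)]] by auto
  have c1: "(U1, \<phi>) \<in> maximal_atlas M" by (rule maximal_atlas_subset[OF M c(1) oU1]) (auto simp: U1_def)
  have fB: "f x \<in> B" if "x \<in> U1" for x using that c(4) by (auto simp: U1_def B_def)
  have chd: "is_chart (mdim N) (mtop N) V' \<psi>'" by (rule maximal_atlasD(1)[OF N d(1)])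
  have tr: "trunc (mdim N) (\<Theta> x) = \<psi>' (f x)" if "x \<in> U1" for x
    using is_chartD(7)[OF chd, of "f x"] fB[OF that] by (auto simp: trunc_def \<Theta>_def B_def Esp_iff fun_eq_iff)
  have "\<exists>G. smooth_on (mdim N) (\<psi>' ` B) G \<and> (\<forall>y\<in>B. G (\<psi>' y) = \<psi> y j)" for j
  proof -
    have "chart_smooth (mdim N) \<psi>' (V' \<inter> B) (\<lambda>y. \<psi> y j)"
      by (rule smooth_fun_chart_smooth[OF N d(1) smooth_fun_subset[OF smooth_fun_coord[OF N c(2)] _ oB]]) (auto simp: B_def)
    moreover have "V' \<inter> B = B" by (auto simp: B_def)
    ultimately show ?thesis by (simp add: chart_smooth_def)
  qed
  then obtain \<tau> where \<tau>: "\<And>j. smooth_on (mdim N) (\<psi>' ` B) (\<tau> j)" "\<And>j y. y \<in> B \<Longrightarrow> \<tau> j (\<psi>' y) = \<psi> y j" by metis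
  let ?D = "{z \<in> Esp (mdim M). trunc (mdim N) z \<in> \<psi>' ` B}"
  have oV'B: "openin (Euclidean_space (mdim N)) (\<psi>' ` B)"
    by (rule is_chart_image_open[OF chd oB]) (auto simp: B_def)
  have "(U1, \<Theta>) \<in> maximal_atlas M"
  proof (rule maximal_atlas_recoordinatize[OF M c1, where D = ?D and
        G = "\<lambda>j z. if j < mdim N then \<tau> j (trunc (mdim N) z) else z j"])
    show oD: "openin (Euclidean_space (mdim M)) ?D" by (rule openin_trunc[OF oV'B])
    show "\<Theta> x \<in> ?D" if x: "x \<in> U1" for x
      using tr[OF x] fB[OF x] is_chartD(7)[OF maximal_atlasD(1)[OF M c1] x] c(6) by (auto simp: Esp_iff \<Theta>_def)
    show "smooth_fun M U1 (\<lambda>x. \<Theta> x i)" for i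
    proof (cases "i < mdim N")
      case True
      have "smooth_fun M U1 (\<lambda>x. \<psi>' (f x) i)"
        by (rule smooth_fun_subset[OF smooth_map_smooth_fun[OF M N submersionD[OF f] d(1)] _ oU1]) (auto simp: U1_def)
      then show ?thesis using True by (simp add: \<Theta>_def)
    next
      case False
      then show ?thesis using smooth_fun_coord[OF M c1] by (simp add: \<Theta>_def)
    qed
    show "smooth_on (mdim M) ?D (\<lambda>z. if j < mdim N then \<tau> j (trunc (mdim N) z) else z j)" for j
      using smooth_on_trunc[OF oV'B \<tau>(1)] smooth_on_coord[OF oD] by (cases "j < mdim N") auto
    show "(if j < mdim N then \<tau> j (trunc (mdim N) (\<Theta> x)) else \<Theta> x j) = \<phi> x j" if "x \<in> U1" for x j
      using tr[OF that] \<tau>(2)[OF fB[OF that]] c(5) that by (auto simp: \<Theta>_def U1_def)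
  qed
  then show "mdim L \<le> mdim M \<and> (\<exists>U \<phi> V \<psi>. (U, \<phi>) \<in> maximal_atlas M \<and> (V, \<psi>) \<in> maximal_atlas L \<and>
      p \<in> U \<and> (\<lambda>x. g (f x)) ` U \<subseteq> V \<and> (\<forall>x\<in>U. \<forall>i<mdim L. \<psi> (g (f x)) i = \<phi> x i))"
    using c(3,6) d p fB
    by (intro conjI exI[of _ U1] exI[of _ \<Theta>] exI[of _ W] exI[of _ \<xi>]) (auto simp: U1_def \<Theta>_def)
qed

lemma submersion_fst:
  assumes M: "is_manifold M" and N: "is_manifold N"
  shows "submersion (prod_manifold M N) M fst"
proof (rule submersionI[OF smooth_map_fst_snd(1)[OF M N]])
  fix p assume "p \<in> pts (prod_manifold M N)"
  then obtain U \<phi> V \<psi> where c: "(U, \<phi>) \<in> atlas M" "(V, \<psi>) \<in> atlas N" "fst p \<in> U" "snd p \<in> V"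
    "(U \<times> V, pchart (mdim M) \<phi> \<psi>) \<in> atlas (prod_manifold M N)" using prod_atlas_pick[OF M N] by metis
  then show "mdim M \<le> mdim (prod_manifold M N) \<and> (\<exists>U \<phi> V \<psi>. (U, \<phi>) \<in> maximal_atlas (prod_manifold M N) \<and> (V, \<psi>) \<in> maximal_atlas M \<and>
      p \<in> U \<and> fst ` U \<subseteq> V \<and> (\<forall>x\<in>U. \<forall>i<mdim M. \<psi> (fst x) i = \<phi> x i))"
    using is_manifoldD(6)[OF M c(1)] is_manifoldD(6)[OF is_manifold_prod[OF M N] c(5)]
    by (intro conjI exI[of _ "U \<times> V"] exI[of _ "pchart (mdim M) \<phi> \<psi>"] exI[of _ U] exI[of _ \<phi>])
      (auto simp: mem_Times_iff pchart_def cjoin_def)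
qed

lemma diffeomorphism_swap:
  assumes M: "is_manifold M" and N: "is_manifold N"
  shows "diffeomorphism (prod_manifold M N) (prod_manifold N M) (\<lambda>p. (snd p, fst p))"
  by (rule diffeomorphismI[where g = "\<lambda>p. (snd p, fst p)"])
    (auto intro: smooth_map_pair is_manifold_prod smooth_map_fst_snd M N)

lemma submersion_snd:
  assumes M: "is_manifold M" and N: "is_manifold N"
  shows "submersion (prod_manifold M N) N snd"
  using submersion_compose[OF is_manifold_prod[OF M N] is_manifold_prod[OF N M] N
    submersion_diffeomorphism[OF is_manifold_prod[OF M N] is_manifold_prod[OF N M] diffeomorphism_swap[OF M N]]
    submersion_fst[OF N M]] by simp

lemma submersion_id_times:
  assumes K: "is_manifold K" and M: "is_manifold M" and N: "is_manifold N" and f: "submersion M N f"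
  shows "submersion (prod_manifold K M) (prod_manifold K N) (\<lambda>p. (fst p, f (snd p)))"
proof (rule submersionI)
  note s = smooth_map_fst_snd[OF K M]
  show "smooth_map (prod_manifold K M) (prod_manifold K N) (\<lambda>p. (fst p, f (snd p)))"
    by (rule smooth_map_pair[OF is_manifold_prod[OF K M] K N s(1)
         smooth_map_compose[OF is_manifold_prod[OF K M] M N s(2) submersionD[OF f]]])
  fix p assume "p \<in> pts (prod_manifold K M)"
  then have p: "fst p \<in> pts K" "snd p \<in> pts M" by auto
  obtain W \<xi> where W: "(W, \<xi>) \<in> maximal_atlas K" "fst p \<in> W" using is_manifold_chart_at[OF K p(1)] .
  obtain U \<phi> V \<psi> where c: "(U, \<phi>) \<in> maximal_atlas M" "(V, \<psi>) \<in> maximal_atlas N" "snd p \<in> U" "f ` U \<subseteq> V"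
    "\<And>x i. x \<in> U \<Longrightarrow> i < mdim N \<Longrightarrow> \<psi> (f x) i = \<phi> x i" "mdim N \<le> mdim M" using submersionE[OF f p(2)] by metis
  show "mdim (prod_manifold K N) \<le> mdim (prod_manifold K M) \<and>
     (\<exists>U \<phi> V \<psi>. (U, \<phi>) \<in> maximal_atlas (prod_manifold K M) \<and> (V, \<psi>) \<in> maximal_atlas (prod_manifold K N) \<and>
      p \<in> U \<and> (\<lambda>p. (fst p, f (snd p))) ` U \<subseteq> V \<and>
      (\<forall>x\<in>U. \<forall>i<mdim (prod_manifold K N). \<psi> (fst x, f (snd x)) i = \<phi> x i))"
    using W c maximal_atlas_prod[OF K M W(1) c(1)] maximal_atlas_prod[OF K N W(1) c(2)]
    by (intro conjI exI[of _ "W \<times> U"] exI[of _ "pchart (mdim K) \<xi> \<phi>"] exI[of _ "W \<times> V"] exI[of _ "pchart (mdim K) \<xi> \<psi>"])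
      (auto simp: mem_Times_iff pchart_def cjoin_def)
qed

subsection \<open>Submanifolds given by slice charts\<close>

lemma openin_Esp_restrict:
  assumes "openin (Euclidean_space n) W" "k \<le> n"
  shows "openin (Euclidean_space k) (W \<inter> Esp k)"
proof -
  obtain T where T: "openin (powertop_real UNIV) T" "W = T \<inter> {x. \<forall>i\<ge>n. x i = 0}"
    using assms(1) unfolding Euclidean_space_def openin_subtopology by blast
  then have "W \<inter> Esp k = T \<inter> {x. \<forall>i\<ge>k. x i = 0}" using assms(2) by (auto simp: Esp_iff)
  then show ?thesis unfolding Euclidean_space_def openin_subtopology using T(1) by blast
qed

lemma smooth_on_restrict:
  assumes W: "openin (Euclidean_space n) W" and g: "smooth_on n W g" and k: "k \<le> n"
  shows "smooth_on k (W \<inter> Esp k) g"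
proof (rule smooth_on_compose[where h = "\<lambda>x. x", OF openin_Esp_restrict[OF W k] W _ _ g])
  show "smooth_on k (W \<inter> Esp k) (\<lambda>x. x j)" for j by (rule smooth_on_coord[OF openin_Esp_restrict[OF W k]])
qed auto

text \<open>The atlas of \<open>submanifold\<close> merely collects the slice charts; this condition
  says that they cover S. The bound on k is imposed at points of S, so an empty S satisfies it for
  every k.\<close>

definition has_slices :: "'a manifold \<Rightarrow> 'a set \<Rightarrow> nat \<Rightarrow> bool" where
  "has_slices M S k \<longleftrightarrow> is_manifold M \<and>
     (\<forall>p\<in>S \<inter> pts M. k \<le> mdim M \<and> (\<exists>U \<phi>. (U, \<phi>) \<in> maximal_atlas M \<and> p \<in> U \<and> \<phi> ` (U \<inter> S) = \<phi> ` U \<inter> Esp k))"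

lemma submanifold_simps [simp]:
  "mtop (submanifold M S k) = subtopology (mtop M) S" "mdim (submanifold M S k) = k"
  by (auto simp: submanifold_def)

lemma atlas_submanifold:
  "c \<in> atlas (submanifold M S k) \<longleftrightarrow> (\<exists>U \<phi>. (U, \<phi>) \<in> maximal_atlas M \<and> \<phi> ` (U \<inter> S) = \<phi> ` U \<inter> Esp k \<and> c = (U \<inter> S, \<phi>))"
  by (auto simp: submanifold_def)

text \<open>The representative of h in the ambient coordinates also represents it on the slice:
  \<open>Esp k\<close> is a subset of the ambient model space, and the chart maps the slice onto the
  part of its image lying there.\<close>

lemma chart_smooth_slice:
  assumes M: "is_manifold M" and c: "(U, \<phi>) \<in> maximal_atlas M" and s: "\<phi> ` (U \<inter> S) = \<phi> ` U \<inter> Esp k" and k: "k \<le> mdim M"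
    and A: "openin (mtop M) A" "A \<subseteq> U" and h: "chart_smooth (mdim M) \<phi> A h"
  shows "chart_smooth k \<phi> (A \<inter> S) h"
proof -
  obtain G where G: "smooth_on (mdim M) (\<phi> ` A) G" "\<forall>x\<in>A. G (\<phi> x) = h x" using h by (auto simp: chart_smooth_def)
  have "smooth_on k (\<phi> ` A \<inter> Esp k) G"
    by (rule smooth_on_restrict[OF is_chart_image_open[OF maximal_atlasD(1)[OF M c] A] G(1) k])
  then have "smooth_on k (\<phi> ` (A \<inter> S)) G"
    by (rule smooth_on_subset) (use s A(2) in blast)
  then show ?thesis unfolding chart_smooth_def using G(2) by auto
qed

lemma is_manifold_submanifold:
  assumes S: "has_slices M S k"
  shows "is_manifold (submanifold M S k)"
proof (rule is_manifoldI)
  have M: "is_manifold M" using S by (simp add: has_slices_def)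
  have kle: "k \<le> mdim M" if "x \<in> S" "x \<in> pts M" for x using S that unfolding has_slices_def by blast
  show "Hausdorff_space (mtop (submanifold M S k))"
    using is_manifoldD(1)[OF M] by (simp add: Hausdorff_space_subtopology)
  show "second_countable (mtop (submanifold M S k))"
    using is_manifoldD(2)[OF M] by (simp add: second_countable_subtopology)
  show "is_chart (mdim (submanifold M S k)) (mtop (submanifold M S k)) U \<phi>"
    if a: "(U, \<phi>) \<in> atlas (submanifold M S k)" for U \<phi>
  proof -
    obtain U0 where U0: "(U0, \<phi>) \<in> maximal_atlas M" "\<phi> ` (U0 \<inter> S) = \<phi> ` U0 \<inter> Esp k" "U = U0 \<inter> S"
      using a by (auto simp: atlas_submanifold)
    note c = maximal_atlasD[OF M U0(1)]
    note cc = is_chartD[OF c(1)]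
    have inv: "inv_into U0 \<phi> (\<phi> x) = x" if "x \<in> U0" for x using that cc(4) by simp
    have sub: "subtopology (subtopology (mtop M) S) (U0 \<inter> S) = subtopology (mtop M) (U0 \<inter> S)"
      by (simp add: subtopology_subtopology Int_absorb1)
    \<comment> \<open>The bound \<open>k \<le> mdim M\<close> is at hand only if S meets the chart.
      Otherwise the slice is empty and so is its image.\<close>
    have oW: "openin (Euclidean_space k) (\<phi> ` (U0 \<inter> S))"
    proof (cases "U0 \<inter> S = {}")
      case False
      then have "k \<le> mdim M" using kle c(3) by blast
      then show ?thesis unfolding U0(2) using openin_Esp_restrict[OF cc(3)] by simp
    qed simp
    show ?thesis unfolding U0(3) submanifold_simps
    proof (rule is_chartI(1)[where W = "\<phi> ` (U0 \<inter> S)" and g = "inv_into U0 \<phi>"])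
      show "openin (subtopology (mtop M) S) (U0 \<inter> S)" using c(2) openin_subtopology by blast
      show "continuous_map (subtopology (subtopology (mtop M) S) (U0 \<inter> S)) (Euclidean_space k) \<phi>"
        unfolding sub cm_into_Esp
      proof (intro conjI ballI allI impI)
        show "\<phi> x \<in> Esp k" if "x \<in> topspace (subtopology (mtop M) (U0 \<inter> S))" for x
          using that U0(2) by auto
        fix i assume i: "i < k"
        show "continuous_map (subtopology (mtop M) (U0 \<inter> S)) euclideanreal (\<lambda>x. \<phi> x i)"
        proof (cases "U0 \<inter> S = {}")
          case False
          then have "i < mdim M" using kle c(3) i by fastforce
          then have "continuous_map (subtopology (mtop M) U0) euclideanreal (\<lambda>x. \<phi> x i)"
            using cc(5) unfolding cm_into_Esp by blast
          then show ?thesis by (rule continuous_map_from_subtopology_mono) auto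
        qed simp
      qed
      show "continuous_map (subtopology (Euclidean_space k) (\<phi> ` (U0 \<inter> S))) (subtopology (mtop M) S) (inv_into U0 \<phi>)"
      proof (cases "U0 \<inter> S = {}")
        case False
        then have k: "k \<le> mdim M" using kle c(3) by blast
        then have "Esp k \<subseteq> Esp (mdim M)" by simp
        then have "Euclidean_space k = subtopology (Euclidean_space (mdim M)) (Esp k)"
          by (simp add: Euclidean_space_def subtopology_subtopology topspace_Euclidean_space Int_absorb1)
        then have e: "subtopology (Euclidean_space k) (\<phi> ` (U0 \<inter> S)) = subtopology (Euclidean_space (mdim M)) (\<phi> ` (U0 \<inter> S))"
          by (metis U0(2) inf.absorb2 inf_le2 subtopology_subtopology)
        have "continuous_map (subtopology (Euclidean_space (mdim M)) (\<phi> ` (U0 \<inter> S))) (mtop M) (inv_into U0 \<phi>)"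
          using cc(6) by (rule continuous_map_from_subtopology_mono) auto
        then show ?thesis unfolding e continuous_map_in_subtopology using inv by auto
      qed simp
    qed (use inv oW in auto)
  qed
  show "\<exists>U \<phi>. (U, \<phi>) \<in> atlas (submanifold M S k) \<and> p \<in> U" if p: "p \<in> pts (submanifold M S k)" for p
  proof -
    have "p \<in> S \<inter> pts M" using p by auto
    then obtain U \<phi> where U: "(U, \<phi>) \<in> maximal_atlas M" "p \<in> U" "\<phi> ` (U \<inter> S) = \<phi> ` U \<inter> Esp k"
      using S unfolding has_slices_def by blast
    have "(U \<inter> S, \<phi>) \<in> atlas (submanifold M S k)" unfolding atlas_submanifold using U by blast
    then show ?thesis using U(2) p by auto
  qed
  fix U1 \<phi>1 U2 \<phi>2 i assume a: "(U1, \<phi>1) \<in> atlas (submanifold M S k)" "(U2, \<phi>2) \<in> atlas (submanifold M S k)"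
    "i < mdim (submanifold M S k)"
  obtain U where U: "(U, \<phi>1) \<in> maximal_atlas M" "\<phi>1 ` (U \<inter> S) = \<phi>1 ` U \<inter> Esp k" "U1 = U \<inter> S"
    using a(1) by (auto simp: atlas_submanifold)
  obtain V where V: "(V, \<phi>2) \<in> maximal_atlas M" "\<phi>2 ` (V \<inter> S) = \<phi>2 ` V \<inter> Esp k" "U2 = V \<inter> S"
    using a(2) by (auto simp: atlas_submanifold)
  have e: "U1 \<inter> U2 = (U \<inter> V) \<inter> S" using U(3) V(3) by auto
  show "chart_smooth (mdim (submanifold M S k)) \<phi>1 (U1 \<inter> U2) (\<lambda>x. \<phi>2 x i)"
  proof (cases "U1 \<inter> U2 = {}")
    case True
    then show ?thesis unfolding chart_smooth_def by (auto intro!: exI[of _ "\<lambda>_. 0"] smooth_on_const)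
  next
    case False
    then have k: "k \<le> mdim M" using kle e maximal_atlasD(3)[OF M U(1)] by blast
    show ?thesis unfolding e submanifold_simps
      by (rule chart_smooth_slice[OF M U(1,2) k _ _ smooth_fun_chart_smooth[OF M U(1) smooth_fun_coord[OF M V(1)]]])
        (use maximal_atlasD(2)[OF M U(1)] maximal_atlasD(2)[OF M V(1)] in auto)
  qed
qed

lemma smooth_map_from_submanifold:
  assumes S: "has_slices M S k" and N: "is_manifold N" and f: "smooth_map M N f"
  shows "smooth_map (submanifold M S k) N f"
proof (rule smooth_mapI[OF is_manifold_submanifold[OF S] N])
  have M: "is_manifold M" using S by (simp add: has_slices_def)
  show "continuous_map (mtop (submanifold M S k)) (mtop N) f"
    using continuous_map_from_subtopology[OF smooth_map_continuous[OF f]] by simp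
  fix p assume "p \<in> pts (submanifold M S k)"
  then have p: "p \<in> S \<inter> pts M" by auto
  then obtain U \<phi> where U: "(U, \<phi>) \<in> maximal_atlas M" "p \<in> U" "\<phi> ` (U \<inter> S) = \<phi> ` U \<inter> Esp k" and k: "k \<le> mdim M"
    using S unfolding has_slices_def by blast
  obtain V \<psi> where V: "(V, \<psi>) \<in> maximal_atlas N" "f p \<in> V"
    using is_manifold_chart_at[OF N smooth_map_in[OF f]] p by blast
  let ?A = "U \<inter> {x \<in> pts M. f x \<in> V}"
  have oA: "openin (mtop M) ?A" using maximal_atlasD(2)[OF M U(1)] smooth_map_vimage_open[OF f maximal_atlasD(2)[OF N V(1)]] by auto
  have at: "(U \<inter> S, \<phi>) \<in> atlas (submanifold M S k)" unfolding atlas_submanifold using U by blast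
  have "smooth_fun (submanifold M S k) (?A \<inter> S) (\<lambda>x. \<psi> (f x) i)" for i
  proof (rule chart_smooth_smooth_fun[OF is_manifold_submanifold[OF S] is_manifoldD(6)[OF is_manifold_submanifold[OF S] at]])
    show "chart_smooth (mdim (submanifold M S k)) \<phi> (?A \<inter> S) (\<lambda>x. \<psi> (f x) i)"
      unfolding submanifold_simps
      by (rule chart_smooth_slice[OF M U(1,3) k oA _ smooth_fun_chart_smooth[OF M U(1) smooth_map_smooth_fun[OF M N f V(1)]]]) auto
    show "openin (mtop (submanifold M S k)) (?A \<inter> S)" using oA unfolding submanifold_simps openin_subtopology by blast
  qed auto
  then show "\<exists>V \<psi> A. (V, \<psi>) \<in> maximal_atlas N \<and> p \<in> A \<and> f ` A \<subseteq> V \<and>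
       (\<forall>i<mdim N. smooth_fun (submanifold M S k) A (\<lambda>x. \<psi> (f x) i))"
    using U V p by (intro exI[of _ V] exI[of _ \<psi>] exI[of _ "?A \<inter> S"]) auto
qed

text \<open>A slice chart is an ambient chart with restricted domain, so the coordinates of f in it
  are its ambient coordinates. Continuity into S holds because S carries the subspace
  topology.\<close>

lemma smooth_map_into_submanifold:
  assumes S: "has_slices M S k" and X: "is_manifold X" and f: "smooth_map X M f"
    and fS: "\<And>x. x \<in> pts X \<Longrightarrow> f x \<in> S"
  shows "smooth_map X (submanifold M S k) f"
proof (rule smooth_mapI[OF X is_manifold_submanifold[OF S]])
  have M: "is_manifold M" using S by (simp add: has_slices_def)
  show "continuous_map (mtop X) (mtop (submanifold M S k)) f"
    using smooth_map_continuous[OF f] fS by (auto simp: continuous_map_in_subtopology)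
  fix p assume p: "p \<in> pts X"
  then have "f p \<in> S \<inter> pts M" using smooth_map_in[OF f] fS by auto
  then obtain U \<phi> where U: "(U, \<phi>) \<in> maximal_atlas M" "f p \<in> U" "\<phi> ` (U \<inter> S) = \<phi> ` U \<inter> Esp k"
    using S unfolding has_slices_def by blast
  have at: "(U \<inter> S, \<phi>) \<in> atlas (submanifold M S k)" unfolding atlas_submanifold using U by blast
  show "\<exists>V \<psi> A. (V, \<psi>) \<in> maximal_atlas (submanifold M S k) \<and> p \<in> A \<and> f ` A \<subseteq> V \<and>
       (\<forall>i<mdim (submanifold M S k). smooth_fun X A (\<lambda>x. \<psi> (f x) i))"
    using is_manifoldD(6)[OF is_manifold_submanifold[OF S] at] U(2) p fS smooth_map_smooth_fun[OF X M f U(1)]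
    by (intro exI[of _ "U \<inter> S"] exI[of _ \<phi>] exI[of _ "{x \<in> pts X. f x \<in> U}"]) auto
qed

subsection \<open>Fibre products\<close>

text \<open>The case of transversality in which one of the two maps is a submersion. The manifold
  conditions are included so that a fibre product is governed by a single hypothesis.\<close>

definition transversal :: "'a manifold \<Rightarrow> ('a \<Rightarrow> 'n) \<Rightarrow> 'n manifold \<Rightarrow> ('b \<Rightarrow> 'n) \<Rightarrow> 'b manifold \<Rightarrow> bool" where
  "transversal R f N g S \<longleftrightarrow> is_manifold R \<and> is_manifold N \<and> is_manifold S \<and>
     (submersion R N f \<and> smooth_map S N g \<or> smooth_map R N f \<and> submersion S N g)"

text \<open>The coordinates near a point of \<open>R \<times>\<^sub>N S\<close>: those of \<open>y\<close>, then the coordinates of \<open>x\<close> along the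
  fibre of \<open>f\<close>, then the difference of \<open>f x\<close> and \<open>g y\<close> in a chart of \<open>N\<close>.\<close>

lemma fibre_product_slice:
  assumes R: "is_manifold R" and N: "is_manifold N" and S: "is_manifold S"
    and f: "submersion R N f" and g: "smooth_map S N g"
    and x0: "x0 \<in> pts R" and y0: "y0 \<in> pts S" and fg: "f x0 = g y0"
  defines "F \<equiv> {(x, y). f x = g y}" and "k \<equiv> mdim R + mdim S - mdim N"
  obtains A \<Theta> W \<xi> where "(A, \<Theta>) \<in> maximal_atlas (prod_manifold R S)" "(x0, y0) \<in> A"
    "\<Theta> ` (A \<inter> F) = \<Theta> ` A \<inter> Esp k" "(W, \<xi>) \<in> maximal_atlas S" "snd ` A \<subseteq> W"
    "\<And>q i. q \<in> A \<Longrightarrow> i < mdim S \<Longrightarrow> \<Theta> q i = \<xi> (snd q) i" "mdim S \<le> k" "k \<le> mdim R + mdim S"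
proof -
  define m n p where mnp: "m = mdim R" "n = mdim N" "p = mdim S"
  obtain U \<phi> V \<psi> where c: "(U, \<phi>) \<in> maximal_atlas R" "(V, \<psi>) \<in> maximal_atlas N" "x0 \<in> U" "f ` U \<subseteq> V"
    "\<And>x i. x \<in> U \<Longrightarrow> i < n \<Longrightarrow> \<psi> (f x) i = \<phi> x i" "n \<le> m"
    using submersionE[OF f x0] unfolding mnp by metis
  obtain W0 \<xi> where W0: "(W0, \<xi>) \<in> maximal_atlas S" "y0 \<in> W0" using is_manifold_chart_at[OF S y0] .
  define W where "W = W0 \<inter> {y \<in> pts S. g y \<in> V}"
  have oW: "openin (mtop S) W"
    unfolding W_def using maximal_atlasD(2)[OF S W0(1)] smooth_map_vimage_open[OF g maximal_atlasD(2)[OF N c(2)]] by auto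
  have W: "(W, \<xi>) \<in> maximal_atlas S" by (rule maximal_atlas_subset[OF S W0(1) oW]) (auto simp: W_def)
  have y0W: "y0 \<in> W" using W0(2) y0 c(3,4) fg by (auto simp: W_def)
  have gV: "g y \<in> V" if "y \<in> W" for y using that by (simp add: W_def)
  note chR = is_chartD[OF maximal_atlasD(1)[OF R c(1)], folded mnp]
  note chN = is_chartD[OF maximal_atlasD(1)[OF N c(2)], folded mnp]
  note chS = is_chartD[OF maximal_atlasD(1)[OF S W], folded mnp]
  have km: "k + n = m + p" "p \<le> k" "k \<le> m + p" using c(6) by (auto simp: k_def mnp)
  \<comment> \<open>Three blocks of lengths p, m - n and n. The second takes the coordinates of x
    from index n on, and k = p + (m - n) is the index at which the differences begin.\<close>
  define \<Theta> where "\<Theta> q i = (if i < p then \<xi> (snd q) i else if i < k then \<phi> (fst q) (n + (i - p))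
     else if i < m + p then \<phi> (fst q) (i - k) - \<psi> (g (snd q)) (i - k) else 0)" for q i
  have P: "is_manifold (prod_manifold R S)" by (rule is_manifold_prod[OF R S])
  have pc: "(U \<times> W, pchart m \<phi> \<xi>) \<in> maximal_atlas (prod_manifold R S)"
    unfolding mnp by (rule maximal_atlas_prod[OF R S c(1) W])
  have oUW: "openin (mtop (prod_manifold R S)) (U \<times> W)" by (rule maximal_atlasD(2)[OF P pc])
  have sg: "smooth_fun S W (\<lambda>y. \<psi> (g y) j)" for j
    by (rule smooth_fun_subset[OF smooth_map_smooth_fun[OF S N g c(2)] _ oW]) (auto simp: W_def)
  have "\<exists>G. smooth_on p (\<xi> ` W) G \<and> (\<forall>y\<in>W. G (\<xi> y) = \<psi> (g y) j)" for j
    using smooth_fun_chart_smooth[OF S W sg[of j]] by (simp add: chart_smooth_def mnp)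
  then obtain \<gamma> where \<gamma>: "\<And>j. smooth_on p (\<xi> ` W) (\<gamma> j)" "\<And>j y. y \<in> W \<Longrightarrow> \<gamma> j (\<xi> y) = \<psi> (g y) j" by metis
  let ?D = "{z \<in> Esp (m + p). trunc p z \<in> \<xi> ` W}"
  have tr: "trunc p (\<Theta> q) = \<xi> (snd q)" if "snd q \<in> W" for q
    using chS(7)[OF that] by (auto simp: trunc_def \<Theta>_def Esp_iff fun_eq_iff)
  have s1: "smooth_fun (prod_manifold R S) (U \<times> W) (\<lambda>q. \<phi> (fst q) i)" for i
    by (rule smooth_fun_subset[OF smooth_map_smooth_fun[OF P R smooth_map_fst_snd(1)[OF R S] c(1)] _ oUW])
      (use chR(2) chS(2) in auto)
  have s2: "smooth_fun (prod_manifold R S) (U \<times> W) (\<lambda>q. h (snd q))" if h: "smooth_fun S W h" for h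
    by (rule smooth_fun_subset[OF smooth_fun_pullback[OF P S smooth_map_fst_snd(2)[OF R S] h] _ oUW])
      (use chR(2) chS(2) in auto)
  have sdiff: "smooth_fun (prod_manifold R S) (U \<times> W) (\<lambda>q. \<phi> (fst q) i - \<psi> (g (snd q)) i)" for i
  proof -
    \<comment> \<open>The two functions are packed into a map to the plane, on which the difference
      is a smooth function.\<close>
    define z where "z q j = (if j = 0 then \<phi> (fst q) i else if j = (1::nat) then \<psi> (g (snd q)) i else 0)" for q j
    have "smooth_fun (prod_manifold R S) (U \<times> W) (\<lambda>q. (\<lambda>w. w 0 - w 1) (z q))"
    proof (rule smooth_fun_compose[OF P oUW, where V = "Esp 2" and m = 2 and k = z and G = "\<lambda>w. w 0 - w 1"])
      show "smooth_fun (prod_manifold R S) (U \<times> W) (\<lambda>x. z x j)" if "j < 2" for j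
        using s1[of i] s2[OF sg[of i]] that less_2_cases by (fastforce simp: z_def)
      show "smooth_on 2 (Esp 2) (\<lambda>w. w 0 - w 1)" by (intro smooth_on_diff smooth_on_coord) auto
    qed (auto simp: z_def Esp_iff)
    then show ?thesis by (simp add: z_def)
  qed
  have oSW: "openin (Euclidean_space p) (\<xi> ` W)" by (rule chS(3))
  have max: "(U \<times> W, \<Theta>) \<in> maximal_atlas (prod_manifold R S)"
  \<comment> \<open>The inverse: adding to the last block the coordinates of g y, which are
    functions \<gamma> of the first block, gives the first n coordinates of x. All others only move
    to their place in the product chart.\<close>
  proof (rule maximal_atlas_recoordinatize[OF P pc, where D = ?D and
        G = "\<lambda>j z. if j < n then z (k + j) + \<gamma> j (trunc p z) else if j < m then z (p + (j - n)) else z (j - m)"])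
    have oD: "openin (Euclidean_space (m + p)) ?D" by (rule openin_trunc[OF oSW])
    then show "openin (Euclidean_space (mdim (prod_manifold R S))) ?D" by (simp add: mnp)
    show "\<Theta> q \<in> ?D" if "q \<in> U \<times> W" for q
      using tr[of q] that km by (auto simp: Esp_iff \<Theta>_def)
    show "smooth_fun (prod_manifold R S) (U \<times> W) (\<lambda>q. \<Theta> q i)" if "i < mdim (prod_manifold R S)" for i
    proof -
      have i: "i < m + p" using that by (simp add: mnp)
      consider "i < p" | "\<not> i < p" "i < k" | "\<not> i < p" "\<not> i < k" by blast
      then show ?thesis
      proof cases
        case 1
        then show ?thesis using s2[OF smooth_fun_coord[OF S W]] by (simp add: \<Theta>_def)
      next
        case 2
        then show ?thesis using s1 by (simp add: \<Theta>_def)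
      next
        case 3
        then show ?thesis using sdiff i by (simp add: \<Theta>_def)
      qed
    qed
    show "smooth_on (mdim (prod_manifold R S)) ?D
        (\<lambda>z. if j < n then z (k + j) + \<gamma> j (trunc p z) else if j < m then z (p + (j - n)) else z (j - m))" for j
    proof -
      have "smooth_on (m + p) ?D (\<lambda>z. z (k + j) + \<gamma> j (trunc p z))"
        by (intro smooth_on_add oD smooth_on_coord smooth_on_trunc oSW \<gamma>(1))
      then show ?thesis using smooth_on_coord[OF oD]
        by (cases "j < n"; cases "j < m") (simp_all add: mnp[symmetric])
    qed
    fix q j assume q: "q \<in> U \<times> W" and "j < mdim (prod_manifold R S)"
    then have j: "j < m + p" by (simp add: mnp)
    have t: "trunc p (\<Theta> q) = \<xi> (snd q)" using tr q by auto
    show "(if j < n then \<Theta> q (k + j) + \<gamma> j (trunc p (\<Theta> q)) else if j < m then \<Theta> q (p + (j - n)) else \<Theta> q (j - m)) =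
      pchart m \<phi> \<xi> q j"
      unfolding t using q j km c(6) \<gamma>(2)[of "snd q" j]
      by (auto simp: \<Theta>_def pchart_def cjoin_def)
  qed
  \<comment> \<open>The first n coordinates of x are those of f x, so the last block vanishes
    exactly when f x and g y have equal coordinates; the chart of N is injective.\<close>
  have slice: "\<Theta> q \<in> Esp k \<longleftrightarrow> q \<in> F" if q: "q \<in> U \<times> W" for q
  proof -
    have "\<Theta> q \<in> Esp k \<longleftrightarrow> (\<forall>j<n. \<phi> (fst q) j = \<psi> (g (snd q)) j)"
    proof
      assume E: "\<Theta> q \<in> Esp k"
      show "\<forall>j<n. \<phi> (fst q) j = \<psi> (g (snd q)) j"
      proof clarify
        fix j assume "j < n"
        then have "\<Theta> q (k + j) = \<phi> (fst q) j - \<psi> (g (snd q)) j" using km by (simp add: \<Theta>_def)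
        then show "\<phi> (fst q) j = \<psi> (g (snd q)) j" using E by (simp add: Esp_iff)
      qed
    next
      assume *: "\<forall>j<n. \<phi> (fst q) j = \<psi> (g (snd q)) j"
      show "\<Theta> q \<in> Esp k" unfolding Esp_iff
      proof clarify
        fix i assume "k \<le> i"
        then show "\<Theta> q i = 0" using * km by (auto simp: \<Theta>_def)
      qed
    qed
    also have "\<dots> \<longleftrightarrow> \<psi> (f (fst q)) = \<psi> (g (snd q))"
    proof -
      have fV: "f (fst q) \<in> V" "g (snd q) \<in> V" using q c(4) gV by auto
      have "\<psi> (f (fst q)) = \<psi> (g (snd q)) \<longleftrightarrow> (\<forall>j<n. \<psi> (f (fst q)) j = \<psi> (g (snd q)) j)"
        using chN(7)[OF fV(1)] chN(7)[OF fV(2)] unfolding Esp_iff fun_eq_iff by (metis not_le)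
      moreover have "\<psi> (f (fst q)) j = \<phi> (fst q) j" if "j < n" for j using c(5) q that by auto
      ultimately show ?thesis by simp
    qed
    also have "\<dots> \<longleftrightarrow> q \<in> F"
      using chN(4) q c(4) gV by (auto simp: F_def inj_on_eq_iff image_subset_iff case_prod_beta)
    finally show ?thesis .
  qed
  show thesis
  proof (rule that[where A = "U \<times> W" and \<Theta> = \<Theta> and W = W and \<xi> = \<xi>])
    show "(x0, y0) \<in> U \<times> W" using c(3) y0W by simp
    show "\<Theta> ` (U \<times> W \<inter> F) = \<Theta> ` (U \<times> W) \<inter> Esp k" using slice by blast
    show "snd ` (U \<times> W) \<subseteq> W" by auto
    show "\<Theta> q i = \<xi> (snd q) i" if "i < mdim S" for q i using that by (simp add: \<Theta>_def mnp)
  qed (use km max W in \<open>auto simp: mnp\<close>)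
qed

text \<open>When g is the submersion, the slice chart is built with the factors exchanged and pulled
  back along the swap. The dimension is symmetric in R and S.\<close>

lemma has_slices_fibre_product:
  assumes t: "transversal R f N g S"
  shows "has_slices (prod_manifold R S) {(x, y). f x = g y} (mdim R + mdim S - mdim N)"
proof -
  have m: "is_manifold R" "is_manifold N" "is_manifold S" using t by (auto simp: transversal_def)
  have P: "is_manifold (prod_manifold R S)" by (rule is_manifold_prod[OF m(1,3)])
  show ?thesis unfolding has_slices_def
  proof (intro conjI P ballI)
    fix q assume "q \<in> {(x, y). f x = g y} \<inter> pts (prod_manifold R S)"
    then obtain x y where q: "q = (x, y)" "x \<in> pts R" "y \<in> pts S" "f x = g y" by auto
    show "mdim R + mdim S - mdim N \<le> mdim (prod_manifold R S)" by simp
    show "\<exists>U \<phi>. (U, \<phi>) \<in> maximal_atlas (prod_manifold R S) \<and> q \<in> U \<and>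
      \<phi> ` (U \<inter> {(x, y). f x = g y}) = \<phi> ` U \<inter> Esp (mdim R + mdim S - mdim N)"
    proof (cases "submersion R N f \<and> smooth_map S N g")
      case True
      then have s: "submersion R N f" "smooth_map S N g" by auto
      obtain A \<Theta> where A: "(A, \<Theta>) \<in> maximal_atlas (prod_manifold R S)" "(x, y) \<in> A"
        "\<Theta> ` (A \<inter> {(x, y). f x = g y}) = \<Theta> ` A \<inter> Esp (mdim R + mdim S - mdim N)"
        using fibre_product_slice[OF m s q(2-4)] by metis
      then show ?thesis using q(1) by blast
    next
      case False
      then have s: "submersion S N g" "smooth_map R N f" using t by (auto simp: transversal_def)
      obtain A \<Theta> where A: "(A, \<Theta>) \<in> maximal_atlas (prod_manifold S R)" "(y, x) \<in> A"
        "\<Theta> ` (A \<inter> {(y, x). g y = f x}) = \<Theta> ` A \<inter> Esp (mdim S + mdim R - mdim N)"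
        using fibre_product_slice[OF m(3,2,1) s q(3,2) q(4)[symmetric]] by metis
      have P': "is_manifold (prod_manifold S R)" by (rule is_manifold_prod[OF m(3,1)])
      let ?A = "{q \<in> pts (prod_manifold R S). (snd q, fst q) \<in> A}"
      have 1: "(?A, \<lambda>q. \<Theta> (snd q, fst q)) \<in> maximal_atlas (prod_manifold R S)"
        by (rule diffeo_chart[OF P P' _ _ _ _ _ A(1), where g = "\<lambda>q. (snd q, fst q)"])
          (auto intro: smooth_map_pair smooth_map_fst_snd is_manifold_prod m)
      have As: "A \<subseteq> pts S \<times> pts R" using maximal_atlasD(3)[OF P' A(1)] by simp
      have "(\<lambda>q. \<Theta> (snd q, fst q)) ` (?A \<inter> {(x, y). f x = g y}) = \<Theta> ` (A \<inter> {(y, x). g y = f x})"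
        using As by force
      moreover have "(\<lambda>q. \<Theta> (snd q, fst q)) ` ?A = \<Theta> ` A" using As by force
      ultimately show ?thesis using 1 A(2,3) q
        by (intro exI[of _ ?A] exI[of _ "\<lambda>q. \<Theta> (snd q, fst q)"]) (simp add: add.commute)
    qed
  qed
qed

lemma pts_fibre_product:
  "pts (fibre_product R f N g S) = {(x, y). x \<in> pts R \<and> y \<in> pts S \<and> f x = g y}"
  by (auto simp: fibre_product_def)

lemma fibre_product_manifold:
  assumes t: "transversal R f N g S"
  shows "is_manifold (fibre_product R f N g S)"
  unfolding fibre_product_def by (rule is_manifold_submanifold[OF has_slices_fibre_product[OF t]])

lemma fibre_product_fst:
  assumes t: "transversal R f N g S" shows "smooth_map (fibre_product R f N g S) R fst"
  unfolding fibre_product_def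
  by (rule smooth_map_from_submanifold[OF has_slices_fibre_product[OF t]])
    (use t in \<open>auto simp: transversal_def intro: smooth_map_fst_snd\<close>)

lemma fibre_product_snd:
  assumes t: "transversal R f N g S" shows "smooth_map (fibre_product R f N g S) S snd"
  unfolding fibre_product_def
  by (rule smooth_map_from_submanifold[OF has_slices_fibre_product[OF t]])
    (use t in \<open>auto simp: transversal_def intro: smooth_map_fst_snd\<close>)

lemma smooth_map_fibre_pair:
  assumes t: "transversal R f N g S" and X: "is_manifold X" and a: "smooth_map X R a" and b: "smooth_map X S b"
    and eq: "\<And>x. x \<in> pts X \<Longrightarrow> f (a x) = g (b x)"
  shows "smooth_map X (fibre_product R f N g S) (\<lambda>x. (a x, b x))"
  unfolding fibre_product_def
proof (rule smooth_map_into_submanifold[OF has_slices_fibre_product[OF t] X])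
  show "smooth_map X (prod_manifold R S) (\<lambda>x. (a x, b x))"
    using t unfolding transversal_def by (intro smooth_map_pair X a b) auto
qed (use eq in auto)

lemma fibre_product_maximal_atlas:
  assumes t: "transversal R f N g S" and c: "(U, \<phi>) \<in> maximal_atlas (prod_manifold R S)"
    and s: "\<phi> ` (U \<inter> {(x, y). f x = g y}) = \<phi> ` U \<inter> Esp (mdim R + mdim S - mdim N)"
  shows "(U \<inter> {(x, y). f x = g y}, \<phi>) \<in> maximal_atlas (fibre_product R f N g S)"
proof (rule is_manifoldD(6)[OF fibre_product_manifold[OF t]])
  show "(U \<inter> {(x, y). f x = g y}, \<phi>) \<in> atlas (fibre_product R f N g S)"
    unfolding fibre_product_def atlas_submanifold using c s by blast
qed

text \<open>The slice chart lists the coordinates of y first; restricted to the fibre product, it is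
  therefore already adapted to the second projection. This is the reason for the order of its
  blocks.\<close>

lemma submersion_fibre_snd:
  assumes R: "is_manifold R" and N: "is_manifold N" and S: "is_manifold S"
    and f: "submersion R N f" and g: "smooth_map S N g"
  shows "submersion (fibre_product R f N g S) S snd"
proof -
  have t: "transversal R f N g S" using assms by (simp add: transversal_def)
  show ?thesis
  proof (rule submersionI[OF fibre_product_snd[OF t]])
    fix q assume "q \<in> pts (fibre_product R f N g S)"
    then obtain x y where q: "q = (x, y)" "x \<in> pts R" "y \<in> pts S" "f x = g y" by (auto simp: pts_fibre_product)
    obtain A \<Theta> W \<xi> where A: "(A, \<Theta>) \<in> maximal_atlas (prod_manifold R S)" "(x, y) \<in> A"
        "\<Theta> ` (A \<inter> {(x, y). f x = g y}) = \<Theta> ` A \<inter> Esp (mdim R + mdim S - mdim N)"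
       "(W, \<xi>) \<in> maximal_atlas S" "snd ` A \<subseteq> W"
       "\<And>q i. q \<in> A \<Longrightarrow> i < mdim S \<Longrightarrow> \<Theta> q i = \<xi> (snd q) i" "mdim S \<le> mdim R + mdim S - mdim N"
       "mdim R + mdim S - mdim N \<le> mdim R + mdim S"
      by (rule fibre_product_slice[OF R N S f g q(2-4)], rule that) assumption+
    have "mdim (fibre_product R f N g S) = mdim R + mdim S - mdim N" by (simp add: fibre_product_def)
    then show "mdim S \<le> mdim (fibre_product R f N g S) \<and>
      (\<exists>U \<phi> V \<psi>. (U, \<phi>) \<in> maximal_atlas (fibre_product R f N g S) \<and> (V, \<psi>) \<in> maximal_atlas S \<and>
       q \<in> U \<and> snd ` U \<subseteq> V \<and> (\<forall>x\<in>U. \<forall>i<mdim S. \<psi> (snd x) i = \<phi> x i))"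
      using A fibre_product_maximal_atlas[OF t A(1,3)] q
      by (intro conjI exI[of _ "A \<inter> {(x, y). f x = g y}"] exI[of _ \<Theta>] exI[of _ W] exI[of _ \<xi>]) auto
  qed
qed

lemma diffeomorphism_fibre_swap:
  assumes t: "transversal R f N g S"
  shows "diffeomorphism (fibre_product R f N g S) (fibre_product S g N f R) (\<lambda>p. (snd p, fst p))"
proof -
  have t': "transversal S g N f R" using t by (auto simp: transversal_def)
  show ?thesis
  proof (rule diffeomorphismI[where g = "\<lambda>p. (snd p, fst p)"])
    show "smooth_map (fibre_product R f N g S) (fibre_product S g N f R) (\<lambda>p. (snd p, fst p))"
      by (rule smooth_map_fibre_pair[OF t' fibre_product_manifold[OF t] fibre_product_snd[OF t] fibre_product_fst[OF t]])
        (auto simp: pts_fibre_product)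
    show "smooth_map (fibre_product S g N f R) (fibre_product R f N g S) (\<lambda>p. (snd p, fst p))"
      by (rule smooth_map_fibre_pair[OF t fibre_product_manifold[OF t'] fibre_product_snd[OF t'] fibre_product_fst[OF t']])
        (auto simp: pts_fibre_product)
  qed auto
qed

lemma submersion_fibre_fst:
  assumes R: "is_manifold R" and N: "is_manifold N" and S: "is_manifold S"
    and f: "smooth_map R N f" and g: "submersion S N g"
  shows "submersion (fibre_product R f N g S) R fst"
proof -
  have t: "transversal R f N g S" using assms by (simp add: transversal_def)
  have t': "transversal S g N f R" using assms by (simp add: transversal_def)
  show ?thesis
    using submersion_compose[OF fibre_product_manifold[OF t] fibre_product_manifold[OF t'] R
        submersion_diffeomorphism[OF fibre_product_manifold[OF t] fibre_product_manifold[OF t'] diffeomorphism_fibre_swap[OF t]]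
        submersion_fibre_snd[OF S N R g f]] by simp
qed

text \<open>The form in which partially defined products, actions and divisions enter composite
  maps: composability is checked for the arguments a and b on the carrier of X.\<close>

lemma smooth_map_fibre_apply:
  assumes t: "transversal R f N g S" and Z: "is_manifold Z"
    and m: "smooth_map (fibre_product R f N g S) Z (\<lambda>(x, y). \<mu> x y)"
    and X: "is_manifold X" and a: "smooth_map X R a" and b: "smooth_map X S b"
    and eq: "\<And>x. x \<in> pts X \<Longrightarrow> f (a x) = g (b x)"
  shows "smooth_map X Z (\<lambda>x. \<mu> (a x) (b x))"
  using smooth_map_compose[OF X fibre_product_manifold[OF t] Z smooth_map_fibre_pair[OF t X a b eq] m] by simp

subsection \<open>Lie groupoids and principal bundles\<close>

lemma lie_groupoidD:
  assumes "lie_groupoid X"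
  shows "is_manifold (arr X)" "is_manifold (obj X)"
    "submersion (arr X) (obj X) (src X)" "submersion (arr X) (obj X) (tgt X)"
    "smooth_map (arr X) (obj X) (src X)" "smooth_map (arr X) (obj X) (tgt X)"
    "smooth_map (obj X) (arr X) (one X)" "smooth_map (arr X) (arr X) (ivr X)"
    "smooth_map (fibre_product (arr X) (src X) (obj X) (tgt X) (arr X)) (arr X) (\<lambda>(g, h). mul X g h)"
    "x \<in> pts (obj X) \<Longrightarrow> src X (one X x) = x" "x \<in> pts (obj X) \<Longrightarrow> tgt X (one X x) = x"
    "g \<in> pts (arr X) \<Longrightarrow> h \<in> pts (arr X) \<Longrightarrow> src X g = tgt X h \<Longrightarrow> src X (mul X g h) = src X h"
    "g \<in> pts (arr X) \<Longrightarrow> h \<in> pts (arr X) \<Longrightarrow> src X g = tgt X h \<Longrightarrow> tgt X (mul X g h) = tgt X g"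
    "g \<in> pts (arr X) \<Longrightarrow> h \<in> pts (arr X) \<Longrightarrow> k \<in> pts (arr X) \<Longrightarrow> src X g = tgt X h \<Longrightarrow> src X h = tgt X k \<Longrightarrow>
       mul X (mul X g h) k = mul X g (mul X h k)"
    "g \<in> pts (arr X) \<Longrightarrow> mul X g (one X (src X g)) = g" "g \<in> pts (arr X) \<Longrightarrow> mul X (one X (tgt X g)) g = g"
    "g \<in> pts (arr X) \<Longrightarrow> src X (ivr X g) = tgt X g" "g \<in> pts (arr X) \<Longrightarrow> tgt X (ivr X g) = src X g"
    "g \<in> pts (arr X) \<Longrightarrow> mul X g (ivr X g) = one X (tgt X g)" "g \<in> pts (arr X) \<Longrightarrow> mul X (ivr X g) g = one X (src X g)"
  using assms unfolding lie_groupoid_def surj_submersion_def by (simp_all add: submersionD)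

lemma lie_groupoid_surj:
  assumes "lie_groupoid X"
  shows "surj_submersion (arr X) (obj X) (src X)" "surj_submersion (arr X) (obj X) (tgt X)"
  using assms unfolding lie_groupoid_def by simp_all

lemma transversal_mul:
  assumes "lie_groupoid X" shows "transversal (arr X) (src X) (obj X) (tgt X) (arr X)"
  using lie_groupoidD(1-6)[OF assms] by (simp add: transversal_def)

lemma transversal_left:
  assumes "lie_groupoid X" "is_manifold R" "smooth_map R (obj X) l"
  shows "transversal (arr X) (src X) (obj X) l R"
  using lie_groupoidD(1-6)[OF assms(1)] assms(2,3) by (simp add: transversal_def)

lemma lie_groupoid_in:
  assumes "lie_groupoid X"
  shows "g \<in> pts (arr X) \<Longrightarrow> src X g \<in> pts (obj X)" "g \<in> pts (arr X) \<Longrightarrow> tgt X g \<in> pts (obj X)"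
    "x \<in> pts (obj X) \<Longrightarrow> one X x \<in> pts (arr X)" "g \<in> pts (arr X) \<Longrightarrow> ivr X g \<in> pts (arr X)"
    "g \<in> pts (arr X) \<Longrightarrow> h \<in> pts (arr X) \<Longrightarrow> src X g = tgt X h \<Longrightarrow> mul X g h \<in> pts (arr X)"
proof -
  note D = lie_groupoidD[OF assms]
  show "g \<in> pts (arr X) \<Longrightarrow> src X g \<in> pts (obj X)" by (rule smooth_map_in[OF D(5)])
  show "g \<in> pts (arr X) \<Longrightarrow> tgt X g \<in> pts (obj X)" by (rule smooth_map_in[OF D(6)])
  show "x \<in> pts (obj X) \<Longrightarrow> one X x \<in> pts (arr X)" by (rule smooth_map_in[OF D(7)])
  show "g \<in> pts (arr X) \<Longrightarrow> ivr X g \<in> pts (arr X)" by (rule smooth_map_in[OF D(8)])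
  show "mul X g h \<in> pts (arr X)" if "g \<in> pts (arr X)" "h \<in> pts (arr X)" "src X g = tgt X h"
    using smooth_map_in[OF D(9), of "(g, h)"] that by (simp add: pts_fibre_product)
qed

lemma groupoid_inverse_laws:
  assumes "lie_groupoid X"
  shows "g \<in> pts (arr X) \<Longrightarrow> h \<in> pts (arr X) \<Longrightarrow> src X g = tgt X h \<Longrightarrow> mul X (ivr X g) (mul X g h) = h"
    "g \<in> pts (arr X) \<Longrightarrow> h \<in> pts (arr X) \<Longrightarrow> tgt X g = tgt X h \<Longrightarrow> mul X g (mul X (ivr X g) h) = h"
    "g \<in> pts (arr X) \<Longrightarrow> h \<in> pts (arr X) \<Longrightarrow> src X g = src X h \<Longrightarrow> mul X (mul X g (ivr X h)) h = g"
    "g \<in> pts (arr X) \<Longrightarrow> h \<in> pts (arr X) \<Longrightarrow> src X g = tgt X h \<Longrightarrow> mul X (mul X g h) (ivr X h) = g"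
  using lie_groupoidD(12-20)[OF assms] lie_groupoid_in[OF assms] by (metis (no_types, lifting))+

lemma groupoid_inverse_unique:
  assumes X: "lie_groupoid X" and "g \<in> pts (arr X)" "h \<in> pts (arr X)" "src X g = tgt X h" "mul X g h = one X (tgt X g)"
  shows "h = ivr X g"
  using groupoid_inverse_laws(1)[OF assms(1-4)] lie_groupoidD(15,17)[OF X] lie_groupoid_in(4)[OF X] assms by metis

lemma groupoid_inverse_props:
  assumes X: "lie_groupoid X"
  shows "x \<in> pts (obj X) \<Longrightarrow> ivr X (one X x) = one X x"
    "g \<in> pts (arr X) \<Longrightarrow> ivr X (ivr X g) = g"
    "g \<in> pts (arr X) \<Longrightarrow> h \<in> pts (arr X) \<Longrightarrow> src X g = tgt X h \<Longrightarrow> ivr X (mul X g h) = mul X (ivr X h) (ivr X g)"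
proof -
  note D = lie_groupoidD[OF X] and I = lie_groupoid_in[OF X]
  show "ivr X (one X x) = one X x" if "x \<in> pts (obj X)"
    by (rule groupoid_inverse_unique[OF X, symmetric]) (use D(10,11,15) I(3) that in metis)+
  show "ivr X (ivr X g) = g" if "g \<in> pts (arr X)"
    by (rule groupoid_inverse_unique[OF X, symmetric]) (use D(17,18,20) I(4) that in metis)+
  show "ivr X (mul X g h) = mul X (ivr X h) (ivr X g)" if g: "g \<in> pts (arr X)" and h: "h \<in> pts (arr X)" and gh: "src X g = tgt X h"
  proof (rule groupoid_inverse_unique[OF X, symmetric])
    have c: "src X (ivr X h) = tgt X (ivr X g)" using D(17,18) g h gh by simp
    show "mul X g h \<in> pts (arr X)" by (rule I(5)[OF g h gh])
    show hg: "mul X (ivr X h) (ivr X g) \<in> pts (arr X)" by (rule I(5)[OF I(4)[OF h] I(4)[OF g] c])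
    show "src X (mul X g h) = tgt X (mul X (ivr X h) (ivr X g))"
      using D(12)[OF g h gh] D(13)[OF I(4)[OF h] I(4)[OF g] c] D(18)[OF h] by simp
    have "mul X (mul X g h) (mul X (ivr X h) (ivr X g)) = mul X (mul X (mul X g h) (ivr X h)) (ivr X g)"
      using D(12)[OF g h gh] D(18)[OF h] c I g h gh by (intro D(14)[symmetric]) auto
    also have "\<dots> = one X (tgt X g)" using groupoid_inverse_laws(4)[OF X g h gh] D(19)[OF g] by simp
    finally show "mul X (mul X g h) (mul X (ivr X h) (ivr X g)) = one X (tgt X (mul X g h))"
      using D(13)[OF g h gh] by simp
  qed
qed

lemma smooth_map_mul:
  assumes "lie_groupoid X" "is_manifold Z" "smooth_map Z (arr X) a" "smooth_map Z (arr X) b"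
    "\<And>z. z \<in> pts Z \<Longrightarrow> src X (a z) = tgt X (b z)"
  shows "smooth_map Z (arr X) (\<lambda>z. mul X (a z) (b z))"
  by (rule smooth_map_fibre_apply[OF transversal_mul[OF assms(1)] _ lie_groupoidD(9)[OF assms(1)] assms(2-5)])
    (rule lie_groupoidD(1)[OF assms(1)])

section \<open>Actions, principal bundles and division maps\<close>

lemma left_actionD:
  assumes "left_action Y R l a"
  shows "smooth_map R (obj Y) l" "smooth_map (fibre_product (arr Y) (src Y) (obj Y) l R) R (\<lambda>(y, p). a y p)"
    "y \<in> pts (arr Y) \<Longrightarrow> p \<in> pts R \<Longrightarrow> src Y y = l p \<Longrightarrow> l (a y p) = tgt Y y"
    "p \<in> pts R \<Longrightarrow> a (one Y (l p)) p = p"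
    "y \<in> pts (arr Y) \<Longrightarrow> y' \<in> pts (arr Y) \<Longrightarrow> p \<in> pts R \<Longrightarrow> src Y y = tgt Y y' \<Longrightarrow> src Y y' = l p \<Longrightarrow>
        a (mul Y y y') p = a y (a y' p)"
  using assms unfolding left_action_def by simp_all

lemma left_action_in:
  assumes "left_action Y R l a" "y \<in> pts (arr Y)" "p \<in> pts R" "src Y y = l p"
  shows "a y p \<in> pts R"
  using smooth_map_in[OF left_actionD(2)[OF assms(1)], of "(y, p)"] assms(2-) by (simp add: pts_fibre_product)

lemma smooth_map_left_action:
  assumes "left_action Y R l a" "lie_groupoid Y" "is_manifold R" "is_manifold Z" "smooth_map Z (arr Y) y" "smooth_map Z R p"
    "\<And>z. z \<in> pts Z \<Longrightarrow> src Y (y z) = l (p z)"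
  shows "smooth_map Z R (\<lambda>z. a (y z) (p z))"
  by (rule smooth_map_fibre_apply[OF transversal_left[OF assms(2,3) left_actionD(1)[OF assms(1)]] assms(3) left_actionD(2)[OF assms(1)] assms(4-7)])

lemma submersion_id: "is_manifold M \<Longrightarrow> submersion M M (\<lambda>x. x)"
  by (rule submersion_diffeomorphism) (auto intro: diffeomorphismI[where g = "\<lambda>x. x"] smooth_map_id)

lemma transversal_self:
  "is_manifold R \<Longrightarrow> is_manifold N \<Longrightarrow> submersion R N r \<Longrightarrow> transversal R r N r R"
  by (simp add: transversal_def submersionD)

text \<open>The division map is the first component of the inverse of (y, p) -> (y p, p); the second
  component of that inverse is forced to be q.\<close>

lemma principal_division:
  assumes pb: "principal_left_bundle Y R l a N r" and Y: "lie_groupoid Y" and R: "is_manifold R" and N: "is_manifold N"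
  obtains \<delta> where "smooth_map (fibre_product R r N r R) (arr Y) (\<lambda>(p, q). \<delta> p q)"
    "\<And>p q. p \<in> pts R \<Longrightarrow> q \<in> pts R \<Longrightarrow> r p = r q \<Longrightarrow> \<delta> p q \<in> pts (arr Y) \<and> src Y (\<delta> p q) = l q \<and> a (\<delta> p q) q = p"
    "\<And>y q. y \<in> pts (arr Y) \<Longrightarrow> q \<in> pts R \<Longrightarrow> src Y y = l q \<Longrightarrow> \<delta> (a y q) q = y"
proof -
  have la: "left_action Y R l a" and sub: "submersion R N r"
    and inv: "\<And>y p. y \<in> pts (arr Y) \<Longrightarrow> p \<in> pts R \<Longrightarrow> src Y y = l p \<Longrightarrow> r (a y p) = r p"
    and d: "diffeomorphism (fibre_product (arr Y) (src Y) (obj Y) l R) (fibre_product R r N r R) (\<lambda>(y, p). (a y p, p))"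
    using pb by (auto simp: principal_left_bundle_def surj_submersion_def)
  note t1 = transversal_left[OF Y R left_actionD(1)[OF la]] and t2 = transversal_self[OF R N sub]
  obtain g where g: "smooth_map (fibre_product R r N r R) (fibre_product (arr Y) (src Y) (obj Y) l R) g"
    "\<And>z. z \<in> pts (fibre_product (arr Y) (src Y) (obj Y) l R) \<Longrightarrow> g ((\<lambda>(y, p). (a y p, p)) z) = z"
    "\<And>z. z \<in> pts (fibre_product R r N r R) \<Longrightarrow> (\<lambda>(y, p). (a y p, p)) (g z) = z"
    using d unfolding diffeomorphism_def by blast
  show thesis
  proof (rule that[of "\<lambda>p q. fst (g (p, q))"])
    show "smooth_map (fibre_product R r N r R) (arr Y) (\<lambda>(p, q). fst (g (p, q)))"
      using smooth_map_compose[OF fibre_product_manifold[OF t2] fibre_product_manifold[OF t1] lie_groupoidD(1)[OF Y] g(1) fibre_product_fst[OF t1]]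
      by (simp add: case_prod_unfold)
    show "fst (g (p, q)) \<in> pts (arr Y) \<and> src Y (fst (g (p, q))) = l q \<and> a (fst (g (p, q))) q = p"
      if "p \<in> pts R" "q \<in> pts R" "r p = r q" for p q
    proof -
      have z: "(p, q) \<in> pts (fibre_product R r N r R)" using that by (simp add: pts_fibre_product)
      obtain y q' where yq: "g (p, q) = (y, q')" by force
      have "(y, q') \<in> pts (fibre_product (arr Y) (src Y) (obj Y) l R)" using smooth_map_in[OF g(1) z] yq by simp
      then show ?thesis using g(3)[OF z] yq by (auto simp: pts_fibre_product)
    qed
    show "fst (g (a y q, q)) = y" if "y \<in> pts (arr Y)" "q \<in> pts R" "src Y y = l q" for y q
      using g(2)[of "(y, q)"] that by (simp add: pts_fibre_product)
  qed
qed

text \<open>A division map \<delta> yields the inverse (p, q) -> (\<delta>(p, q), q) of the map (y,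
  p) -> (y p, p), and it is smooth together with \<delta>.\<close>

lemma principal_left_bundleI:
  assumes Y: "lie_groupoid Y" and R: "is_manifold R" and N: "is_manifold N"
    and la: "left_action Y R l a" and r: "surj_submersion R N r"
    and inv: "\<And>y p. y \<in> pts (arr Y) \<Longrightarrow> p \<in> pts R \<Longrightarrow> src Y y = l p \<Longrightarrow> r (a y p) = r p"
    and sm: "smooth_map (fibre_product R r N r R) (arr Y) (\<lambda>z. \<delta> (fst z) (snd z))"
    and d1: "\<And>p q. p \<in> pts R \<Longrightarrow> q \<in> pts R \<Longrightarrow> r p = r q \<Longrightarrow> src Y (\<delta> p q) = l q \<and> a (\<delta> p q) q = p"
    and d2: "\<And>y q. y \<in> pts (arr Y) \<Longrightarrow> q \<in> pts R \<Longrightarrow> src Y y = l q \<Longrightarrow> \<delta> (a y q) q = y"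
  shows "principal_left_bundle Y R l a N r"
  unfolding principal_left_bundle_def
proof (intro conjI la r ballI impI inv)
  have sub: "submersion R N r" using r by (simp add: surj_submersion_def)
  note t1 = transversal_left[OF Y R left_actionD(1)[OF la]] and t2 = transversal_self[OF R N sub]
  note F1 = fibre_product_manifold[OF t1] and F2 = fibre_product_manifold[OF t2]
  show "diffeomorphism (fibre_product (arr Y) (src Y) (obj Y) l R) (fibre_product R r N r R) (\<lambda>(y, p). (a y p, p))"
  proof (rule diffeomorphismI[where g = "\<lambda>z. (\<delta> (fst z) (snd z), snd z)"])
    have "smooth_map (fibre_product (arr Y) (src Y) (obj Y) l R) (fibre_product R r N r R) (\<lambda>z. (a (fst z) (snd z), snd z))"
    proof (rule smooth_map_fibre_pair[OF t2 F1 _ fibre_product_snd[OF t1]])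
      show "smooth_map (fibre_product (arr Y) (src Y) (obj Y) l R) R (\<lambda>z. a (fst z) (snd z))"
        using left_actionD(2)[OF la] by (simp add: case_prod_unfold)
    qed (use inv in \<open>auto simp: pts_fibre_product\<close>)
    then show "smooth_map (fibre_product (arr Y) (src Y) (obj Y) l R) (fibre_product R r N r R) (\<lambda>(y, p). (a y p, p))"
      by (simp add: case_prod_unfold)
    show "smooth_map (fibre_product R r N r R) (fibre_product (arr Y) (src Y) (obj Y) l R) (\<lambda>z. (\<delta> (fst z) (snd z), snd z))"
      by (rule smooth_map_fibre_pair[OF t1 F2 sm fibre_product_snd[OF t2]]) (use d1 in \<open>auto simp: pts_fibre_product\<close>)
  qed (use d1 d2 in \<open>auto simp: pts_fibre_product\<close>)
qed

lemma surj_submersion_cong: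
  assumes "is_manifold M" "is_manifold N" "surj_submersion M N f" "\<And>x. x \<in> pts M \<Longrightarrow> f x = g x"
  shows "surj_submersion M N g"
  using assms submersion_cong[OF assms(1,2)] unfolding surj_submersion_def by (metis image_cong)

lemma surj_submersion_id: "is_manifold M \<Longrightarrow> surj_submersion M M (\<lambda>x. x)"
  by (simp add: surj_submersion_def submersion_id)

lemma unit_groupoid_simps [simp]:
  "arr (unit_groupoid M) = M" "obj (unit_groupoid M) = M" "src (unit_groupoid M) = (\<lambda>x. x)"
  "tgt (unit_groupoid M) = (\<lambda>x. x)" "one (unit_groupoid M) = (\<lambda>x. x)" "ivr (unit_groupoid M) = (\<lambda>x. x)"
  "mul (unit_groupoid M) = (\<lambda>x y. x)"
  by (simp_all add: unit_groupoid_def)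

lemma transversal_id: "is_manifold M \<Longrightarrow> transversal M (\<lambda>x. x) M (\<lambda>x. x) M"
  by (simp add: transversal_self submersion_id)

lemma lie_groupoid_unit:
  assumes M: "is_manifold M" shows "lie_groupoid (unit_groupoid M)"
  unfolding lie_groupoid_def using fibre_product_fst[OF transversal_id[OF M]] M
  by (simp add: surj_submersion_id smooth_map_id case_prod_unfold)

lemma right_action_unit:
  assumes "is_manifold R" "is_manifold N" "smooth_map R N r"
  shows "right_action (unit_groupoid N) R r (\<lambda>p x. p)"
proof -
  have "transversal R r N (\<lambda>x. x) N" using assms by (simp add: transversal_def submersion_id)
  from fibre_product_fst[OF this] show ?thesis
    using assms(3) unfolding right_action_def by (simp add: case_prod_unfold)
qed

text \<open>In every bibundle of the square, including both structures on the centre, the groupoid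
  acting from the right is a unit groupoid. Its action is trivial, and what remains is a principal
  left action whose quotient map is the right moment map.\<close>

lemma hs_bibundle_unit:
  assumes "lie_groupoid Y" "is_manifold R" "is_manifold N" "principal_left_bundle Y R l a N r"
  shows "hs_bibundle (unit_groupoid N) Y \<lparr>tot = R, lmom = l, rmom = r, lact = a, ract = (\<lambda>p x. p)\<rparr>"
proof -
  have "smooth_map R N r"
    using assms(4) by (simp add: principal_left_bundle_def surj_submersion_def submersionD)
  then show ?thesis
    using assms lie_groupoid_unit[OF assms(3)] right_action_unit[OF assms(2,3)]
    by (simp add: hs_bibundle_def)
qed

lemma submersion_groupoid_simps [simp]:
  "arr (submersion_groupoid N M \<pi>) = fibre_product N \<pi> M \<pi> N" "obj (submersion_groupoid N M \<pi>) = N"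
  "src (submersion_groupoid N M \<pi>) = snd" "tgt (submersion_groupoid N M \<pi>) = fst"
  "one (submersion_groupoid N M \<pi>) = (\<lambda>x. (x, x))" "ivr (submersion_groupoid N M \<pi>) = (\<lambda>(x, y). (y, x))"
  "mul (submersion_groupoid N M \<pi>) = (\<lambda>(x, y) (y', z). (x, z))"
  by (simp_all add: submersion_groupoid_def)

lemma lie_groupoid_submersion:
  assumes N: "is_manifold N" and M: "is_manifold M" and p: "submersion N M \<pi>"
  shows "lie_groupoid (submersion_groupoid N M \<pi>)"
proof -
  note t = transversal_self[OF N M p]
  let ?F = "fibre_product N \<pi> M \<pi> N"
  note F = fibre_product_manifold[OF t] and fs = fibre_product_fst[OF t] and sn = fibre_product_snd[OF t]
  have s1: "submersion ?F N snd" by (rule submersion_fibre_snd[OF N M N p submersionD[OF p]])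
  have s2: "submersion ?F N fst" by (rule submersion_fibre_fst[OF N M N submersionD[OF p] p])
  have o: "smooth_map N ?F (\<lambda>x. (x, x))" by (rule smooth_map_fibre_pair[OF t N]) (auto simp: smooth_map_id N)
  have i: "smooth_map ?F ?F (\<lambda>(x, y). (y, x))"
    unfolding case_prod_unfold by (rule smooth_map_fibre_pair[OF t F sn fs]) (auto simp: pts_fibre_product)
  have t2: "transversal ?F snd N fst ?F" using s1 s2 F N by (auto simp: transversal_def submersionD)
  let ?FF = "fibre_product ?F snd N fst ?F"
  have m: "smooth_map ?FF ?F (\<lambda>z. (fst (fst z), snd (snd z)))"
    by (rule smooth_map_fibre_pair[OF t fibre_product_manifold[OF t2]
          smooth_map_compose[OF fibre_product_manifold[OF t2] F N fibre_product_fst[OF t2] fs]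
          smooth_map_compose[OF fibre_product_manifold[OF t2] F N fibre_product_snd[OF t2] sn]])
      (auto simp: pts_fibre_product)
  have surj: "fst ` pts ?F = pts N" "snd ` pts ?F = pts N" by (force simp: pts_fibre_product)+
  show ?thesis unfolding lie_groupoid_def surj_submersion_def
    using F N s1 s2 o i m surj by (simp add: pts_fibre_product case_prod_unfold)
qed

subsection \<open>The double groupoids at the corners\<close>

lemma groupoid_morphism_unit:
  "smooth_map M N f \<Longrightarrow> groupoid_morphism (unit_groupoid M) (unit_groupoid N) f f"
  by (simp add: groupoid_morphism_def)

lemma groupoid_morphism_id:
  "lie_groupoid X \<Longrightarrow> groupoid_morphism X X (\<lambda>x. x) (\<lambda>x. x)"
  by (simp add: groupoid_morphism_def smooth_map_id lie_groupoidD(1,2))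

lemma double_lie_groupoid_manifold:
  assumes M: "is_manifold M" shows "double_lie_groupoid (manifold_dg M)"
  using lie_groupoid_unit[OF M] groupoid_morphism_id[OF lie_groupoid_unit[OF M]]
  unfolding double_lie_groupoid_def manifold_dg_def transpose_dg_def hor_structure_maps_morphisms_def
  by simp

lemma double_lie_groupoid_submersion:
  assumes N: "is_manifold N" and M: "is_manifold M" and p: "submersion N M \<pi>"
  shows "double_lie_groupoid (submersion_dg N M \<pi>)"
proof -
  let ?S = "submersion_groupoid N M \<pi>" and ?F = "fibre_product N \<pi> M \<pi> N"
  note S = lie_groupoid_submersion[OF N M p]
  have F: "is_manifold ?F" using lie_groupoidD(1)[OF S] by simp
  have m: "smooth_map ?F N snd" "smooth_map ?F N fst" "smooth_map N ?F (\<lambda>x. (x, x))" "smooth_map ?F ?F (\<lambda>(x, y). (y, x))"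
    using lie_groupoidD(5-8)[OF S] by simp_all
  have mS: "groupoid_morphism ?S ?S (\<lambda>x. x) (\<lambda>x. x)" by (rule groupoid_morphism_id[OF S])
  show ?thesis
    using S lie_groupoid_unit[OF F] lie_groupoid_unit[OF N] m[THEN groupoid_morphism_unit] mS
    unfolding double_lie_groupoid_def submersion_dg_def transpose_dg_def hor_structure_maps_morphisms_def
    by (simp add: pts_fibre_product)
qed

subsection \<open>Principal 2-bundles\<close>

locale two_bundle =
  fixes G :: "('g1, 'g0) two_group" and P :: "('p1, 'p0) groupoid"
    and act1 :: "'g1 \<Rightarrow> 'p1 \<Rightarrow> 'p1" and act0 :: "'g0 \<Rightarrow> 'p0 \<Rightarrow> 'p0"
    and M :: "'m manifold" and \<pi> :: "'p0 \<Rightarrow> 'm"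
  assumes lie_2_group: "lie_2_group G"
    and principal: "principal_2_bundle G P act1 act0 M \<pi>"
begin

text \<open>In the names below, h marks the horizontal structure (the group G_1), v the vertical one
  (the groupoid G_1 over G_0), 0 the group G_0 and p the groupoid P; m stands for products, i for
  inverses.\<close>

abbreviation "G1 \<equiv> arr (ver1 G)"
abbreviation "G0 \<equiv> arr (hor0 G)"
abbreviation "P1 \<equiv> arr P"
abbreviation "P0 \<equiv> obj P"
abbreviation "mh \<equiv> mul (hor1 G)"
abbreviation "mv \<equiv> mul (ver1 G)"
abbreviation "m0 \<equiv> mul (hor0 G)"
abbreviation "mp \<equiv> mul P"
abbreviation "ih \<equiv> ivr (hor1 G)"
abbreviation "iv \<equiv> ivr (ver1 G)"
abbreviation "i0 \<equiv> ivr (hor0 G)"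
abbreviation "ip \<equiv> ivr P"
abbreviation "e1 \<equiv> one (hor1 G) ()"
abbreviation "e0 \<equiv> one (hor0 G) ()"
abbreviation "u \<equiv> one (ver1 G)"
abbreviation "pu \<equiv> one P"
abbreviation "s \<equiv> src (ver1 G)"
abbreviation "t \<equiv> tgt (ver1 G)"
abbreviation "sp \<equiv> src P"
abbreviation "tp \<equiv> tgt P"

section \<open>Laws of the 2-group\<close>

lemma double: "double_lie_groupoid G" and ver0: "ver0 G = unit_groupoid point_manifold"
  using lie_2_group by (auto simp: lie_2_group_def)

lemma lie_h1: "lie_groupoid (hor1 G)" and lie_h0: "lie_groupoid (hor0 G)"
  and lie_v: "lie_groupoid (ver1 G)" and lie_P: "lie_groupoid P"
  using double principal by (auto simp: double_lie_groupoid_def principal_2_bundle_def)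

text \<open>Composability in the two groups is an equation between elements of \<open>unit\<close>;
  rewriting with this removes it from the axioms.\<close>

lemma unit_eq: "(x = (y :: unit)) = True" by simp

lemma carriers [simp]:
  "arr (hor1 G) = G1" "obj (ver1 G) = G0" "obj (hor1 G) = point_manifold" "obj (hor0 G) = point_manifold"
  using double unfolding double_lie_groupoid_def ver0 by simp_all

lemma manifolds: "is_manifold G1" "is_manifold G0" "is_manifold P1" "is_manifold P0" "is_manifold M"
  using lie_groupoidD(1,2)[OF lie_v] lie_groupoidD(1,2)[OF lie_P] principal
  by (simp_all add: principal_2_bundle_def)

lemma closed [simp]:
  "g \<in> pts G1 \<Longrightarrow> s g \<in> pts G0" "g \<in> pts G1 \<Longrightarrow> t g \<in> pts G0" "a \<in> pts G0 \<Longrightarrow> u a \<in> pts G1"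
  "g \<in> pts G1 \<Longrightarrow> iv g \<in> pts G1" "g \<in> pts G1 \<Longrightarrow> ih g \<in> pts G1" "a \<in> pts G0 \<Longrightarrow> i0 a \<in> pts G0"
  "e1 \<in> pts G1" "e0 \<in> pts G0"
  "g \<in> pts G1 \<Longrightarrow> h \<in> pts G1 \<Longrightarrow> mh g h \<in> pts G1" "a \<in> pts G0 \<Longrightarrow> b \<in> pts G0 \<Longrightarrow> m0 a b \<in> pts G0"
  "g \<in> pts G1 \<Longrightarrow> h \<in> pts G1 \<Longrightarrow> s g = t h \<Longrightarrow> mv g h \<in> pts G1"
  "p \<in> pts P1 \<Longrightarrow> sp p \<in> pts P0" "p \<in> pts P1 \<Longrightarrow> tp p \<in> pts P0" "x \<in> pts P0 \<Longrightarrow> pu x \<in> pts P1"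
  "p \<in> pts P1 \<Longrightarrow> ip p \<in> pts P1" "p \<in> pts P1 \<Longrightarrow> q \<in> pts P1 \<Longrightarrow> sp p = tp q \<Longrightarrow> mp p q \<in> pts P1"
  using lie_groupoid_in[OF lie_v] lie_groupoid_in[OF lie_h1] lie_groupoid_in[OF lie_h0] lie_groupoid_in[OF lie_P]
  by (simp_all add: point_manifold(2))

lemmas P_laws [simp] = lie_groupoidD(10-13,15-20)[OF lie_P] groupoid_inverse_laws[OF lie_P] groupoid_inverse_props(1,2)[OF lie_P]
lemmas P_assoc = lie_groupoidD(14)[OF lie_P]
lemmas V_laws [simp] = lie_groupoidD(10-13,15-20)[OF lie_v, simplified] groupoid_inverse_laws[OF lie_v] groupoid_inverse_props(1,2)[OF lie_v, simplified]

lemma H_laws [simp]: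
  "g \<in> pts G1 \<Longrightarrow> mh g e1 = g" "g \<in> pts G1 \<Longrightarrow> mh e1 g = g" "g \<in> pts G1 \<Longrightarrow> mh g (ih g) = e1" "g \<in> pts G1 \<Longrightarrow> mh (ih g) g = e1"
  "g \<in> pts G1 \<Longrightarrow> h \<in> pts G1 \<Longrightarrow> mh (ih g) (mh g h) = h" "g \<in> pts G1 \<Longrightarrow> h \<in> pts G1 \<Longrightarrow> mh g (mh (ih g) h) = h"
  "g \<in> pts G1 \<Longrightarrow> h \<in> pts G1 \<Longrightarrow> mh (mh g (ih h)) h = g" "g \<in> pts G1 \<Longrightarrow> h \<in> pts G1 \<Longrightarrow> mh (mh g h) (ih h) = g"
  "a \<in> pts G0 \<Longrightarrow> m0 a e0 = a" "a \<in> pts G0 \<Longrightarrow> m0 e0 a = a" "a \<in> pts G0 \<Longrightarrow> m0 a (i0 a) = e0" "a \<in> pts G0 \<Longrightarrow> m0 (i0 a) a = e0"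
  "a \<in> pts G0 \<Longrightarrow> b \<in> pts G0 \<Longrightarrow> m0 (i0 a) (m0 a b) = b" "a \<in> pts G0 \<Longrightarrow> b \<in> pts G0 \<Longrightarrow> m0 a (m0 (i0 a) b) = b"
  "a \<in> pts G0 \<Longrightarrow> b \<in> pts G0 \<Longrightarrow> m0 (m0 a (i0 b)) b = a" "a \<in> pts G0 \<Longrightarrow> b \<in> pts G0 \<Longrightarrow> m0 (m0 a b) (i0 b) = a"
  "i0 e0 = e0" "a \<in> pts G0 \<Longrightarrow> i0 (i0 a) = a" "a \<in> pts G0 \<Longrightarrow> b \<in> pts G0 \<Longrightarrow> i0 (m0 a b) = m0 (i0 b) (i0 a)"
  "g \<in> pts G1 \<Longrightarrow> ih (ih g) = g"
  using lie_groupoidD(15,16,19,20)[OF lie_h1] lie_groupoidD(15,16,19,20)[OF lie_h0]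
    groupoid_inverse_laws[OF lie_h1] groupoid_inverse_laws[OF lie_h0]
    groupoid_inverse_props[OF lie_h1] groupoid_inverse_props[OF lie_h0]
  by (simp_all add: point_manifold(2))

lemma H_assoc: "g \<in> pts G1 \<Longrightarrow> h \<in> pts G1 \<Longrightarrow> k \<in> pts G1 \<Longrightarrow> mh (mh g h) k = mh g (mh h k)"
  and G0_assoc: "a \<in> pts G0 \<Longrightarrow> b \<in> pts G0 \<Longrightarrow> c \<in> pts G0 \<Longrightarrow> m0 (m0 a b) c = m0 a (m0 b c)"
  using lie_groupoidD(14)[OF lie_h1] lie_groupoidD(14)[OF lie_h0] by simp_all

lemma structure_maps [simp]:
  "u e0 = e1" "g \<in> pts G1 \<Longrightarrow> s (ih g) = i0 (s g)" "g \<in> pts G1 \<Longrightarrow> t (ih g) = i0 (t g)" "s e1 = e0" "t e1 = e0"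
  "a \<in> pts G0 \<Longrightarrow> ih (u a) = u (i0 a)"
  "g \<in> pts G1 \<Longrightarrow> h \<in> pts G1 \<Longrightarrow> s (mh g h) = m0 (s g) (s h)" "g \<in> pts G1 \<Longrightarrow> h \<in> pts G1 \<Longrightarrow> t (mh g h) = m0 (t g) (t h)"
  "a \<in> pts G0 \<Longrightarrow> b \<in> pts G0 \<Longrightarrow> mh (u a) (u b) = u (m0 a b)"
  and interchange:
  "g \<in> pts G1 \<Longrightarrow> g' \<in> pts G1 \<Longrightarrow> h \<in> pts G1 \<Longrightarrow> h' \<in> pts G1 \<Longrightarrow> s g = t g' \<Longrightarrow> s h = t h' \<Longrightarrow>
     mh (mv g g') (mv h h') = mv (mh g h) (mh g' h')"
proof -
  have "hor_structure_maps_morphisms G" using double by (simp add: double_lie_groupoid_def)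
  then have *: "groupoid_morphism (unit_groupoid point_manifold) (ver1 G) (one (hor1 G)) (one (hor0 G))"
    "groupoid_morphism (ver1 G) (ver1 G) ih i0"
    "\<forall>g\<in>pts G1. \<forall>h\<in>pts G1. s (mh g h) = m0 (s g) (s h) \<and> t (mh g h) = m0 (t g) (t h)"
    "\<forall>x\<in>pts G0. \<forall>y\<in>pts G0. u (m0 x y) = mh (u x) (u y)"
    "\<forall>g\<in>pts G1. \<forall>g'\<in>pts G1. \<forall>h\<in>pts G1. \<forall>h'\<in>pts G1. s g = t g' \<and> s h = t h' \<longrightarrow>
      mh (mv g g') (mv h h') = mv (mh g h) (mh g' h')"
    unfolding hor_structure_maps_morphisms_def ver0 carriers simp_thms unit_eq by - (elim conjE; assumption)+
  show e: "u e0 = e1" using *(1) by (simp add: groupoid_morphism_def point_manifold(2))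
  show "s e1 = e0" "t e1 = e0" using V_laws(1,2)[of e0] closed(8) unfolding e by simp_all
  show "g \<in> pts G1 \<Longrightarrow> s (ih g) = i0 (s g)" "g \<in> pts G1 \<Longrightarrow> t (ih g) = i0 (t g)"
    "a \<in> pts G0 \<Longrightarrow> ih (u a) = u (i0 a)" using *(2) by (simp_all add: groupoid_morphism_def)
  show "g \<in> pts G1 \<Longrightarrow> h \<in> pts G1 \<Longrightarrow> s (mh g h) = m0 (s g) (s h)" "g \<in> pts G1 \<Longrightarrow> h \<in> pts G1 \<Longrightarrow> t (mh g h) = m0 (t g) (t h)"
    using *(3) by blast+
  show "a \<in> pts G0 \<Longrightarrow> b \<in> pts G0 \<Longrightarrow> mh (u a) (u b) = u (m0 a b)" using *(4) by simp
  show "g \<in> pts G1 \<Longrightarrow> g' \<in> pts G1 \<Longrightarrow> h \<in> pts G1 \<Longrightarrow> h' \<in> pts G1 \<Longrightarrow> s g = t g' \<Longrightarrow> s h = t h' \<Longrightarrow>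
     mh (mv g g') (mv h h') = mv (mh g h) (mh g' h')" using *(5) by blast
qed

text \<open>Inversion in the groupoid is a homomorphism of the group G_1, not an antihomomorphism.
  This is contained in the transposed half of the axioms of a double groupoid.\<close>

lemma iv_mh:
  assumes "g \<in> pts G1" "h \<in> pts G1"
  shows "iv (mh g h) = mh (iv g) (iv h)"
proof -
  have "hor_structure_maps_morphisms (transpose_dg G)" using double by (simp add: double_lie_groupoid_def)
  then have "groupoid_morphism (hor1 G) (hor1 G) iv (ivr (ver0 G))"
    unfolding hor_structure_maps_morphisms_def transpose_dg_def by simp
  then show ?thesis using assms by (simp add: groupoid_morphism_def)
qed

section \<open>The action of the 2-group on P\<close>

lemma act1: "left_action (hor1 G) P1 (\<lambda>_. ()) act1" and act0: "left_action (hor0 G) P0 (\<lambda>_. ()) act0"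
  and pi_sub: "surj_submersion P0 M \<pi>" and pi_src: "surj_submersion P1 M (\<lambda>p. \<pi> (sp p))"
  and pb1: "principal_left_bundle (hor1 G) P1 (\<lambda>_. ()) act1 M (\<lambda>p. \<pi> (sp p))"
  and pb0: "principal_left_bundle (hor0 G) P0 (\<lambda>_. ()) act0 M \<pi>"
  using principal by (auto simp: principal_2_bundle_def principal_left_bundle_def)

lemma act_closed [simp]:
  "g \<in> pts G1 \<Longrightarrow> p \<in> pts P1 \<Longrightarrow> act1 g p \<in> pts P1" "a \<in> pts G0 \<Longrightarrow> x \<in> pts P0 \<Longrightarrow> act0 a x \<in> pts P0"
  using left_action_in[OF act1] left_action_in[OF act0] by simp_all

lemma act_laws [simp]:
  "p \<in> pts P1 \<Longrightarrow> act1 e1 p = p" "x \<in> pts P0 \<Longrightarrow> act0 e0 x = x"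
  "g \<in> pts G1 \<Longrightarrow> h \<in> pts G1 \<Longrightarrow> p \<in> pts P1 \<Longrightarrow> act1 g (act1 h p) = act1 (mh g h) p"
  "a \<in> pts G0 \<Longrightarrow> b \<in> pts G0 \<Longrightarrow> x \<in> pts P0 \<Longrightarrow> act0 a (act0 b x) = act0 (m0 a b) x"
  using left_actionD(4,5)[OF act1] left_actionD(4,5)[OF act0] by simp_all

lemma act_morphism [simp]:
  "g \<in> pts G1 \<Longrightarrow> p \<in> pts P1 \<Longrightarrow> sp (act1 g p) = act0 (s g) (sp p)"
  "g \<in> pts G1 \<Longrightarrow> p \<in> pts P1 \<Longrightarrow> tp (act1 g p) = act0 (t g) (tp p)"
  "a \<in> pts G0 \<Longrightarrow> x \<in> pts P0 \<Longrightarrow> act1 (u a) (pu x) = pu (act0 a x)"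
  using principal unfolding principal_2_bundle_def left_action_morphism_def by simp_all

lemma act_mul:
  "g \<in> pts G1 \<Longrightarrow> g' \<in> pts G1 \<Longrightarrow> p \<in> pts P1 \<Longrightarrow> p' \<in> pts P1 \<Longrightarrow> s g = t g' \<Longrightarrow> sp p = tp p' \<Longrightarrow>
     mp (act1 g p) (act1 g' p') = act1 (mv g g') (mp p p')"
  using principal unfolding principal_2_bundle_def left_action_morphism_def by simp

lemma pi_tgt [simp]: "p \<in> pts P1 \<Longrightarrow> \<pi> (tp p) = \<pi> (sp p)"
  using principal by (simp add: principal_2_bundle_def)

lemma pi_act [simp]: "a \<in> pts G0 \<Longrightarrow> x \<in> pts P0 \<Longrightarrow> \<pi> (act0 a x) = \<pi> x"
  using pb0 by (simp add: principal_left_bundle_def)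

text \<open>The unit 1_a composed with itself is 1_a, so each element of G_0 acts on P by a groupoid
  automorphism.\<close>

lemma act_mul_u: "a \<in> pts G0 \<Longrightarrow> p \<in> pts P1 \<Longrightarrow> p' \<in> pts P1 \<Longrightarrow> sp p = tp p' \<Longrightarrow>
     act1 (u a) (mp p p') = mp (act1 (u a) p) (act1 (u a) p')"
  using act_mul[of "u a" "u a" p p'] V_laws(5)[of "u a"] by simp

lemma act_ip: "g \<in> pts G1 \<Longrightarrow> p \<in> pts P1 \<Longrightarrow> ip (act1 g p) = act1 (iv g) (ip p)"
  by (rule groupoid_inverse_unique[OF lie_P, symmetric]) (simp_all add: act_mul)

text \<open>Combines g = g 1_(s g) = 1_(t g) g with p = 1 p = p 1 in the morphism property of the
  action. Together the two equations carry a factor from the left of p to its right, which links the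
  two forms of the second prescribed value.\<close>

lemma act_decompose:
  assumes "g \<in> pts G1" "p \<in> pts P1"
  shows "mp (act1 g (pu (tp p))) (act1 (u (s g)) p) = act1 g p"
    "mp (act1 (u (t g)) p) (act1 g (pu (sp p))) = act1 g p"
  using assms act_mul[of g "u (s g)" "pu (tp p)" p] act_mul[of "u (t g)" g p "pu (sp p)"] by simp_all

lemma act0_cancel: "a \<in> pts G0 \<Longrightarrow> x \<in> pts P0 \<Longrightarrow> y \<in> pts P0 \<Longrightarrow> act0 (i0 a) x = y \<longleftrightarrow> x = act0 a y"
  using act_laws(4)[of a "i0 a" x] act_laws(4)[of "i0 a" a y] by auto

text \<open>The division map of the principal G_1-bundle P_1 over M, fixed once by choice so that it
  can occur in explicit formulas for charts and inverses; \<open>dv0\<close> is its counterpart for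
  P_0.\<close>

definition dv1 :: "'p1 \<Rightarrow> 'p1 \<Rightarrow> 'g1" where
  "dv1 = (SOME \<delta>. smooth_map (fibre_product P1 (\<lambda>p. \<pi> (sp p)) M (\<lambda>p. \<pi> (sp p)) P1) G1 (\<lambda>(p, q). \<delta> p q) \<and>
    (\<forall>p\<in>pts P1. \<forall>q\<in>pts P1. \<pi> (sp p) = \<pi> (sp q) \<longrightarrow> \<delta> p q \<in> pts G1 \<and> act1 (\<delta> p q) q = p) \<and>
    (\<forall>g\<in>pts G1. \<forall>q\<in>pts P1. \<delta> (act1 g q) q = g))"

definition dv0 :: "'p0 \<Rightarrow> 'p0 \<Rightarrow> 'g0" where
  "dv0 = (SOME \<delta>. smooth_map (fibre_product P0 \<pi> M \<pi> P0) G0 (\<lambda>(p, q). \<delta> p q) \<and>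
    (\<forall>p\<in>pts P0. \<forall>q\<in>pts P0. \<pi> p = \<pi> q \<longrightarrow> \<delta> p q \<in> pts G0 \<and> act0 (\<delta> p q) q = p) \<and>
    (\<forall>g\<in>pts G0. \<forall>q\<in>pts P0. \<delta> (act0 g q) q = g))"

lemma dv1_props:
  "smooth_map (fibre_product P1 (\<lambda>p. \<pi> (sp p)) M (\<lambda>p. \<pi> (sp p)) P1) G1 (\<lambda>(p, q). dv1 p q)"
  "p \<in> pts P1 \<Longrightarrow> q \<in> pts P1 \<Longrightarrow> \<pi> (sp p) = \<pi> (sp q) \<Longrightarrow> dv1 p q \<in> pts G1"
  "p \<in> pts P1 \<Longrightarrow> q \<in> pts P1 \<Longrightarrow> \<pi> (sp p) = \<pi> (sp q) \<Longrightarrow> act1 (dv1 p q) q = p"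
  "g \<in> pts G1 \<Longrightarrow> q \<in> pts P1 \<Longrightarrow> dv1 (act1 g q) q = g"
proof -
  have "\<exists>\<delta>. smooth_map (fibre_product P1 (\<lambda>p. \<pi> (sp p)) M (\<lambda>p. \<pi> (sp p)) P1) G1 (\<lambda>(p, q). \<delta> p q) \<and>
    (\<forall>p\<in>pts P1. \<forall>q\<in>pts P1. \<pi> (sp p) = \<pi> (sp q) \<longrightarrow> \<delta> p q \<in> pts G1 \<and> act1 (\<delta> p q) q = p) \<and>
    (\<forall>g\<in>pts G1. \<forall>q\<in>pts P1. \<delta> (act1 g q) q = g)"
  proof -
    obtain \<delta> where "smooth_map (fibre_product P1 (\<lambda>p. \<pi> (sp p)) M (\<lambda>p. \<pi> (sp p)) P1) (arr (hor1 G)) (\<lambda>(p, q). \<delta> p q)"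
      and "\<And>p q. p \<in> pts P1 \<Longrightarrow> q \<in> pts P1 \<Longrightarrow> \<pi> (sp p) = \<pi> (sp q) \<Longrightarrow>
        \<delta> p q \<in> pts (arr (hor1 G)) \<and> src (hor1 G) (\<delta> p q) = () \<and> act1 (\<delta> p q) q = p"
      and "\<And>g q. g \<in> pts (arr (hor1 G)) \<Longrightarrow> q \<in> pts P1 \<Longrightarrow> src (hor1 G) g = () \<Longrightarrow> \<delta> (act1 g q) q = g"
      by (rule principal_division[OF pb1 lie_h1 manifolds(3,5)], rule that)
    then show ?thesis by (intro exI[of _ \<delta>]) simp
  qed
  from someI_ex[OF this, folded dv1_def]
  show "smooth_map (fibre_product P1 (\<lambda>p. \<pi> (sp p)) M (\<lambda>p. \<pi> (sp p)) P1) G1 (\<lambda>(p, q). dv1 p q)"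
    "p \<in> pts P1 \<Longrightarrow> q \<in> pts P1 \<Longrightarrow> \<pi> (sp p) = \<pi> (sp q) \<Longrightarrow> dv1 p q \<in> pts G1"
    "p \<in> pts P1 \<Longrightarrow> q \<in> pts P1 \<Longrightarrow> \<pi> (sp p) = \<pi> (sp q) \<Longrightarrow> act1 (dv1 p q) q = p"
    "g \<in> pts G1 \<Longrightarrow> q \<in> pts P1 \<Longrightarrow> dv1 (act1 g q) q = g" by blast+
qed

lemma dv0_props:
  "smooth_map (fibre_product P0 \<pi> M \<pi> P0) G0 (\<lambda>(p, q). dv0 p q)"
  "x \<in> pts P0 \<Longrightarrow> y \<in> pts P0 \<Longrightarrow> \<pi> x = \<pi> y \<Longrightarrow> dv0 x y \<in> pts G0"
  "x \<in> pts P0 \<Longrightarrow> y \<in> pts P0 \<Longrightarrow> \<pi> x = \<pi> y \<Longrightarrow> act0 (dv0 x y) y = x"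
  "a \<in> pts G0 \<Longrightarrow> y \<in> pts P0 \<Longrightarrow> dv0 (act0 a y) y = a"
proof -
  have "\<exists>\<delta>. smooth_map (fibre_product P0 \<pi> M \<pi> P0) G0 (\<lambda>(p, q). \<delta> p q) \<and>
    (\<forall>p\<in>pts P0. \<forall>q\<in>pts P0. \<pi> p = \<pi> q \<longrightarrow> \<delta> p q \<in> pts G0 \<and> act0 (\<delta> p q) q = p) \<and>
    (\<forall>g\<in>pts G0. \<forall>q\<in>pts P0. \<delta> (act0 g q) q = g)"
  proof -
    obtain \<delta> where "smooth_map (fibre_product P0 \<pi> M \<pi> P0) (arr (hor0 G)) (\<lambda>(p, q). \<delta> p q)"
      and "\<And>p q. p \<in> pts P0 \<Longrightarrow> q \<in> pts P0 \<Longrightarrow> \<pi> p = \<pi> q \<Longrightarrow>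
        \<delta> p q \<in> pts (arr (hor0 G)) \<and> src (hor0 G) (\<delta> p q) = () \<and> act0 (\<delta> p q) q = p"
      and "\<And>g q. g \<in> pts (arr (hor0 G)) \<Longrightarrow> q \<in> pts P0 \<Longrightarrow> src (hor0 G) g = () \<Longrightarrow> \<delta> (act0 g q) q = g"
      by (rule principal_division[OF pb0 lie_h0 manifolds(4,5)], rule that)
    then show ?thesis by (intro exI[of _ \<delta>]) simp
  qed
  from someI_ex[OF this, folded dv0_def]
  show "smooth_map (fibre_product P0 \<pi> M \<pi> P0) G0 (\<lambda>(p, q). dv0 p q)"
    "x \<in> pts P0 \<Longrightarrow> y \<in> pts P0 \<Longrightarrow> \<pi> x = \<pi> y \<Longrightarrow> dv0 x y \<in> pts G0"
    "x \<in> pts P0 \<Longrightarrow> y \<in> pts P0 \<Longrightarrow> \<pi> x = \<pi> y \<Longrightarrow> act0 (dv0 x y) y = x"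
    "a \<in> pts G0 \<Longrightarrow> y \<in> pts P0 \<Longrightarrow> dv0 (act0 a y) y = a" by blast+
qed

lemma act0_free: "a \<in> pts G0 \<Longrightarrow> b \<in> pts G0 \<Longrightarrow> x \<in> pts P0 \<Longrightarrow> act0 a x = act0 b x \<Longrightarrow> a = b"
  using dv0_props(4) by metis

subsection \<open>Smoothness of composite maps\<close>

text \<open>Introduction rules closed under all structure maps: smoothness of a composite follows
  its syntax, and the only side conditions left over are the composability conditions in P.\<close>

lemma smooth_ops:
  assumes Z: "is_manifold Z"
  shows "smooth_map Z G1 g \<Longrightarrow> smooth_map Z G0 (\<lambda>z. s (g z))"
    "smooth_map Z G1 g \<Longrightarrow> smooth_map Z G0 (\<lambda>z. t (g z))"
    "smooth_map Z G0 a \<Longrightarrow> smooth_map Z G1 (\<lambda>z. u (a z))"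
    "smooth_map Z G1 g \<Longrightarrow> smooth_map Z G1 (\<lambda>z. iv (g z))"
    "smooth_map Z G1 g \<Longrightarrow> smooth_map Z G1 (\<lambda>z. ih (g z))"
    "smooth_map Z G0 a \<Longrightarrow> smooth_map Z G0 (\<lambda>z. i0 (a z))"
    "smooth_map Z P1 p \<Longrightarrow> smooth_map Z P0 (\<lambda>z. sp (p z))"
    "smooth_map Z P1 p \<Longrightarrow> smooth_map Z P0 (\<lambda>z. tp (p z))"
    "smooth_map Z P0 x \<Longrightarrow> smooth_map Z P1 (\<lambda>z. pu (x z))"
    "smooth_map Z P1 p \<Longrightarrow> smooth_map Z P1 (\<lambda>z. ip (p z))"
    "smooth_map Z (prod_manifold G0 P1) w \<Longrightarrow> smooth_map Z G0 (\<lambda>z. fst (w z))"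
    "smooth_map Z (prod_manifold G0 P1) w \<Longrightarrow> smooth_map Z P1 (\<lambda>z. snd (w z))"
    "smooth_map Z G1 g \<Longrightarrow> smooth_map Z G1 h \<Longrightarrow> smooth_map Z G1 (\<lambda>z. mh (g z) (h z))"
    "smooth_map Z G0 a \<Longrightarrow> smooth_map Z G0 b \<Longrightarrow> smooth_map Z G0 (\<lambda>z. m0 (a z) (b z))"
    "smooth_map Z P1 p \<Longrightarrow> smooth_map Z P1 q \<Longrightarrow> (\<And>z. z \<in> pts Z \<Longrightarrow> sp (p z) = tp (q z)) \<Longrightarrow> smooth_map Z P1 (\<lambda>z. mp (p z) (q z))"
    "smooth_map Z G1 g \<Longrightarrow> smooth_map Z P1 p \<Longrightarrow> smooth_map Z P1 (\<lambda>z. act1 (g z) (p z))"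
    "smooth_map Z G0 a \<Longrightarrow> smooth_map Z P0 x \<Longrightarrow> smooth_map Z P0 (\<lambda>z. act0 (a z) (x z))"
    "smooth_map Z G0 a \<Longrightarrow> smooth_map Z P1 p \<Longrightarrow> smooth_map Z (prod_manifold G0 P1) (\<lambda>z. (a z, p z))"
  subgoal by (rule smooth_map_compose[OF Z manifolds(1,2) _ lie_groupoidD(5)[OF lie_v, simplified]])
  subgoal by (rule smooth_map_compose[OF Z manifolds(1,2) _ lie_groupoidD(6)[OF lie_v, simplified]])
  subgoal by (rule smooth_map_compose[OF Z manifolds(2,1) _ lie_groupoidD(7)[OF lie_v, simplified]])
  subgoal by (rule smooth_map_compose[OF Z manifolds(1,1) _ lie_groupoidD(8)[OF lie_v]])
  subgoal by (rule smooth_map_compose[OF Z manifolds(1,1) _ lie_groupoidD(8)[OF lie_h1, simplified]])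
  subgoal by (rule smooth_map_compose[OF Z manifolds(2,2) _ lie_groupoidD(8)[OF lie_h0]])
  subgoal by (rule smooth_map_compose[OF Z manifolds(3,4) _ lie_groupoidD(5)[OF lie_P]])
  subgoal by (rule smooth_map_compose[OF Z manifolds(3,4) _ lie_groupoidD(6)[OF lie_P]])
  subgoal by (rule smooth_map_compose[OF Z manifolds(4,3) _ lie_groupoidD(7)[OF lie_P]])
  subgoal by (rule smooth_map_compose[OF Z manifolds(3,3) _ lie_groupoidD(8)[OF lie_P]])
  subgoal by (rule smooth_map_compose[OF Z is_manifold_prod[OF manifolds(2,3)] manifolds(2) _ smooth_map_fst_snd(1)[OF manifolds(2,3)]])
  subgoal by (rule smooth_map_compose[OF Z is_manifold_prod[OF manifolds(2,3)] manifolds(3) _ smooth_map_fst_snd(2)[OF manifolds(2,3)]])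
  subgoal using smooth_map_mul[OF lie_h1 Z] by simp
  subgoal using smooth_map_mul[OF lie_h0 Z] by simp
  subgoal using smooth_map_mul[OF lie_P Z] by simp
  subgoal using smooth_map_left_action[OF act1 lie_h1 manifolds(3) Z] by simp
  subgoal using smooth_map_left_action[OF act0 lie_h0 manifolds(4) Z] by simp
  subgoal by (rule smooth_map_pair[OF Z manifolds(2,3)])
  done

lemma smooth_dv:
  assumes Z: "is_manifold Z"
  shows "smooth_map Z P1 p \<Longrightarrow> smooth_map Z P1 q \<Longrightarrow> (\<And>z. z \<in> pts Z \<Longrightarrow> \<pi> (sp (p z)) = \<pi> (sp (q z))) \<Longrightarrow> smooth_map Z G1 (\<lambda>z. dv1 (p z) (q z))"
    "smooth_map Z P0 x \<Longrightarrow> smooth_map Z P0 y \<Longrightarrow> (\<And>z. z \<in> pts Z \<Longrightarrow> \<pi> (x z) = \<pi> (y z)) \<Longrightarrow> smooth_map Z G0 (\<lambda>z. dv0 (x z) (y z))"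
  using smooth_map_fibre_apply[OF transversal_self[OF manifolds(3,5)] manifolds(1) dv1_props(1) Z]
    smooth_map_fibre_apply[OF transversal_self[OF manifolds(4,5)] manifolds(2) dv0_props(1) Z]
    pi_sub pi_src by (simp_all add: surj_submersion_def)

subsection \<open>The associated bundle gerbe\<close>

abbreviation "Q \<equiv> gerbe_groupoid G P act1 act0"
abbreviation "Q1 \<equiv> prod_manifold G0 P1"

lemma Q_simps [simp]:
  "arr Q = Q1" "obj Q = P0" "src Q = (\<lambda>(a, x). act0 (i0 a) (sp x))" "tgt Q = (\<lambda>(a, x). tp x)"
  "one Q = (\<lambda>x. (e0, pu x))" "ivr Q = (\<lambda>(a, x). (i0 a, act1 (u (i0 a)) (ip x)))"
  "mul Q = (\<lambda>(a, x) (b, y). (m0 a b, mp x (act1 (u a) y)))"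
  by (simp_all add: gerbe_groupoid_def)

lemma Q1_manifold: "is_manifold Q1" by (rule is_manifold_prod[OF manifolds(2,3)])

text \<open>Turns composability in Q, or of Q with the centre, into the condition under which x can
  be multiplied in P by an element translated by a.\<close>

lemma src_Q_iff: "a \<in> pts G0 \<Longrightarrow> x \<in> pts P1 \<Longrightarrow> y \<in> pts P0 \<Longrightarrow> act0 (i0 a) (sp x) = y \<longleftrightarrow> sp x = act0 a y"
  by (simp add: act0_cancel)

text \<open>Since ^(a^-1) s(x) = s(^(a^-1) x), this change of variables turns the source map of Q
  into the source map of P after the second projection. It recurs for the map to P_0 \<times>_M
  P_0.\<close>

lemma Q1_shear: "diffeomorphism Q1 Q1 (\<lambda>w. (fst w, act1 (u (i0 (fst w))) (snd w)))"
  by (rule diffeomorphismI[where g = "\<lambda>w. (fst w, act1 (u (fst w)) (snd w))"])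
    (auto intro!: smooth_ops smooth_map_id Q1_manifold)

lemma src_Q_submersion: "submersion Q1 P0 (src Q)"
proof -
  have "submersion Q1 P0 (\<lambda>w. sp (snd ((fst w, act1 (u (i0 (fst w))) (snd w)))))"
    by (rule submersion_compose[OF Q1_manifold Q1_manifold manifolds(4) submersion_diffeomorphism[OF Q1_manifold Q1_manifold Q1_shear]
      submersion_compose[OF Q1_manifold manifolds(3,4) submersion_snd[OF manifolds(2,3)] lie_groupoidD(3)[OF lie_P]]])
  then show ?thesis by (rule submersion_cong[OF Q1_manifold manifolds(4)]) auto
qed

lemma tgt_Q_submersion: "submersion Q1 P0 (tgt Q)"
  using submersion_compose[OF Q1_manifold manifolds(3,4) submersion_snd[OF manifolds(2,3)] lie_groupoidD(4)[OF lie_P]]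
  by (simp add: case_prod_unfold)

text \<open>Q is the semidirect product of P with the group G_0 acting by automorphisms.
  Associativity is that of P and G_0 together with \<open>act_mul_u\<close>.\<close>

lemma lie_Q: "lie_groupoid Q"
proof -
  have tr: "transversal Q1 (src Q) P0 (tgt Q) Q1"
    using src_Q_submersion tgt_Q_submersion Q1_manifold manifolds(4) by (simp add: transversal_def submersionD)
  note F = fibre_product_manifold[OF tr]
  note pr = fibre_product_fst[OF tr] fibre_product_snd[OF tr]
  have "smooth_map (fibre_product Q1 (src Q) P0 (tgt Q) Q1) Q1
    (\<lambda>z. (m0 (fst (fst z)) (fst (snd z)), mp (snd (fst z)) (act1 (u (fst (fst z))) (snd (snd z)))))"
    by (intro smooth_ops F pr) (auto simp: pts_fibre_product src_Q_iff)
  then have mul: "smooth_map (fibre_product Q1 (src Q) P0 (tgt Q) Q1) Q1 (\<lambda>(g, h). mul Q g h)"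
    by (simp add: case_prod_unfold)
  have one: "smooth_map P0 Q1 (\<lambda>x. (e0, pu x))"
    by (intro smooth_ops manifolds smooth_map_id smooth_map_const closed)
  have "smooth_map Q1 Q1 (\<lambda>w. (i0 (fst w), act1 (u (i0 (fst w))) (ip (snd w))))"
    by (intro smooth_ops Q1_manifold smooth_map_id)
  then have inv: "smooth_map Q1 Q1 (ivr Q)" by (simp add: case_prod_unfold)
  have s1: "src Q ` pts Q1 = pts P0"
  proof -
    have "x \<in> src Q ` pts Q1" if "x \<in> pts P0" for x
      using that by (intro image_eqI[where x = "(e0, pu x)"]) auto
    then show ?thesis using smooth_map_in[OF submersionD[OF src_Q_submersion]] by blast
  qed
  have s2: "tgt Q ` pts Q1 = pts P0"
  proof -
    have "x \<in> tgt Q ` pts Q1" if "x \<in> pts P0" for x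
      using that by (intro image_eqI[where x = "(e0, pu x)"]) auto
    then show ?thesis using smooth_map_in[OF submersionD[OF tgt_Q_submersion]] by blast
  qed
  have mulS: "src Q (mul Q g h) = src Q h \<and> tgt Q (mul Q g h) = tgt Q g"
    if "g \<in> pts Q1" "h \<in> pts Q1" "src Q g = tgt Q h" for g h
    using that by (auto simp: src_Q_iff)
  have assoc: "mul Q (mul Q g h) k = mul Q g (mul Q h k)"
    if "g \<in> pts Q1" "h \<in> pts Q1" "k \<in> pts Q1" "src Q g = tgt Q h" "src Q h = tgt Q k" for g h k
    using that by (auto simp: src_Q_iff G0_assoc P_assoc act_mul_u)
  have unit: "mul Q g (one Q (src Q g)) = g" "mul Q (one Q (tgt Q g)) g = g" if "g \<in> pts Q1" for g
    using that by auto
  have invl: "src Q (ivr Q g) = tgt Q g" "tgt Q (ivr Q g) = src Q g" "mul Q g (ivr Q g) = one Q (tgt Q g)"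
    "mul Q (ivr Q g) g = one Q (src Q g)" if "g \<in> pts Q1" for g
    using that by (auto simp: act_mul_u[symmetric])
  show ?thesis
    unfolding lie_groupoid_def surj_submersion_def
  proof (intro conjI)
    show "\<forall>g\<in>pts (arr Q). \<forall>h\<in>pts (arr Q). \<forall>k\<in>pts (arr Q). src Q g = tgt Q h \<and> src Q h = tgt Q k \<longrightarrow>
        mul Q (mul Q g h) k = mul Q g (mul Q h k)" using assoc by (metis Q_simps(1))
    show "\<forall>g\<in>pts (arr Q). \<forall>h\<in>pts (arr Q). src Q g = tgt Q h \<longrightarrow>
        src Q (mul Q g h) = src Q h \<and> tgt Q (mul Q g h) = tgt Q g" using mulS by (metis Q_simps(1))
    show "smooth_map (fibre_product (arr Q) (src Q) (obj Q) (tgt Q) (arr Q)) (arr Q) (\<lambda>(g, h). mul Q g h)"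
      using mul by (simp only: Q_simps(1,2))
    show "\<forall>g\<in>pts (arr Q). mul Q g (one Q (src Q g)) = g \<and> mul Q (one Q (tgt Q g)) g = g"
      using unit by (metis Q_simps(1))
    show "\<forall>g\<in>pts (arr Q). src Q (ivr Q g) = tgt Q g \<and> tgt Q (ivr Q g) = src Q g \<and>
        mul Q g (ivr Q g) = one Q (tgt Q g) \<and> mul Q (ivr Q g) g = one Q (src Q g)"
      using invl by (metis Q_simps(1))
    show "\<forall>x\<in>pts (obj Q). src Q (one Q x) = x \<and> tgt Q (one Q x) = x" by simp
    show "smooth_map (obj Q) (arr Q) (one Q)" using one by simp
    show "smooth_map (arr Q) (arr Q) (ivr Q)" using inv by (simp only: Q_simps(1,2))
    show "src Q ` pts (arr Q) = pts (obj Q)" "tgt Q ` pts (arr Q) = pts (obj Q)"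
      using s1 s2 by (simp_all only: Q_simps(1,2))
    show "submersion (arr Q) (obj Q) (src Q)" "submersion (arr Q) (obj Q) (tgt Q)"
      using src_Q_submersion tgt_Q_submersion by (simp_all only: Q_simps(1,2))
  qed (simp_all add: Q1_manifold manifolds del: prod_manifold_simps)
qed

subsection \<open>The actions on the centre\<close>

text \<open>Multiplication from the right by inverses is a left action, because inversion reverses
  products.\<close>

lemma alpha_V_action: "left_action P P1 sp (alpha_V P)"
proof -
  have tr: "transversal P1 sp P0 sp P1" by (rule transversal_self[OF manifolds(3,4) lie_groupoidD(3)[OF lie_P]])
  have "smooth_map (fibre_product P1 sp P0 sp P1) P1 (\<lambda>z. mp (snd z) (ip (fst z)))"
    by (intro smooth_ops fibre_product_manifold[OF tr] fibre_product_fst[OF tr] fibre_product_snd[OF tr])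
      (auto simp: pts_fibre_product)
  then show ?thesis
    unfolding left_action_def alpha_V_def
    by (auto simp: case_prod_unfold lie_groupoidD(5)[OF lie_P] groupoid_inverse_props(3)[OF lie_P] P_assoc)
qed

lemma alpha_V_principal: "principal_left_bundle P P1 sp (alpha_V P) P0 tp"
\<comment> \<open>The division map solves z = y x^-1 for x.\<close>
proof (rule principal_left_bundleI[OF lie_P manifolds(3,4) alpha_V_action lie_groupoid_surj(2)[OF lie_P],
      where \<delta> = "\<lambda>z y. mp (ip z) y"])
  have tr: "transversal P1 tp P0 tp P1" by (rule transversal_self[OF manifolds(3,4) lie_groupoidD(4)[OF lie_P]])
  show "smooth_map (fibre_product P1 tp P0 tp P1) P1 (\<lambda>z. mp (ip (fst z)) (snd z))"
    by (intro smooth_ops fibre_product_manifold[OF tr] fibre_product_fst[OF tr] fibre_product_snd[OF tr])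
      (auto simp: pts_fibre_product)
qed (auto simp: alpha_V_def groupoid_inverse_props(3)[OF lie_P])

definition aH :: "'g0 \<times> 'p1 \<Rightarrow> 'p1 \<Rightarrow> 'p1" where
  "aH w p = mp (snd w) (act1 (u (fst w)) p)"

lemma aH_action: "left_action Q P1 tp aH"
proof -
  have tr: "transversal Q1 (src Q) P0 tp P1"
    using src_Q_submersion Q1_manifold manifolds lie_groupoidD(6)[OF lie_P] by (simp add: transversal_def)
  have "smooth_map (fibre_product Q1 (src Q) P0 tp P1) P1 (\<lambda>z. mp (snd (fst z)) (act1 (u (fst (fst z))) (snd z)))"
    by (intro smooth_ops fibre_product_manifold[OF tr] fibre_product_fst[OF tr] fibre_product_snd[OF tr])
      (auto simp: pts_fibre_product src_Q_iff)
  then have 1: "smooth_map (fibre_product (arr Q) (src Q) (obj Q) tp P1) P1 (\<lambda>(y, p). aH y p)"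
    by (simp add: aH_def case_prod_unfold)
  show ?thesis
    unfolding left_action_def
  proof (intro conjI 1 ballI impI)
    show "smooth_map P1 (obj Q) tp" using lie_groupoidD(6)[OF lie_P] by simp
    show "tp (aH q p) = tgt Q q" if "q \<in> pts (arr Q)" "p \<in> pts P1" "src Q q = tp p" for q p
      using that by (auto simp: aH_def src_Q_iff)
    show "aH (one Q (tp p)) p = p" if "p \<in> pts P1" for p
      using that by (simp add: aH_def)
    show "aH (mul Q q q') p = aH q (aH q' p)" if "q \<in> pts (arr Q)" "q' \<in> pts (arr Q)" "p \<in> pts P1"
      "src Q q = tgt Q q' \<and> src Q q' = tp p" for q q' p
      using that by (auto simp: aH_def src_Q_iff P_assoc act_mul_u)
  qed
qed

lemma aH_principal: "principal_left_bundle Q P1 tp aH M (\<lambda>p. \<pi> (tp p))"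
\<comment> \<open>To solve y = x (^a p) for \<open>(a, x)\<close>: comparing sources gives s(y) = ^a
  s(p), which determines a by division in P_0, and then x = y (^a p)^-1.\<close>
proof (rule principal_left_bundleI[OF lie_Q manifolds(3,5) aH_action,
      where \<delta> = "\<lambda>y p. (dv0 (sp y) (sp p), mp y (ip (act1 (u (dv0 (sp y) (sp p))) p)))"])
  show sub: "surj_submersion P1 M (\<lambda>p. \<pi> (tp p))"
    by (rule surj_submersion_cong[OF manifolds(3,5) pi_src]) simp
  then have tr: "transversal P1 (\<lambda>p. \<pi> (tp p)) M (\<lambda>p. \<pi> (tp p)) P1"
    using transversal_self[OF manifolds(3,5)] by (simp add: surj_submersion_def)
  have "smooth_map (fibre_product P1 (\<lambda>p. \<pi> (tp p)) M (\<lambda>p. \<pi> (tp p)) P1) Q1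
     (\<lambda>z. (dv0 (sp (fst z)) (sp (snd z)), mp (fst z) (ip (act1 (u (dv0 (sp (fst z)) (sp (snd z)))) (snd z)))))"
    by (intro smooth_ops smooth_dv fibre_product_manifold[OF tr] fibre_product_fst[OF tr] fibre_product_snd[OF tr])
      (auto simp: pts_fibre_product dv0_props)
  then show "smooth_map (fibre_product P1 (\<lambda>p. \<pi> (tp p)) M (\<lambda>p. \<pi> (tp p)) P1) (arr Q)
     (\<lambda>z. (dv0 (sp (fst z)) (sp (snd z)), mp (fst z) (ip (act1 (u (dv0 (sp (fst z)) (sp (snd z)))) (snd z)))))"
    by simp
  show "\<pi> (tp (aH q p)) = \<pi> (tp p)" if "q \<in> pts (arr Q)" "p \<in> pts P1" "src Q q = tp p" for q p
    using that by (auto simp: aH_def src_Q_iff)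
  show "src Q (dv0 (sp y) (sp p), mp y (ip (act1 (u (dv0 (sp y) (sp p))) p))) = tp p \<and>
      aH (dv0 (sp y) (sp p), mp y (ip (act1 (u (dv0 (sp y) (sp p))) p))) p = y"
    if "y \<in> pts P1" "p \<in> pts P1" "\<pi> (tp y) = \<pi> (tp p)" for y p
    using that by (simp add: aH_def src_Q_iff dv0_props)
  show "(dv0 (sp (aH q p)) (sp p), mp (aH q p) (ip (act1 (u (dv0 (sp (aH q p)) (sp p))) p))) = q"
    if "q \<in> pts (arr Q)" "p \<in> pts P1" "src Q q = tp p" for q p
    using that by (auto simp: aH_def src_Q_iff dv0_props)
qed

text \<open>The element written \<open>(k\<inverse>, \<partial>(k))\<close> is the inverse of \<open>k\<close> in the groupoid \<open>G\<^sub>1 \<rightrightarrows> G\<^sub>0\<close>.\<close>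

lemma cm_pair_inverse:
  assumes k: "k \<in> pts G1" "s k = e0"
  shows "cm_pair G (ih k) (cm_bd G k) = iv k"
proof -
  let ?w = "mh (ih k) (u (t k))"
  have "mv ?w k = mv ?w (mh e1 k)" using k by simp
  \<comment> \<open>Interchange separates the factors: k^-1 meets only a unit and 1_\<partial>(k)
    meets only k, so the group product k^-1 k remains.\<close>
  also have "\<dots> = mh (mv (ih k) e1) (mv (u (t k)) k)"
    using k by (intro interchange[symmetric]) simp_all
  also have "mv (ih k) e1 = ih k" using V_laws(5)[of "ih k"] k by simp
  finally have wk: "mv ?w k = u (s k)" using k by simp
  have "iv k = mv (mv ?w k) (iv k)" unfolding wk using k V_laws(6)[of "iv k"] by simp
  also have "\<dots> = ?w" using k by simp
  finally show ?thesis by (simp add: cm_pair_def cm_bd_def)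
qed

lemma cm_part_props:
  assumes g: "g \<in> pts G1"
  shows "cm_part G g \<in> pts G1" "s (cm_part G g) = e0" "t (cm_part G g) = m0 (t g) (i0 (s g))"
    "mh (cm_part G g) (u (s g)) = g"
  using g H_assoc[of g "u (i0 (s g))" "u (s g)"] by (simp_all add: cm_part_def)

lemma cm_ker_iff: "k \<in> cm_ker G \<longleftrightarrow> k \<in> pts G1 \<and> s k = e0"
  by (simp add: cm_ker_def)

text \<open>In the first case r is the unit at ^g t(p). In the second, \<partial>(k) is the source
  of the vertical inverse of k and the group unit is its target, so the two decompositions give
  (^(iv k) 1)(^\<partial>(k) p) = ^(iv k) p = p (^(iv k) 1); the last factor is the inverse of ^k
  1.\<close>

lemma aH_cases: "alpha_H_cases G P act1 act0 aH"
  unfolding alpha_H_cases_def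
proof (intro ballI impI conjI)
  fix g r p assume g: "g \<in> pts G0" and r: "r \<in> pts P1" and p: "p \<in> pts P1" and "src Q (g, r) = tp p"
  then have src: "sp r = act0 g (tp p)" by (simp add: src_Q_iff)
  show "aH (g, r) p = act1 (u g) p" if "r = act1 (u g) (pu (tp p))"
    using that g p P_laws(6)[of "act1 (u g) p"] by (simp add: aH_def)
  fix k assume "k \<in> cm_ker G" and eq: "g = cm_bd G k \<and> r = act1 (cm_pair G (ih k) (cm_bd G k)) (pu (tp p))"
  then have k: "k \<in> pts G1" "s k = e0" by (simp_all add: cm_ker_iff)
  have g_eq: "g = t k" and r_eq: "r = act1 (iv k) (pu (tp p))"
    using eq unfolding cm_pair_inverse[OF k] by (simp_all add: cm_bd_def)
  have "aH (g, r) p = act1 (iv k) p"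
    using act_decompose(1)[of "iv k" p] k p by (simp add: aH_def g_eq r_eq)
  also have "\<dots> = mp p (act1 (iv k) (pu (sp p)))"
    using act_decompose(2)[of "iv k" p] k p by simp
  also have "\<dots> = mp p (ip (act1 (cm_pair G k e0) (pu (sp p))))"
    using k p by (simp add: act_ip cm_pair_def)
  finally show "aH (g, r) p = mp p (ip (act1 (cm_pair G k e0) (pu (sp p))))" .
qed

text \<open>Every element of \<open>Q\<^sub>1\<close> is a product of the two kinds of elements on which \<open>\<alpha>\<^sub>H\<close> is prescribed.\<close>

lemma alpha_H_unique:
  assumes b1: "left_action Q P1 tp \<beta>" "alpha_H_cases G P act1 act0 \<beta>"
    and b2: "left_action Q P1 tp \<beta>'" "alpha_H_cases G P act1 act0 \<beta>'"
    and q: "q \<in> pts Q1" and p: "p \<in> pts P1" and src: "src Q q = tp p"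
  shows "\<beta> q p = \<beta>' q p"
proof -
  obtain a x where q_eq: "q = (a, x)" and a: "a \<in> pts G0" and x: "x \<in> pts P1" using q by auto
  define w where "w = tp p"
  have w: "w \<in> pts P0" using p by (simp add: w_def)
  have spx: "sp x = act0 a w" using src a x p by (simp add: q_eq w_def src_Q_iff)
  then have "\<pi> (sp x) = \<pi> (sp (pu w))" using a w by simp
  then obtain g where g: "g \<in> pts G1" "act1 g (pu w) = x"
    using dv1_props(2,3)[of x "pu w"] x w by auto
  have sg: "s g = a"
    by (rule act0_free[of _ _ w]) (use g a w spx in auto)
  \<comment> \<open>Chosen so that (iv k) 1_b = g in the group: since iv k = k^-1 1_\<partial>(k),
    this requires k^-1 to be the K-part of g and \<partial>(k) b = a.\<close>
  define k where "k = ih (cm_part G g)"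
  define b where "b = m0 (i0 (t k)) a"
  define y where "y = act0 b w"
  have k: "k \<in> pts G1" "s k = e0" using cm_part_props[OF g(1)] by (simp_all add: k_def)
  have b: "b \<in> pts G0" "m0 (t k) b = a" using k a by (simp_all add: b_def)
  have y: "y \<in> pts P0" using b w by (simp add: y_def)
  have ivk: "iv k = mh (ih k) (u (t k))"
    using cm_pair_inverse[OF k] by (simp add: cm_pair_def cm_bd_def)
  have "act1 (iv k) (pu y) = act1 (mh (mh (ih k) (u (t k))) (u b)) (pu w)"
    using k b w act_laws(3)[of "mh (ih k) (u (t k))" "u b" "pu w"] by (simp add: ivk y_def)
  also have "mh (mh (ih k) (u (t k))) (u b) = g"
  proof -
    have "mh (mh (ih k) (u (t k))) (u b) = mh (ih k) (mh (u (t k)) (u b))"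
      using k b by (intro H_assoc) simp_all
    also have "\<dots> = mh (ih k) (u a)" using k b by simp
    also have "\<dots> = g" using cm_part_props(1,4)[OF g(1)] sg by (simp add: k_def)
    finally show ?thesis .
  qed
  finally have x_eq: "act1 (iv k) (pu y) = x" using g(2) by simp
  define q1 where "q1 = (t k, act1 (iv k) (pu y))"
  define q2 where "q2 = (b, act1 (u b) (pu w))"
  have qs: "q1 \<in> pts Q1" "q2 \<in> pts Q1" using k b y w by (simp_all add: q1_def q2_def)
  have prod: "mul Q q1 q2 = q"
    using k b w y P_laws(5)[of x] x by (simp add: q1_def q2_def q_eq x_eq y_def[symmetric] spx act_laws(4)[symmetric])
      (metis act_closed(2) act_laws(4) closed(2) spx y_def)
  have s2: "src Q q2 = tp p" using b w by (simp add: q2_def src_Q_iff w_def[symmetric])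
  have s12: "src Q q1 = tgt Q q2" using k b w y by (simp add: q1_def q2_def src_Q_iff y_def[symmetric])
  \<comment> \<open>The right-hand side does not involve \<gamma>: the action law splits q as q1 q2,
    and each factor takes a prescribed value.\<close>
  have val: "\<gamma> q p = mp (act1 (u b) p) (ip (act1 (cm_pair G k e0) (pu (sp (act1 (u b) p)))))"
    if \<gamma>: "left_action Q P1 tp \<gamma>" "alpha_H_cases G P act1 act0 \<gamma>" for \<gamma>
  proof -
    let ?p = "act1 (u b) p"
    have p': "?p \<in> pts P1" "tp ?p = y" using b p by (simp_all add: y_def w_def)
    have "\<gamma> q p = \<gamma> q1 (\<gamma> q2 p)"
      using left_actionD(5)[OF \<gamma>(1), of q1 q2 p] qs p s2 s12 prod by simp
    also have "\<gamma> q2 p = ?p"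
    proof -
      have "act1 (u b) (pu w) = act1 (u b) (pu (tp p))" by (simp only: w_def)
      moreover have "act1 (u b) (pu w) \<in> pts P1" using b w by simp
      ultimately show ?thesis
        using \<gamma>(2)[unfolded alpha_H_cases_def, rule_format, of b "act1 (u b) (pu w)" p] b(1) p s2
        unfolding q2_def by blast
    qed
    also have "\<gamma> q1 ?p = mp ?p (ip (act1 (cm_pair G k e0) (pu (sp ?p))))"
    proof -
      have "src Q q1 = tp ?p" using s12 p' b w y by (simp add: q2_def y_def[symmetric])
      moreover have "k \<in> cm_ker G" using k by (simp add: cm_ker_iff)
      moreover have "act1 (iv k) (pu y) = act1 (cm_pair G (ih k) (cm_bd G k)) (pu (tp ?p))" "t k = cm_bd G k"
        unfolding p'(2) cm_pair_inverse[OF k] by (simp_all add: cm_bd_def)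
      moreover have "act1 (iv k) (pu y) \<in> pts P1" "t k \<in> pts G0" using k y by simp_all
      ultimately show ?thesis
        using \<gamma>(2)[unfolded alpha_H_cases_def, rule_format, of "t k" "act1 (iv k) (pu y)" ?p] p'(1)
        unfolding q1_def by blast
    qed
    finally show ?thesis .
  qed
  show ?thesis using val[OF b1] val[OF b2] by simp
qed

subsection \<open>The action of the 2-group on the bundle gerbe\<close>

abbreviation "ga \<equiv> gerbe_act G act1"

text \<open>With k the K-part of g, the first component \<partial>(k) s(g) is t(g), and the acting
  element (k^-1, \<partial>(k)) is the vertical inverse of k. All later computations with the action
  use this form.\<close>

lemma gerbe_act_eq:
  assumes g: "g \<in> pts G1" and x: "x \<in> pts P1"
  shows "ga g (s g, x) = (t g, act1 (iv (cm_part G g)) x)"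
  using cm_pair_inverse[of "cm_part G g"] cm_part_props[OF g] g
  by (simp add: gerbe_act_def Let_def) (simp add: cm_bd_def)

text \<open>This is the rule (k, \<partial>(k') g)(k', g) = (k k', g) for the groupoid composition.
  It follows by interchange from g = k 1_(t h) and h = 1 h.\<close>

lemma cm_part_mv:
  assumes g: "g \<in> pts G1" "h \<in> pts G1" "s g = t h"
  shows "cm_part G (mv g h) = mh (cm_part G g) (cm_part G h)"
proof -
  note c = cm_part_props[OF g(1)]
  have "mv g h = mv (mh (cm_part G g) (u (t h))) (mh e1 h)" using c(4) g by simp
  also have "\<dots> = mh (mv (cm_part G g) e1) (mv (u (t h)) h)"
    using c g by (intro interchange[symmetric]) simp_all
  also have "mv (cm_part G g) e1 = cm_part G g" using V_laws(5)[OF c(1)] c(2) by simp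
  finally have eq: "mv g h = mh (cm_part G g) h" using g by simp
  have "cm_part G (mv g h) = mh (mv g h) (u (i0 (s h)))" using g by (simp add: cm_part_def)
  also have "\<dots> = mh (cm_part G g) (mh h (u (i0 (s h))))"
    unfolding eq using g c by (intro H_assoc) simp_all
  finally show ?thesis using g by (simp add: cm_part_def[of G h])
qed

text \<open>The K-part of a product in G_1 is c (^a c'), with c, c' the K-parts of the factors and a
  = s(g). Its vertical inverse is rewritten as a vertical composite, so that one factor acts on x
  and the other on ^a x'; in the latter, conjugation by a cancels.\<close>

lemma gerbe_act_mul:
  assumes g: "g \<in> pts G1" "g' \<in> pts G1" and x: "x \<in> pts P1" "x' \<in> pts P1" and src: "sp x = act0 (s g) (tp x')"
  shows "ga (mh g g') (mul Q (s g, x) (s g', x')) = mul Q (ga g (s g, x)) (ga g' (s g', x'))"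
proof -
  let ?c = "cm_part G g" and ?c' = "cm_part G g'" and ?a = "s g"
  note c = cm_part_props[OF g(1)] and c' = cm_part_props[OF g(2)]
  \<comment> \<open>The element ^a c', where the crossed module action is conjugation by
    1_a.\<close>
  let ?d = "mh (mh (u ?a) ?c') (u (i0 ?a))"
  have d: "?d \<in> pts G1" "s ?d = e0" "t ?d = m0 (m0 ?a (t ?c')) (i0 ?a)" using c' g by simp_all
  have cm: "cm_part G (mh g g') = mh ?c ?d"
  proof -
    have "cm_part G (mh g g') = mh (mh g g') (u (m0 (i0 (s g')) (i0 ?a)))"
      using g by (simp add: cm_part_def)
    also have "\<dots> = mh (mh (mh ?c (u ?a)) (mh ?c' (u (s g')))) (mh (u (i0 (s g'))) (u (i0 ?a)))"
      using g c(4) c'(4) by simp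
    also have "\<dots> = mh ?c (mh (u ?a) (mh ?c' (mh (u (s g')) (mh (u (i0 (s g'))) (u (i0 ?a))))))"
      using g c(1) c'(1) by (simp only: H_assoc closed H_laws)
    also have "mh (u (s g')) (mh (u (i0 (s g'))) (u (i0 ?a))) = u (i0 ?a)"
      using g by simp
    finally show ?thesis using g c(1) c'(1) by (simp add: H_assoc)
  qed
  let ?y = "act1 (u ?a) x'"
  have y: "?y \<in> pts P1" "sp x = tp ?y" using g x src by simp_all
  \<comment> \<open>The group product (iv c)(iv d) equals the vertical composite of iv c with
    1_\<partial>(c) (iv d); only in this form can it be distributed over a product in P.\<close>
  have "act1 (iv (mh ?c ?d)) (mp x ?y) = act1 (mv (iv ?c) (mh (u (t ?c)) (iv ?d))) (mp x ?y)"
  proof -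
    have "mv (iv ?c) (mh (u (t ?c)) (iv ?d)) = mv (mh (iv ?c) e1) (mh (u (t ?c)) (iv ?d))" using c by simp
    also have "\<dots> = mh (mv (iv ?c) (u (t ?c))) (mv e1 (iv ?d))"
      using c d g by (intro interchange[symmetric]) simp_all
    also have "\<dots> = mh (iv ?c) (iv ?d)"
      using V_laws(5)[of "iv ?c"] V_laws(6)[of "iv ?d"] c d by simp
    finally show ?thesis using c(1) d(1) by (simp add: iv_mh)
  qed
  also have "\<dots> = mp (act1 (iv ?c) x) (act1 (mh (u (t ?c)) (iv ?d)) ?y)"
    using c d x y g by (intro act_mul[symmetric]) simp_all
  also have "act1 (mh (u (t ?c)) (iv ?d)) ?y = act1 (mh (mh (u (t ?c)) (iv ?d)) (u ?a)) x'"
    using c d x g by simp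
  \<comment> \<open>Inversion commutes with the conjugation defining d, so the factor 1_a on the
    right cancels and 1_\<partial>(c) 1_a becomes 1_(t g).\<close>
  also have "mh (mh (u (t ?c)) (iv ?d)) (u ?a) = mh (u (t g)) (iv ?c')"
  proof -
    have "iv ?d = mh (mh (u ?a) (iv ?c')) (u (i0 ?a))"
      using c' g by (simp add: iv_mh)
    then have "mh (mh (u (t ?c)) (iv ?d)) (u ?a) = mh (mh (u (t ?c)) (u ?a)) (mh (iv ?c') (mh (u (i0 ?a)) (u ?a)))"
      using c(1) c'(1) g by (simp only: H_assoc closed H_laws)
    then show ?thesis using c(1,3) c'(1) g by simp
  qed
  finally have "act1 (iv (mh ?c ?d)) (mp x ?y) = mp (act1 (iv ?c) x) (act1 (u (t g)) (act1 (iv ?c') x'))"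
    using c' g x by simp
  then show ?thesis
    using gerbe_act_eq[of "mh g g'" "mp x ?y"] gerbe_act_eq[OF g(1) x(1)] gerbe_act_eq[OF g(2) x(2)] g x y
    by (simp add: cm)
qed

text \<open>For composable elements of the groupoid the K-parts multiply, and \<open>iv\<close>
  preserves the order of group products; hence the two elements act successively.\<close>

lemma gerbe_action: "left_action (ver1 G) Q1 fst ga"
proof -
  have tr: "transversal G1 s G0 fst Q1"
    using lie_groupoidD(3)[OF lie_v] manifolds Q1_manifold smooth_map_fst_snd(1)[OF manifolds(2,3)] by (simp add: transversal_def)
  have "smooth_map (fibre_product G1 s G0 fst Q1) Q1 (\<lambda>(g, w). ga g w)"
    unfolding gerbe_act_def cm_part_def cm_bd_def cm_pair_def Let_def case_prod_unfold
    by (intro smooth_ops fibre_product_manifold[OF tr] fibre_product_fst[OF tr] fibre_product_snd[OF tr])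
  moreover have "ga (u (fst w)) w = w" if "w \<in> pts Q1" for w
    using that gerbe_act_eq[of "u (fst w)" "snd w"] groupoid_inverse_props(1)[OF lie_v, of e0] by (auto simp: cm_part_def)
  moreover have "fst (ga g w) = t g" if "g \<in> pts G1" "w \<in> pts Q1" "s g = fst w" for g w
    using that gerbe_act_eq[of g "snd w"] by auto
  moreover have "ga (mv g h) w = ga g (ga h w)" if "g \<in> pts G1" "h \<in> pts G1" "w \<in> pts Q1" "s g = t h" "s h = fst w" for g h w
  proof -
    note gw = that
    obtain x where w: "w = (s h, x)" "x \<in> pts P1" using \<open>w \<in> pts Q1\<close> \<open>s h = fst w\<close> by auto
    note c = cm_part_props[OF gw(1)] cm_part_props[OF gw(2)]
    have "ga (mv g h) w = (t g, act1 (iv (mh (cm_part G g) (cm_part G h))) x)"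
      using gerbe_act_eq[of "mv g h" x] gw(1,2,4) w by (simp add: cm_part_mv)
    also have "\<dots> = (t g, act1 (iv (cm_part G g)) (act1 (iv (cm_part G h)) x))"
      using c w by (simp add: iv_mh)
    also have "\<dots> = ga g (ga h w)"
      using gerbe_act_eq[of h x] gerbe_act_eq[of g "act1 (iv (cm_part G h)) x"] gw(1,2,4) w c by simp
    finally show ?thesis .
  qed
  ultimately show ?thesis
    unfolding left_action_def using smooth_map_fst_snd(1)[OF manifolds(2,3)] by simp
qed

abbreviation "F0 \<equiv> fibre_product P0 \<pi> M \<pi> P0"
abbreviation "ends \<equiv> \<lambda>w. (tgt Q w, src Q w)"

lemma F0_transversal: "transversal P0 \<pi> M \<pi> P0"
  using transversal_self[OF manifolds(4,5)] pi_sub by (simp add: surj_submersion_def)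

lemma F0_manifold: "is_manifold F0" by (rule fibre_product_manifold[OF F0_transversal])

text \<open>After the change of variables \<open>b = \<delta>(t(x), s(x)) a\<close>, \<open>x' = \<^sup>b\<^sup>\<inverse>x\<close> on \<open>Q\<^sub>1\<close>, where \<open>\<delta>\<close> is the division
  map of \<open>P\<^sub>0\<close>, and with \<open>P\<^sub>0 \<times>\<^sub>M P\<^sub>0 \<cong> G\<^sub>0 \<times> P\<^sub>0\<close>, the map \<open>(t, s)\<close> becomes \<open>(b, x') \<mapsto> (b, t(x'))\<close>.\<close>

lemma ends_submersion: "surj_submersion Q1 F0 ends"
proof -
  note GP = is_manifold_prod[OF manifolds(2,4)]
  \<comment> \<open>The multiplier depends on x alone, so multiplication by its inverse undoes the
    map.\<close>
  have d1: "diffeomorphism Q1 Q1 (\<lambda>w. (m0 (dv0 (tp (snd w)) (sp (snd w))) (fst w), snd w))"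
    by (rule diffeomorphismI[where g = "\<lambda>w. (m0 (i0 (dv0 (tp (snd w)) (sp (snd w)))) (fst w), snd w)"])
      (auto intro!: smooth_ops smooth_dv smooth_map_id Q1_manifold simp: dv0_props)
  have d2: "diffeomorphism (prod_manifold G0 P0) F0 (\<lambda>w. (act0 (fst w) (snd w), snd w))"
  proof (rule diffeomorphismI[where g = "\<lambda>w. (dv0 (fst w) (snd w), snd w)"])
    show "smooth_map (prod_manifold G0 P0) F0 (\<lambda>w. (act0 (fst w) (snd w), snd w))"
      by (rule smooth_map_fibre_pair[OF F0_transversal GP])
        (auto intro!: smooth_ops GP smooth_map_fst_snd manifolds)
    show "smooth_map F0 (prod_manifold G0 P0) (\<lambda>w. (dv0 (fst w) (snd w), snd w))"
      by (rule smooth_map_pair[OF F0_manifold manifolds(2,4)])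
        (auto intro!: smooth_dv F0_manifold fibre_product_fst[OF F0_transversal] fibre_product_snd[OF F0_transversal]
          simp: pts_fibre_product)
  qed (auto simp: pts_fibre_product dv0_props)
  define f1 where "f1 w = (m0 (dv0 (tp (snd w)) (sp (snd w))) (fst w), snd w)" for w
  define f2 where "f2 w = (fst w, act1 (u (i0 (fst w))) (snd w))" for w
  define f3 where "f3 w = (fst w, tp (snd w))" for w :: "'g0 \<times> 'p1"
  define f4 where "f4 w = (act0 (fst w) (snd w), snd w)" for w
  have "submersion Q1 (prod_manifold G0 P0) f3"
    unfolding f3_def by (rule submersion_id_times[OF manifolds(2,3,4) lie_groupoidD(4)[OF lie_P]])
  from submersion_compose[OF Q1_manifold GP F0_manifold this submersion_diffeomorphism[OF GP F0_manifold d2[folded f4_def]]]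
  have "submersion Q1 F0 (\<lambda>w. f4 (f3 w))" .
  from submersion_compose[OF Q1_manifold Q1_manifold F0_manifold
      submersion_diffeomorphism[OF Q1_manifold Q1_manifold Q1_shear[folded f2_def]] this]
  have "submersion Q1 F0 (\<lambda>w. f4 (f3 (f2 w)))" .
  from submersion_compose[OF Q1_manifold Q1_manifold F0_manifold
      submersion_diffeomorphism[OF Q1_manifold Q1_manifold d1[folded f1_def]] this]
  have "submersion Q1 F0 (\<lambda>w. f4 (f3 (f2 (f1 w))))" .
  moreover have "f4 (f3 (f2 (f1 w))) = ends w" if w0: "w \<in> pts Q1" for w
  proof -
    obtain a x where w: "w = (a, x)" "a \<in> pts G0" "x \<in> pts P1" using w0 by auto
    let ?d = "dv0 (tp x) (sp x)"
    have d: "?d \<in> pts G0" "act0 ?d (sp x) = tp x" using w dv0_props(2,3) by simp_all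
    \<comment> \<open>This is the target of x'. As \<delta> carries s(x) to t(x), it cancels and the
      source of (a, x) in Q remains.\<close>
    have "act0 (i0 (m0 ?d a)) (tp x) = act0 (i0 (m0 ?d a)) (act0 ?d (sp x))" by (simp only: d(2))
    also have "\<dots> = act0 (i0 a) (sp x)" using d(1) w by (simp add: G0_assoc)
    finally show ?thesis using w d by (simp add: f1_def f2_def f3_def f4_def)
  qed
  ultimately have sub: "submersion Q1 F0 ends" by (rule submersion_cong[OF Q1_manifold F0_manifold])
  have "ends ` pts Q1 = pts F0"
  proof -
    have "z \<in> ends ` pts Q1" if z: "z \<in> pts F0" for z
    proof -
      obtain x y where xy: "z = (x, y)" "x \<in> pts P0" "y \<in> pts P0" "\<pi> x = \<pi> y" using z by (auto simp: pts_fibre_product)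
      \<comment> \<open>A preimage of (x, y) is the unit at x together with the element of G_0
        carrying y to x.\<close>
      then show ?thesis
        using dv0_props(2,3)[of x y] act0_cancel[of "dv0 x y" x y]
        by (intro image_eqI[where x = "(dv0 x y, pu x)"]) simp_all
    qed
    then show ?thesis using smooth_map_in[OF submersionD[OF sub]] by blast
  qed
  with sub show ?thesis by (simp add: surj_submersion_def)
qed

lemma gerbe_principal: "principal_left_bundle (ver1 G) Q1 fst ga F0 ends"
\<comment> \<open>If (b, y) is g (a, x) and c is the K-part of g, then y = ^(iv c) x. Division in
  P_1 gives iv c, hence c, and g = c 1_a.\<close>
proof (rule principal_left_bundleI[OF lie_v Q1_manifold F0_manifold gerbe_action ends_submersion,
      where \<delta> = "\<lambda>w' w. mh (iv (dv1 (snd w') (snd w))) (u (fst w))"])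
  have tr: "transversal Q1 ends F0 ends Q1"
    using transversal_self[OF Q1_manifold F0_manifold] ends_submersion by (simp add: surj_submersion_def)
  have pi_eq: "\<pi> (sp (snd w)) = \<pi> (sp (snd w'))" if "w \<in> pts Q1" "w' \<in> pts Q1" "ends w = ends w'" for w w'
  proof -
    have "snd w \<in> pts P1" "snd w' \<in> pts P1" using that by auto
    moreover have "\<pi> (tp (snd w)) = \<pi> (tp (snd w'))" using that(3) by (auto simp: case_prod_unfold)
    ultimately show ?thesis by simp
  qed
  show "smooth_map (fibre_product Q1 ends F0 ends Q1) G1 (\<lambda>z. mh (iv (dv1 (snd (fst z)) (snd (snd z)))) (u (fst (snd z))))"
    by (intro smooth_ops smooth_dv fibre_product_manifold[OF tr] fibre_product_fst[OF tr] fibre_product_snd[OF tr] pi_eq)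
      (auto simp: pts_fibre_product)
  show "ends (ga g w) = ends w" if "g \<in> pts G1" "w \<in> pts Q1" "s g = fst w" for g w
  proof -
    note gw = that
    obtain x where w: "w = (s g, x)" "x \<in> pts P1" using gw by auto
    note c = cm_part_props[OF gw(1)]
    have "act0 (i0 (t g)) (act0 (m0 (t g) (i0 (s g))) (sp x)) = act0 (i0 (s g)) (sp x)"
      using gw(1) w by (simp add: G0_assoc)
    then show ?thesis using gerbe_act_eq[OF gw(1) w(2)] w c by simp
  qed
  show "s (mh (iv (dv1 (snd w') (snd w))) (u (fst w))) = fst w \<and> ga (mh (iv (dv1 (snd w') (snd w))) (u (fst w))) w = w'"
    if ww: "w' \<in> pts Q1" "w \<in> pts Q1" "ends w' = ends w" for w' w
  proof -
    obtain b y where w': "w' = (b, y)" "b \<in> pts G0" "y \<in> pts P1" using ww by auto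
    obtain a x where w: "w = (a, x)" "a \<in> pts G0" "x \<in> pts P1" using ww by auto
    have e: "tp y = tp x" "act0 (i0 b) (sp y) = act0 (i0 a) (sp x)" using ww(3) by (simp_all add: w w')
    let ?k = "dv1 y x"
    have k: "?k \<in> pts G1" "act1 ?k x = y" using dv1_props(2,3)[of y x] pi_eq[OF ww] w w' by simp_all
    \<comment> \<open>As x and y have the same target and G_0 acts freely, the element carrying x to
      y has trivial target; its vertical inverse therefore lies in K.\<close>
    have tk: "t ?k = e0" by (rule act0_free[of _ _ "tp x"]) (use k w e act_morphism(2)[of ?k x] in auto)
    define z where "z = act0 (i0 a) (sp x)"
    have z: "z \<in> pts P0" "sp x = act0 a z" "sp y = act0 b z"
      using w w' e act0_cancel[of a "sp x" z] act0_cancel[of b "sp y" z] by (simp_all add: z_def)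
    \<comment> \<open>Both sources are translates of the common point z, so freeness turns the
      action of k on sources into an equation in G_0.\<close>
    have b: "b = m0 (s ?k) a"
      by (rule act0_free[of _ _ z]) (use k w w' z act_morphism(1)[of ?k x] in auto)
    let ?g = "mh (iv ?k) (u a)"
    have g: "?g \<in> pts G1" "s ?g = a" "t ?g = b" using k w tk b by simp_all
    have "cm_part G ?g = iv ?k"
      using H_assoc[of "iv ?k" "u a" "u (i0 a)"] k w tk by (simp add: cm_part_def)
    then show ?thesis using gerbe_act_eq[OF g(1) w(3)] g k w w' by simp
  qed
  show "mh (iv (dv1 (snd (ga g w)) (snd w))) (u (fst w)) = g" if "g \<in> pts G1" "w \<in> pts Q1" "s g = fst w" for g w
  proof -
    note gw = that
    obtain x where w: "w = (s g, x)" "x \<in> pts P1" using gw by auto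
    note c = cm_part_props[OF gw(1)]
    show ?thesis using gerbe_act_eq[OF gw(1) w(2)] w c dv1_props(4) by simp
  qed
qed

subsection \<open>The sides of the square\<close>

lemma pi_smooth: "smooth_map P0 M \<pi>"
  using pi_sub by (simp add: surj_submersion_def submersionD)

lemma smooth_map_point: "is_manifold Z \<Longrightarrow> smooth_map Z point_manifold (\<lambda>_. ())"
  by (rule smooth_map_const) (simp_all add: point_manifold)

lemma top_side_morphism: "horizontal_morphism (manifold_dg M) G (top_side P act1 act0 \<pi>)"
proof -
  have "groupoid_morphism P (unit_groupoid point_manifold) (\<lambda>_. ()) (\<lambda>_. ())"
    by (simp add: groupoid_morphism_def smooth_map_point manifolds)
  moreover have "groupoid_morphism P (unit_groupoid M) (\<lambda>p. \<pi> (sp p)) \<pi>"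
    using smooth_map_compose[OF manifolds(3,4,5) lie_groupoidD(5)[OF lie_P] pi_smooth] pi_smooth
    by (simp add: groupoid_morphism_def)
  moreover have "left_action_morphism (ver1 G) (\<lambda>_. ()) (\<lambda>_. ()) P (\<lambda>_. ()) (\<lambda>_. ()) act1 act0"
    using principal by (simp add: principal_2_bundle_def)
  then have "left_action_morphism (ver1 G) (src (hor1 G)) (src (hor0 G)) P (\<lambda>_. ()) (\<lambda>_. ()) act1 act0"
    by (simp add: left_action_morphism_def)
  moreover have "right_action_morphism (unit_groupoid M) (\<lambda>x. x) (\<lambda>x. x) P (\<lambda>p. \<pi> (sp p)) \<pi> (\<lambda>p m. p) (\<lambda>x m. x)"
    by (simp add: right_action_morphism_def left_action_morphism_def)
  ultimately show ?thesis
    using hs_bibundle_unit[OF lie_h1 manifolds(3,5) pb1] hs_bibundle_unit[OF lie_h0 manifolds(4,5) pb0] lie_P ver0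
    unfolding horizontal_morphism_def top_side_def manifold_dg_def by simp
qed

text \<open>The pair (p, q) is itself the unique arrow from q to p, so the division map is the
  identity of P_0 \<times>_M P_0.\<close>

lemma bottom_action_principal:
  "principal_left_bundle (submersion_groupoid P0 M \<pi>) P0 (\<lambda>x. x) (\<lambda>(x, y) z. x) M \<pi>"
proof -
  have sub: "submersion P0 M \<pi>" using pi_sub by (simp add: surj_submersion_def)
  note S = lie_groupoid_submersion[OF manifolds(4,5) sub]
  have tr: "transversal F0 snd P0 (\<lambda>x. x) P0"
    using lie_groupoidD(1,3)[OF S] manifolds by (simp add: transversal_def smooth_map_id)
  have "smooth_map (fibre_product F0 snd P0 (\<lambda>x. x) P0) P0 (\<lambda>z. fst (fst z))"
    by (rule smooth_map_compose[OF fibre_product_manifold[OF tr] F0_manifold manifolds(4) fibre_product_fst[OF tr] fibre_product_fst[OF F0_transversal]])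
  then have la: "left_action (submersion_groupoid P0 M \<pi>) P0 (\<lambda>x. x) (\<lambda>(x, y) z. x)"
    by (auto simp: left_action_def case_prod_unfold smooth_map_id manifolds)
  show ?thesis
  proof (rule principal_left_bundleI[OF S manifolds(4,5) la pi_sub, where \<delta> = Pair])
    show "smooth_map F0 (arr (submersion_groupoid P0 M \<pi>)) (\<lambda>z. (fst z, snd z))"
      using smooth_map_id[OF F0_manifold] by simp
  qed (auto simp: pts_fibre_product)
qed

lemma bottom_side_morphism:
  "horizontal_morphism (manifold_dg M) (submersion_dg P0 M \<pi>) (bottom_side P0 \<pi>)"
proof -
  have sub: "submersion P0 M \<pi>" using pi_sub by (simp add: surj_submersion_def)
  note S = lie_groupoid_submersion[OF manifolds(4,5) sub]
  note hs = hs_bibundle_unit[OF S manifolds(4,5) bottom_action_principal]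
  have "left_action_morphism (unit_groupoid F0) snd snd (unit_groupoid P0) (\<lambda>x. x) (\<lambda>x. x) (\<lambda>(x, y) z. x) (\<lambda>(x, y) z. x)"
    by (auto simp: left_action_morphism_def)
  moreover have "right_action_morphism (unit_groupoid M) (\<lambda>x. x) (\<lambda>x. x) (unit_groupoid P0) \<pi> \<pi> (\<lambda>x m. x) (\<lambda>x m. x)"
    by (simp add: right_action_morphism_def left_action_morphism_def)
  ultimately show ?thesis
    using hs lie_groupoid_unit[OF manifolds(4)] groupoid_morphism_unit[OF smooth_map_id[OF manifolds(4)]] groupoid_morphism_unit[OF pi_smooth]
    unfolding horizontal_morphism_def bottom_side_def manifold_dg_def submersion_dg_def Let_def by simp
qed

lemma unit_action_principal:
  assumes N: "is_manifold N" shows "principal_left_bundle (unit_groupoid N) N (\<lambda>x. x) (\<lambda>m x. x) N (\<lambda>x. x)"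
proof -
  note tr = transversal_id[OF N]
  have la: "left_action (unit_groupoid N) N (\<lambda>x. x) (\<lambda>m x. x)"
    using fibre_product_snd[OF tr] by (simp add: left_action_def case_prod_unfold smooth_map_id N)
  show ?thesis
    by (rule principal_left_bundleI[OF lie_groupoid_unit[OF N] N N la surj_submersion_id[OF N], where \<delta> = "\<lambda>p q. q"])
      (use fibre_product_snd[OF tr] in simp_all)
qed

lemma identity_side_morphism: "vertical_morphism (manifold_dg M) (manifold_dg M) (identity_side M)"
  using hs_bibundle_unit[OF lie_groupoid_unit[OF manifolds(5)] manifolds(5,5) unit_action_principal[OF manifolds(5)]]
    groupoid_morphism_unit[OF smooth_map_id[OF manifolds(5)]] lie_groupoid_unit[OF manifolds(5)]
  unfolding vertical_morphism_def horizontal_morphism_def identity_side_def manifold_dg_def transpose_dg_def Let_def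
  by (simp add: right_action_morphism_def left_action_morphism_def)

lemma point_action_principal:
  assumes N: "is_manifold N"
  shows "principal_left_bundle (unit_groupoid point_manifold) N (\<lambda>_. ()) (\<lambda>u x. x) N (\<lambda>x. x)"
proof -
  have tr: "transversal point_manifold (\<lambda>x. x) point_manifold (\<lambda>_. ()) N"
    unfolding transversal_def by (intro conjI disjI1 point_manifold N submersion_id smooth_map_point)
  have la: "left_action (unit_groupoid point_manifold) N (\<lambda>_. ()) (\<lambda>u x. x)"
    using fibre_product_snd[OF tr] by (simp add: left_action_def case_prod_unfold smooth_map_point N)
  show ?thesis
    by (rule principal_left_bundleI[OF lie_groupoid_unit[OF point_manifold(1)] N N la surj_submersion_id[OF N], where \<delta> = "\<lambda>p q. ()"])
      (use smooth_map_point[OF fibre_product_manifold[OF transversal_id[OF N]]] in simp_all)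
qed

text \<open>After transposition the groupoid G_1 over G_0 acts on Q_1, and the groupoid over the
  point acts trivially on P_0. That the action is a morphism for Q means invariance of both ends and
  \<open>gerbe_act_mul\<close>.\<close>

lemma left_side_morphism: "vertical_morphism (submersion_dg P0 M \<pi>) G (left_side G P act1 act0)"
proof -
  have 1: "groupoid_morphism Q (hor0 G) fst (\<lambda>_. ())"
    using smooth_map_fst_snd(1)[OF manifolds(2,3)]
    by (simp add: groupoid_morphism_def smooth_map_point manifolds del: prod_manifold_simps) auto
  have 2: "groupoid_morphism Q (submersion_groupoid P0 M \<pi>) ends (\<lambda>x. x)"
    unfolding groupoid_morphism_def
  proof (intro conjI ballI impI)
    show "smooth_map (arr Q) (arr (submersion_groupoid P0 M \<pi>)) ends"
      using ends_submersion by (simp only: Q_simps(1) submersion_groupoid_simps surj_submersion_def submersionD)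
    show "smooth_map (obj Q) (obj (submersion_groupoid P0 M \<pi>)) (\<lambda>x. x)"
      by (simp add: smooth_map_id manifolds)
    show "ends (one Q x) = one (submersion_groupoid P0 M \<pi>) x" if "x \<in> pts (obj Q)" for x
      using that by simp
    show "ends (mul Q g h) = mul (submersion_groupoid P0 M \<pi>) (ends g) (ends h)"
      if "g \<in> pts (arr Q)" "h \<in> pts (arr Q)" "src Q g = tgt Q h" for g h
      unfolding lie_groupoidD(12)[OF lie_Q that] lie_groupoidD(13)[OF lie_Q that] by simp
  qed simp_all
  have 3: "hs_bibundle (unit_groupoid F0) (ver1 G) \<lparr>tot = Q1, lmom = fst, rmom = ends, lact = ga, ract = (\<lambda>q z. q)\<rparr>"
    by (rule hs_bibundle_unit[OF lie_v Q1_manifold F0_manifold gerbe_principal])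
  have 4: "hs_bibundle (unit_groupoid P0) (ver0 G) \<lparr>tot = P0, lmom = (\<lambda>_. ()), rmom = (\<lambda>x. x), lact = (\<lambda>u x. x), ract = (\<lambda>x y. x)\<rparr>"
    unfolding ver0 by (rule hs_bibundle_unit[OF lie_groupoid_unit[OF point_manifold(1)] manifolds(4,4) point_action_principal[OF manifolds(4)]])
  have 5: "left_action_morphism (hor1 G) s (\<lambda>_. ()) Q fst (\<lambda>_. ()) ga (\<lambda>u x. x)"
    unfolding left_action_morphism_def
  proof (intro conjI ballI impI)
    fix v w assume v: "v \<in> pts (arr (hor1 G))" "w \<in> pts (arr Q)" "s v = fst w"
    have "ends (ga v w) = ends w"
      using gerbe_principal v unfolding principal_left_bundle_def by (simp del: Q_simps(3,4) prod_manifold_simps)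
    then show "src Q (ga v w) = src Q w" "tgt Q (ga v w) = tgt Q w" by (simp_all del: Q_simps)
  next
    fix v x assume x: "x \<in> pts (obj Q)"
    have e: "one (hor1 G) v = u e0" by simp
    show "ga (one (hor1 G) v) (one Q x) = one Q x"
      unfolding e using left_actionD(4)[OF gerbe_action, of "(e0, pu x)"] x by simp
  next
    fix v v' w w' assume v: "v \<in> pts (arr (hor1 G))" "v' \<in> pts (arr (hor1 G))" and w: "w \<in> pts (arr Q)" "w' \<in> pts (arr Q)"
      and c: "s v = fst w \<and> s v' = fst w' \<and> src (hor1 G) v = tgt (hor1 G) v' \<and> src Q w = tgt Q w'"
    obtain x x' where x: "w = (s v, x)" "x \<in> pts P1" "w' = (s v', x')" "x' \<in> pts P1" using w c by auto
    show "ga (mh v v') (mul Q w w') = mul Q (ga v w) (ga v' w')"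
      unfolding x(1,3)
    proof (rule gerbe_act_mul)
      have "src Q (s v, x) = tgt Q (s v', x')" using c unfolding x(1,3) by blast
      then show "sp x = act0 (s v) (tp x')" using v(1) x(2,4) by (simp add: src_Q_iff)
    qed (use v x(2,4) in simp_all)
  qed
  have 6: "right_action_morphism (submersion_groupoid P0 M \<pi>) (\<lambda>x. x) (\<lambda>x. x) Q ends (\<lambda>x. x) (\<lambda>q z. q) (\<lambda>x y. x)"
    by (simp add: right_action_morphism_def left_action_morphism_def del: Q_simps(3,4))
  have 7: "src (ver0 G) = (\<lambda>_. ())" by (simp add: ver0)
  show ?thesis
    unfolding vertical_morphism_def horizontal_morphism_def left_side_def submersion_dg_def transpose_dg_def Let_def
    using lie_Q 1 2 3 4 5 6 7 by (simp del: Q_simps(3-7) prod_manifold_simps)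
qed

subsection \<open>The interchange law at the upper left corner\<close>

text \<open>With c the K-part of g, the action on x contributes iv c at the left end of the product
  x (^a w)(^a d^-1), while the action on d contributes at the right end. Passing iv c to the right
  end leaves ^(iv c)(^a d^-1) there, which is (^g d)^-1 because iv g = (iv c) 1_a.\<close>

lemma upper_left_interchange:
  assumes g: "g \<in> pts G1" and d: "d \<in> pts P1" and x: "x \<in> pts P1" and w: "w \<in> pts P1"
    and src: "sp d = sp w" "sp x = act0 (s g) (tp w)"
  shows "alpha_V P (act1 g d) (aH (s g, x) w) = aH (ga g (s g, x)) (alpha_V P d w)"
proof -
  let ?c = "cm_part G g" and ?y = "mp x (act1 (u (s g)) w)" and ?e = "act1 (u (s g)) (ip d)"
  note c = cm_part_props[OF g]
  have dw: "mp w (ip d) \<in> pts P1" using d w src by simp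
  have "aH (ga g (s g, x)) (alpha_V P d w) = mp (act1 (iv ?c) x) (act1 (u (t g)) (mp w (ip d)))"
    using gerbe_act_eq[OF g x] by (simp add: aH_def alpha_V_def)
  also have "act1 (u (t g)) (mp w (ip d)) = act1 (u (t ?c)) (act1 (u (s g)) (mp w (ip d)))"
    using g dw c by simp
  also have "mp (act1 (iv ?c) x) \<dots> = act1 (mv (iv ?c) (u (t ?c))) (mp x (act1 (u (s g)) (mp w (ip d))))"
    using c g d x w src by (intro act_mul) simp_all
  \<comment> \<open>The passage from left to right: iv c may be composed with the unit at its source
    or with the unit at its target, and the product in P is regrouped in between.\<close>
  also have "mv (iv ?c) (u (t ?c)) = mv e1 (iv ?c)"
    using V_laws(5)[of "iv ?c"] V_laws(6)[of "iv ?c"] c by simp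
  also have "mp x (act1 (u (s g)) (mp w (ip d))) = mp ?y ?e"
    using g d x w src by (simp add: act_mul_u P_assoc)
  also have "act1 (mv e1 (iv ?c)) (mp ?y ?e) = mp (act1 e1 ?y) (act1 (iv ?c) ?e)"
    using c g d x w src by (intro act_mul[symmetric]) simp_all
  also have "act1 (iv ?c) ?e = act1 (iv g) (ip d)"
  proof -
    have "iv g = iv (mh ?c (u (s g)))" by (simp only: c(4))
    also have "\<dots> = mh (iv ?c) (u (s g))" using c(1) g by (simp add: iv_mh)
    finally show ?thesis using c(1) g d by simp
  qed
  finally show ?thesis
    using g d x w src by (simp add: aH_def alpha_V_def act_ip)
qed

lemma aH_moments:
  assumes "q \<in> pts Q1" "p \<in> pts P1" "src Q q = tp p"
  shows "sp (aH q p) = act0 (fst q) (sp p)" "tp (aH q p) = tgt Q q"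
  using assms by (auto simp: aH_def src_Q_iff)

text \<open>Away from the upper left corner, each interchange equation involves a right action. All
  right actions here are projections, so both sides coincide by definition; what remains is
  \<open>upper_left_interchange\<close>.\<close>

lemma square:
  "one_one_morphism G (manifold_dg M) (submersion_dg P0 M \<pi>) (manifold_dg M)
     (top_side P act1 act0 \<pi>) (left_side G P act1 act0) (bottom_side P0 \<pi>) (identity_side M)
     (centre_hor P \<pi> aH) (centre_ver P (alpha_V P))"
  unfolding one_one_morphism_def
proof (intro conjI)
  have sub: "submersion P0 M \<pi>" using pi_sub by (simp add: surj_submersion_def)
  show "double_lie_groupoid G" by (rule double)
  show "double_lie_groupoid (manifold_dg M)" "double_lie_groupoid (manifold_dg M)"
    by (rule double_lie_groupoid_manifold[OF manifolds(5)])+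
  show "double_lie_groupoid (submersion_dg P0 M \<pi>)" by (rule double_lie_groupoid_submersion[OF manifolds(4,5) sub])
  show "horizontal_morphism (manifold_dg M) G (top_side P act1 act0 \<pi>)" by (rule top_side_morphism)
  show "vertical_morphism (submersion_dg P0 M \<pi>) G (left_side G P act1 act0)" by (rule left_side_morphism)
  show "horizontal_morphism (manifold_dg M) (submersion_dg P0 M \<pi>) (bottom_side P0 \<pi>)" by (rule bottom_side_morphism)
  show "vertical_morphism (manifold_dg M) (manifold_dg M) (identity_side M)" by (rule identity_side_morphism)
  show "tot (centre_hor P \<pi> aH) = tot (centre_ver P (alpha_V P))" by (simp add: centre_hor_def centre_ver_def)
  show "hs_bibundle (gpd (identity_side M)) (gpd (left_side G P act1 act0)) (centre_hor P \<pi> aH)"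
    using hs_bibundle_unit[OF lie_Q manifolds(3,5) aH_principal]
    by (simp add: identity_side_def left_side_def centre_hor_def Let_def del: Q_simps)
  show "hs_bibundle (gpd (bottom_side P0 \<pi>)) (gpd (top_side P act1 act0 \<pi>)) (centre_ver P (alpha_V P))"
    using hs_bibundle_unit[OF lie_P manifolds(3,4) alpha_V_principal]
    by (simp add: bottom_side_def top_side_def centre_ver_def Let_def)
  show "moments_compatible (bottom_side P0 \<pi>) (left_side G P act1 act0) (identity_side M) (top_side P act1 act0 \<pi>)
     (centre_hor P \<pi> aH) (centre_ver P (alpha_V P))"
    by (simp add: moments_compatible_def bottom_side_def left_side_def identity_side_def top_side_def centre_hor_def centre_ver_def Let_def)
  have aV: "tp (alpha_V P d w) = tp w" if "d \<in> pts P1" "w \<in> pts P1" "sp d = sp w" for d w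
    using that by (simp add: alpha_V_def)
  show "moments_equivariant (bottom_side P0 \<pi>) (left_side G P act1 act0) (identity_side M) (top_side P act1 act0 \<pi>)
     (centre_hor P \<pi> aH) (centre_ver P (alpha_V P))"
    using aV aH_moments
    by (simp add: moments_equivariant_def bottom_side_def left_side_def identity_side_def top_side_def centre_hor_def centre_ver_def Let_def
        del: Q_simps(3-7) prod_manifold_simps)
  show "corner_interchange G (manifold_dg M) (submersion_dg P0 M \<pi>) (manifold_dg M)
     (bottom_side P0 \<pi>) (left_side G P act1 act0) (identity_side M) (top_side P act1 act0 \<pi>)
     (centre_hor P \<pi> aH) (centre_ver P (alpha_V P))"
    unfolding corner_interchange_def
  proof (intro conjI)
    have "alpha_V P (act1 g d) (aH q w) = aH (ga g q) (alpha_V P d w)"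
      if gd: "g \<in> pts G1" "d \<in> pts P1" "q \<in> pts Q1" "w \<in> pts P1" "s g = fst q" "sp d = sp w" "src Q q = tp w" for g d q w
    proof -
      obtain x where q: "q = (s g, x)" "x \<in> pts P1" using gd by auto
      show ?thesis unfolding q(1)
      proof (rule upper_left_interchange)
        have "src Q (s g, x) = tp w" using gd(7) unfolding q(1) .
        then show "sp x = act0 (s g) (tp w)" using gd(1,4) q(2) by (simp add: src_Q_iff)
      qed (use gd(1,2,4,6) q(2) in simp_all)
    qed
    then show "\<forall>k\<in>pts (arr (hor1 G)). \<forall>d\<in>pts (arr (gpd (top_side P act1 act0 \<pi>))). \<forall>b\<in>pts (arr (gpd (left_side G P act1 act0))).
        \<forall>w\<in>pts (tot (centre_hor P \<pi> aH)).
        src (hor1 G) k = lmom (bib1 (top_side P act1 act0 \<pi>)) d \<and> s k = lmom (bib1 (left_side G P act1 act0)) b \<and>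
        src (gpd (top_side P act1 act0 \<pi>)) d = lmom (centre_ver P (alpha_V P)) w \<and>
        src (gpd (left_side G P act1 act0)) b = lmom (centre_hor P \<pi> aH) w \<longrightarrow>
        lact (centre_ver P (alpha_V P)) (lact (bib1 (top_side P act1 act0 \<pi>)) k d) (lact (centre_hor P \<pi> aH) b w) =
        lact (centre_hor P \<pi> aH) (lact (bib1 (left_side G P act1 act0)) k b) (lact (centre_ver P (alpha_V P)) d w)"
      by (simp add: left_side_def top_side_def centre_hor_def centre_ver_def Let_def del: Q_simps(3-7) prod_manifold_simps)
  qed (simp_all add: bottom_side_def left_side_def identity_side_def top_side_def centre_hor_def centre_ver_def Let_def
      del: Q_simps prod_manifold_simps)
qed

end

theorem proposition5p4:
  fixes G :: "('g1, 'g0) two_group"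
    and P :: "('p1, 'p0) groupoid"
    and act1 :: "'g1 \<Rightarrow> 'p1 \<Rightarrow> 'p1" and act0 :: "'g0 \<Rightarrow> 'p0 \<Rightarrow> 'p0"
    and M :: "'m manifold" and \<pi> :: "'p0 \<Rightarrow> 'm"
  assumes "lie_2_group G"
    and "principal_2_bundle G P act1 act0 M \<pi>"
  defines "Q \<equiv> gerbe_groupoid G P act1 act0"
  shows "left_action P (arr P) (src P) (alpha_V P) \<and>
         (\<exists>\<alpha>H. left_action Q (arr P) (tgt P) \<alpha>H \<and>
               alpha_H_cases G P act1 act0 \<alpha>H \<and>
               (\<forall>\<beta>. left_action Q (arr P) (tgt P) \<beta> \<and> alpha_H_cases G P act1 act0 \<beta> \<longrightarrow>
                     (\<forall>q\<in>pts (arr Q). \<forall>p\<in>pts (arr P). src Q q = tgt P p \<longrightarrow> \<beta> q p = \<alpha>H q p)) \<and>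
               one_one_morphism
                 G (manifold_dg M)
                 (submersion_dg (obj P) M \<pi>) (manifold_dg M)
                 (top_side P act1 act0 \<pi>)
                 (left_side G P act1 act0)
                 (bottom_side (obj P) \<pi>)
                 (identity_side M)
                 (centre_hor P \<pi> \<alpha>H)
                 (centre_ver P (alpha_V P)))"
proof -
  interpret B: two_bundle G P act1 act0 M \<pi>
    using assms(1,2) by (rule two_bundle.intro)
  show ?thesis
    unfolding Q_def
  proof (intro conjI exI[of _ B.aH] allI impI ballI)
    show "left_action P (arr P) (src P) (alpha_V P)" by (rule B.alpha_V_action)
    show "left_action (gerbe_groupoid G P act1 act0) (arr P) (tgt P) B.aH" by (rule B.aH_action)
    show "alpha_H_cases G P act1 act0 B.aH" by (rule B.aH_cases)
    show "\<beta> q p = B.aH q p"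
      if "left_action (gerbe_groupoid G P act1 act0) (arr P) (tgt P) \<beta> \<and> alpha_H_cases G P act1 act0 \<beta>"
        "q \<in> pts (arr (gerbe_groupoid G P act1 act0))" "p \<in> pts (arr P)"
        "src (gerbe_groupoid G P act1 act0) q = tgt P p" for \<beta> q p
      by (rule B.alpha_H_unique) (use that B.aH_action B.aH_cases in \<open>simp_all only: B.Q_simps(1)\<close>)
    show "one_one_morphism G (manifold_dg M) (submersion_dg (obj P) M \<pi>) (manifold_dg M)
       (top_side P act1 act0 \<pi>) (left_side G P act1 act0) (bottom_side (obj P) \<pi>) (identity_side M)
       (centre_hor P \<pi> B.aH) (centre_ver P (alpha_V P))" by (rule B.square)
  qed
qed

end
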